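(* The Lie groupoids $X=\mathfrak h^*\times G\times\mathfrak h^*$ and $X^*=H\times\mathfrak h^*\times G^*$ over $\mathfrak h^*$ form a matched pair of Lie groupoids $(X,X^* )$, with matched product $X\ast X^*$ given by the trivial groupoid $\mathfrak h^*\times M\times\mathfrak h^*$, where the vertex group $M=H\times(G\times G^* )$ is the direct product of $H$ with the Drinfeld double $G\times G^*$.
   Context: Setting. $G$ is a connected, simply connected Lie group, $H\subset G$ a connected, simply connected Lie subgroup, $\mathfrak g,\mathfrak h$ their Lie algebras, $\iota:\mathfrak h\to\mathfrak g$ the inclusion. $\mathrm{Ad}^*_x,\mathrm{ad}^*_Y$ are the transposes of $\mathrm{Ad}_x,\mathrm{ad}_Y$. $R:\mathfrak g^*\to\mathfrak g$ is linear, skew-symmetric, such that $\kappa(A,B)=-[RA,RB]-R\,\mathrm{ad}^*_{RA}B+R\,\mathrm{ad}^*_{RB}A$ satisfies $\mathrm{ad}_Y\kappa(A,B)+\kappa(\mathrm{ad}^*_YA,B)+\kappa(A,\mathrm{ad}^*_YB)=0$ for $Y\in\mathfrak g$, and $R\,\mathrm{ad}^*_{\iota Z}+\mathrm{ad}_{\iota Z}R=0$ for $Z\in\mathfrak h$. Poisson Lie groups. $G$ with $\{f,g\}_G=\langle R(Df),Dg\rangle-\langle R(D'f),D'g\rangle$ ($\langle Df,Y\rangle=\frac{d}{dt}|_0f(e^{tY}x)$, $\langle D'f,Y\rangle=\frac{d}{dt}|_0f(xe^{tY})$) is a Poisson Lie group; $(G^*,\{\,,\,\}_* )$ is the connected,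 simply connected dual Poisson Lie group, with Lie algebra $\mathfrak g^*$, $[A,B]_*=\mathrm{ad}^*_{R(A)}B-\mathrm{ad}^*_{R(B)}A$. $\varphi^+$ is the right dressing action of $G$ on $G^*$ and $\varphi^-$ the left dressing action of $G^*$ on $G$, with generators $\lambda^+(Y)(u)=\frac{d}{dt}|_0\varphi^+_{e^{tY}}(u)$, $\lambda^-(A)(x)=\frac{d}{dt}|_0\varphi^-_{e^{tA}}(x)$ determined by $\{\phi,\psi\}_*(u)=-d\phi(u)\lambda^+(T_1l_u^*d\psi(u))(u)$, $\{f,g\}_G(x)=df(x)\lambda^-(T_1r_x^*dg(x))(x)$. They satisfy $\varphi^+_x(uv)=\varphi^+_{\varphi^-_v(x)}(u)\varphi^+_x(v)$, $\varphi^-_u(xy)=\varphi^-_u(x)\varphi^-_{\varphi^+_x(u)}(y)$, and $\varphi^-_u(h)=h$ for $h\in H$. $G$ is assumed complete, i.e. $\varphi^\pm$ are globally defined. The Drinfeld double is then $G\times G^*$ with product $(g_1,u_1)\cdot(g_2,u_2)=\big((\varphi^-_{u_2^{-1}}(g_1^{-1}))^{-1}g_2,\ u_1(\varphi^+_{g_1^{-1}}(u_2^{-1}))^{-1}\big)$. $I^*:G^*\to\mathfrak h^*$ is the Lie group morphism integrating $\iota^*:\mathfrak g^*\to\mathfrak h^*$. Groupoids. Lie groupoids have target $\alpha$, source $\beta$, unit $\epsilon$; $(x,y)$ composable iff $\beta(x)=\alpha(y)$. $X$: $\alpha(p,g,q)=p$, $\beta(p,g,q)=q$, $(p,g,q)(q,g',r)=(p,gg',r)$;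 similarly the trivial groupoid $\mathfrak h^*\times M\times\mathfrak h^*$. $X^*$: $\alpha(h,p,u)=\mathrm{Ad}^*_{h^{-1}}p+I^*(u)$, $\beta(h,p,u)=p$, $\epsilon(q)=(1,q,1)$, $(h,\alpha(k,q,v),u)\cdot(k,q,v)=(hk,q,u\varphi^+_{h^{-1}}(v))$. Matched pair. Two Lie groupoids $\mathcal V,\mathcal H$ over $B$ form a matched pair iff the manifold $\mathcal V\ast\mathcal H=\{(v,h)\in\mathcal V\times\mathcal H\mid\beta_{\mathcal V}(v)=\alpha_{\mathcal H}(h)\}$ admits a Lie groupoid structure over $B$ such that (a) the maps $h\mapsto\overline h=(\epsilon_{\mathcal V}(\alpha_{\mathcal H}(h)),h)$ and $v\mapsto\overline v=(v,\epsilon_{\mathcal H}(\beta_{\mathcal V}(v)))$ are morphisms of Lie groupoids from $\mathcal H$ and $\mathcal V$ to $\mathcal V\ast\mathcal H$; (b) the map $\mathcal V\ast\mathcal H\to\mathcal V\ast\mathcal H$, $(v,h)\mapsto\overline v\,\overline h$, is a diffeomorphism. The groupoid $\mathcal V\ast\mathcal H$ is the matched product. "Given by" means: isomorphic as a Lie groupoid over $\mathfrak h^*$. *)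

theory Defs
  imports "HOL-Analysis.Analysis" "HOL-Algebra.Group"
begin

text \<open>
  Smooth manifolds, Lie groups, Poisson Lie groups and Lie groupoids, all with explicit carriers.

  Model spaces are finite-dimensional real inner product (or normed) spaces.  The class
  \<open>euclidean_space\<close> is avoided on purpose, since it excludes dimension zero.

  The dual of a finite-dimensional inner product space is represented by the space itself, the
  pairing being the inner product; the transpose of a linear map is then \<open>adjoint\<close>.
\<close>

section \<open>Smooth manifolds\<close>

text \<open>\<open>Ck_on k S f\<close> is meant for open \<open>S\<close>.\<close>

primrec Ck_on :: "nat \<Rightarrow> 'e::real_normed_vector set \<Rightarrow> ('e \<Rightarrow> 'f::real_normed_vector) \<Rightarrow> bool" where
  "Ck_on 0 S f \<longleftrightarrow> continuous_on S f"
| "Ck_on (Suc k) S f \<longleftrightarrow> (\<forall>x\<in>S. f differentiable (at x)) \<and>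
     (\<forall>v. Ck_on k S (\<lambda>x. frechet_derivative f (at x) v))"

definition Cinf_on :: "'e::real_normed_vector set \<Rightarrow> ('e \<Rightarrow> 'f::real_normed_vector) \<Rightarrow> bool" where
  "Cinf_on S f \<longleftrightarrow> (\<forall>k. Ck_on k S f)"

definition finite_dim :: "'e::real_vector itself \<Rightarrow> bool" where
  "finite_dim _ \<longleftrightarrow> (\<exists>B::'e set. finite B \<and> span B = UNIV)"

text \<open>The atlas need not be maximal.\<close>

record ('a, 'e) manifold =
  mtop :: "'a topology"
  atlas :: "('a set \<times> ('a \<Rightarrow> 'e)) set"

abbreviation points :: "('a, 'e, 'z) manifold_scheme \<Rightarrow> 'a set" where
  "points M \<equiv> topspace (mtop M)"

definition smooth_manifold :: "('a, 'e::real_normed_vector) manifold \<Rightarrow> bool" where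
  "smooth_manifold M \<longleftrightarrow>
     finite_dim TYPE('e) \<and> Hausdorff_space (mtop M) \<and> second_countable (mtop M) \<and>
     (\<forall>(U, \<phi>)\<in>atlas M. openin (mtop M) U \<and> open (\<phi> ` U) \<and>
        homeomorphic_map (subtopology (mtop M) U) (top_of_set (\<phi> ` U)) \<phi>) \<and>
     (\<Union>(U, \<phi>)\<in>atlas M. U) = points M \<and>
     (\<forall>(U, \<phi>)\<in>atlas M. \<forall>(V, \<psi>)\<in>atlas M.
        Cinf_on (\<phi> ` (U \<inter> V)) (\<psi> \<circ> inv_into U \<phi>))"

definition smooth_map ::
  "('a, 'e::real_normed_vector) manifold \<Rightarrow> ('b, 'f::real_normed_vector) manifold \<Rightarrow> ('a \<Rightarrow> 'b) \<Rightarrow> bool"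
  where
  "smooth_map M N f \<longleftrightarrow> continuous_map (mtop M) (mtop N) f \<and>
     (\<forall>(U, \<phi>)\<in>atlas M. \<forall>(V, \<psi>)\<in>atlas N.
        Cinf_on (\<phi> ` (U \<inter> f -` V)) (\<psi> \<circ> f \<circ> inv_into U \<phi>))"

definition diffeomorphism ::
  "('a, 'e::real_normed_vector) manifold \<Rightarrow> ('b, 'f::real_normed_vector) manifold \<Rightarrow> ('a \<Rightarrow> 'b) \<Rightarrow> bool"
  where
  "diffeomorphism M N f \<longleftrightarrow> smooth_map M N f \<and>
     (\<exists>g. smooth_map N M g \<and> (\<forall>x\<in>points M. g (f x) = x) \<and> (\<forall>y\<in>points N. f (g y) = y))"

definition immersion ::
  "('a, 'e::real_normed_vector) manifold \<Rightarrow> ('b, 'f::real_normed_vector) manifold \<Rightarrow> ('a \<Rightarrow> 'b) \<Rightarrow> bool"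
  where
  "immersion M N f \<longleftrightarrow> smooth_map M N f \<and>
     (\<forall>(U, \<phi>)\<in>atlas M. \<forall>(V, \<psi>)\<in>atlas N. \<forall>x\<in>U. f x \<in> V \<longrightarrow>
        inj (frechet_derivative (\<psi> \<circ> f \<circ> inv_into U \<phi>) (at (\<phi> x))))"

definition submersion ::
  "('a, 'e::real_normed_vector) manifold \<Rightarrow> ('b, 'f::real_normed_vector) manifold \<Rightarrow> ('a \<Rightarrow> 'b) \<Rightarrow> bool"
  where
  "submersion M N f \<longleftrightarrow> smooth_map M N f \<and>
     (\<forall>(U, \<phi>)\<in>atlas M. \<forall>(V, \<psi>)\<in>atlas N. \<forall>x\<in>U. f x \<in> V \<longrightarrow>
        surj (frechet_derivative (\<psi> \<circ> f \<circ> inv_into U \<phi>) (at (\<phi> x))))"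

definition embedded_submanifold ::
  "('a, 'e::real_normed_vector) manifold \<Rightarrow> ('a, 'f::real_normed_vector) manifold \<Rightarrow> bool" where
  "embedded_submanifold S M \<longleftrightarrow> smooth_manifold S \<and> points S \<subseteq> points M \<and>
     mtop S = subtopology (mtop M) (points S) \<and> immersion S M (\<lambda>x. x)"

definition open_part :: "('a, 'e) manifold \<Rightarrow> 'a set \<Rightarrow> ('a, 'e) manifold" where
  "open_part M W = \<lparr>mtop = subtopology (mtop M) W, atlas = (\<lambda>(U, \<phi>). (U \<inter> W, \<phi>)) ` atlas M\<rparr>"

text \<open>
  Smoothness on an arbitrary subset, by local smooth extension.  On an embedded submanifold this is
  smoothness with respect to its own manifold structure.
\<close>

definition smooth_map_on ::
  "('a, 'e::real_normed_vector) manifold \<Rightarrow> 'a set \<Rightarrow> ('b, 'f::real_normed_vector) manifold \<Rightarrow>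
    ('a \<Rightarrow> 'b) \<Rightarrow> bool" where
  "smooth_map_on M S N f \<longleftrightarrow> S \<subseteq> points M \<and>
     (\<forall>x\<in>S. \<exists>W g. openin (mtop M) W \<and> x \<in> W \<and> smooth_map (open_part M W) N g \<and>
        (\<forall>y\<in>S \<inter> W. g y = f y))"

definition prod_mfd :: "('a, 'e) manifold \<Rightarrow> ('b, 'f) manifold \<Rightarrow> ('a \<times> 'b, 'e \<times> 'f) manifold" where
  "prod_mfd M N = \<lparr>mtop = prod_topology (mtop M) (mtop N),
     atlas = {(U \<times> V, map_prod \<phi> \<psi>) | U \<phi> V \<psi>. (U, \<phi>) \<in> atlas M \<and> (V, \<psi>) \<in> atlas N}\<rparr>"

definition vec_mfd :: "('e::real_normed_vector, 'e) manifold" where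
  "vec_mfd = \<lparr>mtop = euclidean, atlas = {(UNIV, \<lambda>x. x)}\<rparr>"

definition smooth_fun :: "('a, 'e::real_normed_vector) manifold \<Rightarrow> ('a \<Rightarrow> real) \<Rightarrow> bool" where
  "smooth_fun M f \<longleftrightarrow> smooth_map M vec_mfd f"

definition same_velocity ::
  "('a, 'e::real_normed_vector) manifold \<Rightarrow> (real \<Rightarrow> 'a) \<Rightarrow> (real \<Rightarrow> 'a) \<Rightarrow> bool" where
  "same_velocity M c d \<longleftrightarrow> c 0 = d 0 \<and>
     (\<forall>(U, \<phi>)\<in>atlas M. c 0 \<in> U \<longrightarrow>
        vector_derivative (\<phi> \<circ> c) (at 0) = vector_derivative (\<phi> \<circ> d) (at 0))"

definition simply_connected_space :: "'a topology \<Rightarrow> bool" where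
  "simply_connected_space T \<longleftrightarrow> path_connected_space T \<and>
     (\<forall>p. continuous_map (top_of_set {0..1::real}) T p \<and> p 0 = p 1 \<longrightarrow>
        homotopic_with (\<lambda>r. r 0 = p 0 \<and> r 1 = p 0) (top_of_set {0..1}) T p (\<lambda>_. p 0))"

section \<open>Lie groups\<close>

record ('a, 'e) lie_group = "'a monoid" +
  mfd :: "('a, 'e) manifold"

text \<open>
  In an \<open>exp_lie_group\<close> the Lie algebra is the model space \<open>'e\<close> (which has the dimension of the
  group), identified with the tangent space at the unit through \<open>Y \<mapsto> d/dt|0 lexp (t Y)\<close>.
  The field \<open>lexp\<close> is the exponential map under this identification.
\<close>

record ('a, 'e) exp_lie_group = "('a, 'e) lie_group" +
  lexp :: "'e \<Rightarrow> 'a"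

definition is_lie_group :: "('a, 'e::real_normed_vector, 'z) lie_group_scheme \<Rightarrow> bool" where
  "is_lie_group G \<longleftrightarrow> group G \<and> smooth_manifold (mfd G) \<and> points (mfd G) = carrier G \<and>
     smooth_map (prod_mfd (mfd G) (mfd G)) (mfd G) (\<lambda>(x, y). x \<otimes>\<^bsub>G\<^esub> y) \<and>
     smooth_map (mfd G) (mfd G) (\<lambda>x. m_inv G x)"

definition is_exp_lie_group :: "('a, 'e::real_normed_vector) exp_lie_group \<Rightarrow> bool" where
  "is_exp_lie_group G \<longleftrightarrow> is_lie_group G \<and>
     (\<forall>Y. smooth_map vec_mfd (mfd G) (\<lambda>t. lexp G (t *\<^sub>R Y))) \<and>
     (\<forall>Y s t. lexp G ((s + t) *\<^sub>R Y) = lexp G (s *\<^sub>R Y) \<otimes>\<^bsub>G\<^esub> lexp G (t *\<^sub>R Y)) \<and>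
     (\<forall>(U, \<phi>)\<in>atlas (mfd G). \<one>\<^bsub>G\<^esub> \<in> U \<longrightarrow>
        linear (\<lambda>Y. vector_derivative (\<lambda>t. \<phi> (lexp G (t *\<^sub>R Y))) (at 0)) \<and>
        bij (\<lambda>Y. vector_derivative (\<lambda>t. \<phi> (lexp G (t *\<^sub>R Y))) (at 0)))"

definition lie_hom ::
  "('a, 'e::real_normed_vector, 'y) lie_group_scheme \<Rightarrow> ('b, 'f::real_normed_vector, 'z) lie_group_scheme \<Rightarrow>
    ('a \<Rightarrow> 'b) \<Rightarrow> bool" where
  "lie_hom G K F \<longleftrightarrow> F \<in> hom G K \<and> smooth_map (mfd G) (mfd K) F"

text \<open>The tangent map at the unit of a smooth map preserving the units.\<close>

definition lie_diff ::
  "('a, 'e::real_normed_vector) exp_lie_group \<Rightarrow> ('b, 'f::real_normed_vector) exp_lie_group \<Rightarrow>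
    ('a \<Rightarrow> 'b) \<Rightarrow> 'e \<Rightarrow> 'f" where
  "lie_diff G K F Y =
     (THE W. same_velocity (mfd K) (\<lambda>t. F (lexp G (t *\<^sub>R Y))) (\<lambda>t. lexp K (t *\<^sub>R W)))"

definition Ad :: "('a, 'e::real_normed_vector) exp_lie_group \<Rightarrow> 'a \<Rightarrow> 'e \<Rightarrow> 'e" where
  "Ad G x = lie_diff G G (\<lambda>y. x \<otimes>\<^bsub>G\<^esub> y \<otimes>\<^bsub>G\<^esub> m_inv G x)"

text \<open>The adjoint representation of the Lie algebra; the Lie bracket is \<open>[Y, Z] = ad G Y Z\<close>.\<close>

definition ad :: "('a, 'e::real_normed_vector) exp_lie_group \<Rightarrow> 'e \<Rightarrow> 'e \<Rightarrow> 'e" where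
  "ad G Y Z = vector_derivative (\<lambda>t. Ad G (lexp G (t *\<^sub>R Y)) Z) (at 0)"

definition coAd :: "('a, 'e::real_inner) exp_lie_group \<Rightarrow> 'a \<Rightarrow> 'e \<Rightarrow> 'e" where
  "coAd G x = adjoint (Ad G x)"

definition coad :: "('a, 'e::real_inner) exp_lie_group \<Rightarrow> 'e \<Rightarrow> 'e \<Rightarrow> 'e" where
  "coad G Y = adjoint (ad G Y)"

text \<open>Lie subgroups are immersed; their topology need not be the subspace topology.\<close>

definition lie_subgroup ::
  "('a, 'f::real_normed_vector) exp_lie_group \<Rightarrow> ('a, 'e::real_normed_vector) exp_lie_group \<Rightarrow> bool"
  where
  "lie_subgroup H G \<longleftrightarrow> is_exp_lie_group H \<and> subgroup (carrier H) G \<and>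
     (\<forall>x\<in>carrier H. \<forall>y\<in>carrier H. x \<otimes>\<^bsub>H\<^esub> y = x \<otimes>\<^bsub>G\<^esub> y) \<and>
     immersion (mfd H) (mfd G) (\<lambda>x. x)"

definition lie_incl ::
  "('a, 'f::real_normed_vector) exp_lie_group \<Rightarrow> ('a, 'e::real_normed_vector) exp_lie_group \<Rightarrow> 'f \<Rightarrow> 'e"
  where
  "lie_incl H G = lie_diff H G (\<lambda>x. x)"

definition vec_lie_group :: "('e::real_normed_vector, 'e) exp_lie_group" where
  "vec_lie_group = \<lparr>carrier = UNIV, mult = (+), one = 0, mfd = vec_mfd, lexp = (\<lambda>x. x)\<rparr>"

definition prod_lie_group ::
  "('a, 'e, 'y) lie_group_scheme \<Rightarrow> ('b, 'f, 'z) lie_group_scheme \<Rightarrow> ('a \<times> 'b, 'e \<times> 'f) lie_group" where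
  "prod_lie_group G K = \<lparr>carrier = carrier G \<times> carrier K,
     mult = (\<lambda>(g, k) (g', k'). (g \<otimes>\<^bsub>G\<^esub> g', k \<otimes>\<^bsub>K\<^esub> k')),
     one = (\<one>\<^bsub>G\<^esub>, \<one>\<^bsub>K\<^esub>), mfd = prod_mfd (mfd G) (mfd K)\<rparr>"

section \<open>Poisson Lie groups and dressing actions\<close>

text \<open>
  \<open>right_diff G f x\<close> is \<open>Df(x) = (T_1 r_x)^* df(x)\<close> and \<open>left_diff G f x\<close> is
  \<open>D'f(x) = (T_1 l_x)^* df(x)\<close>, as elements of the dual of the Lie algebra.
\<close>

definition right_diff :: "('a, 'e::real_inner) exp_lie_group \<Rightarrow> ('a \<Rightarrow> real) \<Rightarrow> 'a \<Rightarrow> 'e" where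
  "right_diff G f x = (THE A. \<forall>Y. A \<bullet> Y = deriv (\<lambda>t. f (lexp G (t *\<^sub>R Y) \<otimes>\<^bsub>G\<^esub> x)) 0)"

definition left_diff :: "('a, 'e::real_inner) exp_lie_group \<Rightarrow> ('a \<Rightarrow> real) \<Rightarrow> 'a \<Rightarrow> 'e" where
  "left_diff G f x = (THE A. \<forall>Y. A \<bullet> Y = deriv (\<lambda>t. f (x \<otimes>\<^bsub>G\<^esub> lexp G (t *\<^sub>R Y))) 0)"

definition poisson_bracket ::
  "('a, 'e::real_normed_vector) manifold \<Rightarrow> (('a \<Rightarrow> real) \<Rightarrow> ('a \<Rightarrow> real) \<Rightarrow> 'a \<Rightarrow> real) \<Rightarrow> bool" where
  "poisson_bracket M br \<longleftrightarrow>
     (\<forall>f g. smooth_fun M f \<and> smooth_fun M g \<longrightarrow> smooth_fun M (br f g)) \<and>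
     (\<forall>f g h a b. smooth_fun M f \<and> smooth_fun M g \<and> smooth_fun M h \<longrightarrow> (\<forall>x\<in>points M.
        br f g x = - br g f x \<and>
        br (\<lambda>y. a * f y + b * g y) h x = a * br f h x + b * br g h x \<and>
        br (\<lambda>y. f y * g y) h x = f x * br g h x + g x * br f h x \<and>
        br f (br g h) x + br g (br h f) x + br h (br f g) x = 0))"

text \<open>The last condition says that the multiplication \<open>G \<times> G \<rightarrow> G\<close> is a Poisson map.\<close>

definition poisson_lie_group ::
  "('a, 'e::real_normed_vector, 'z) lie_group_scheme \<Rightarrow> (('a \<Rightarrow> real) \<Rightarrow> ('a \<Rightarrow> real) \<Rightarrow> 'a \<Rightarrow> real) \<Rightarrow> bool"
  where
  "poisson_lie_group G br \<longleftrightarrow> is_lie_group G \<and> poisson_bracket (mfd G) br \<and>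
     (\<forall>f g. smooth_fun (mfd G) f \<and> smooth_fun (mfd G) g \<longrightarrow>
        (\<forall>x\<in>carrier G. \<forall>y\<in>carrier G. br f g (x \<otimes>\<^bsub>G\<^esub> y) =
           br (\<lambda>z. f (z \<otimes>\<^bsub>G\<^esub> y)) (\<lambda>z. g (z \<otimes>\<^bsub>G\<^esub> y)) x +
           br (\<lambda>z. f (x \<otimes>\<^bsub>G\<^esub> z)) (\<lambda>z. g (x \<otimes>\<^bsub>G\<^esub> z)) y))"

definition kappa :: "('a, 'e::real_inner) exp_lie_group \<Rightarrow> ('e \<Rightarrow> 'e) \<Rightarrow> 'e \<Rightarrow> 'e \<Rightarrow> 'e" where
  "kappa G R A B = - ad G (R A) (R B) - R (coad G (R A) B) + R (coad G (R B) A)"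

definition r_bracket ::
  "('a, 'e::real_inner) exp_lie_group \<Rightarrow> ('e \<Rightarrow> 'e) \<Rightarrow> ('a \<Rightarrow> real) \<Rightarrow> ('a \<Rightarrow> real) \<Rightarrow> 'a \<Rightarrow> real" where
  "r_bracket G R f g x =
     R (right_diff G f x) \<bullet> right_diff G g x - R (left_diff G f x) \<bullet> left_diff G g x"

text \<open>
  The connected and simply connected dual Poisson Lie group of \<open>(G, r_bracket G R)\<close>: its Lie algebra
  is the dual of that of \<open>G\<close> with the bracket \<open>[A, B]_*\<close>, and the linearisation of its Poisson
  bracket at the unit is the Lie bracket of the Lie algebra of \<open>G\<close>.
\<close>

definition dual_poisson_lie_group ::
  "('a, 'e::real_inner) exp_lie_group \<Rightarrow> ('e \<Rightarrow> 'e) \<Rightarrow> ('d, 'e) exp_lie_group \<Rightarrow>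
    (('d \<Rightarrow> real) \<Rightarrow> ('d \<Rightarrow> real) \<Rightarrow> 'd \<Rightarrow> real) \<Rightarrow> bool" where
  "dual_poisson_lie_group G R Gs br \<longleftrightarrow>
     is_exp_lie_group Gs \<and> connected_space (mtop (mfd Gs)) \<and> simply_connected_space (mtop (mfd Gs)) \<and>
     poisson_lie_group Gs br \<and>
     (\<forall>A B. ad Gs A B = coad G (R A) B - coad G (R B) A) \<and>
     (\<forall>\<phi> \<psi> A. smooth_fun (mfd Gs) \<phi> \<and> smooth_fun (mfd Gs) \<psi> \<longrightarrow>
        deriv (\<lambda>t. br \<phi> \<psi> (lexp Gs (t *\<^sub>R A))) 0 =
        A \<bullet> ad G (left_diff Gs \<phi> \<one>\<^bsub>Gs\<^esub>) (left_diff Gs \<psi> \<one>\<^bsub>Gs\<^esub>))"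

definition left_lie_action ::
  "('a, 'e::real_normed_vector, 'z) lie_group_scheme \<Rightarrow> ('b, 'f::real_normed_vector) manifold \<Rightarrow>
    ('a \<Rightarrow> 'b \<Rightarrow> 'b) \<Rightarrow> bool" where
  "left_lie_action G M act \<longleftrightarrow> smooth_map (prod_mfd (mfd G) M) M (\<lambda>(x, m). act x m) \<and>
     (\<forall>m\<in>points M. act \<one>\<^bsub>G\<^esub> m = m) \<and>
     (\<forall>x\<in>carrier G. \<forall>y\<in>carrier G. \<forall>m\<in>points M. act (x \<otimes>\<^bsub>G\<^esub> y) m = act x (act y m))"

definition right_lie_action ::
  "('a, 'e::real_normed_vector, 'z) lie_group_scheme \<Rightarrow> ('b, 'f::real_normed_vector) manifold \<Rightarrow>
    ('a \<Rightarrow> 'b \<Rightarrow> 'b) \<Rightarrow> bool" where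
  "right_lie_action G M act \<longleftrightarrow> smooth_map (prod_mfd (mfd G) M) M (\<lambda>(x, m). act x m) \<and>
     (\<forall>m\<in>points M. act \<one>\<^bsub>G\<^esub> m = m) \<and>
     (\<forall>x\<in>carrier G. \<forall>y\<in>carrier G. \<forall>m\<in>points M. act (x \<otimes>\<^bsub>G\<^esub> y) m = act y (act x m))"

text \<open>
  The derivatives at \<open>0\<close> below are \<open>d\<phi>(u) \<lambda>\<^sup>+(T_1 l_u^* d\<psi>(u))(u)\<close> and
  \<open>df(x) \<lambda>\<^sup>-(T_1 r_x^* dg(x))(x)\<close>.
\<close>

definition right_dressing_action ::
  "('a, 'e::real_inner) exp_lie_group \<Rightarrow> ('d, 'e) exp_lie_group \<Rightarrow>
    (('d \<Rightarrow> real) \<Rightarrow> ('d \<Rightarrow> real) \<Rightarrow> 'd \<Rightarrow> real) \<Rightarrow> ('a \<Rightarrow> 'd \<Rightarrow> 'd) \<Rightarrow> bool" where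
  "right_dressing_action G Gs br dp \<longleftrightarrow> right_lie_action G (mfd Gs) dp \<and>
     (\<forall>\<phi> \<psi>. smooth_fun (mfd Gs) \<phi> \<and> smooth_fun (mfd Gs) \<psi> \<longrightarrow> (\<forall>u\<in>carrier Gs.
        br \<phi> \<psi> u = - deriv (\<lambda>t. \<phi> (dp (lexp G (t *\<^sub>R left_diff Gs \<psi> u)) u)) 0))"

definition left_dressing_action ::
  "('a, 'e::real_inner) exp_lie_group \<Rightarrow> ('d, 'e) exp_lie_group \<Rightarrow>
    (('a \<Rightarrow> real) \<Rightarrow> ('a \<Rightarrow> real) \<Rightarrow> 'a \<Rightarrow> real) \<Rightarrow> ('d \<Rightarrow> 'a \<Rightarrow> 'a) \<Rightarrow> bool" where
  "left_dressing_action G Gs br dm \<longleftrightarrow> left_lie_action Gs (mfd G) dm \<and>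
     (\<forall>f g. smooth_fun (mfd G) f \<and> smooth_fun (mfd G) g \<longrightarrow> (\<forall>x\<in>carrier G.
        br f g x = deriv (\<lambda>t. f (dm (lexp Gs (t *\<^sub>R right_diff G g x)) x)) 0))"

definition drinfeld_double ::
  "('a, 'e, 'y) lie_group_scheme \<Rightarrow> ('d, 'f, 'z) lie_group_scheme \<Rightarrow> ('a \<Rightarrow> 'd \<Rightarrow> 'd) \<Rightarrow> ('d \<Rightarrow> 'a \<Rightarrow> 'a) \<Rightarrow>
    ('a \<times> 'd, 'e \<times> 'f) lie_group" where
  "drinfeld_double G Gs dp dm = \<lparr>carrier = carrier G \<times> carrier Gs,
     mult = (\<lambda>(g1, u1) (g2, u2).
       (m_inv G (dm (m_inv Gs u2) (m_inv G g1)) \<otimes>\<^bsub>G\<^esub> g2,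
        u1 \<otimes>\<^bsub>Gs\<^esub> m_inv Gs (dp (m_inv G g1) (m_inv Gs u2)))),
     one = (\<one>\<^bsub>G\<^esub>, \<one>\<^bsub>Gs\<^esub>), mfd = prod_mfd (mfd G) (mfd Gs)\<rparr>"

section \<open>Lie groupoids\<close>

text \<open>
  \<open>gcomp \<Gamma> x y\<close> is meaningful iff \<open>gsource \<Gamma> x = gtarget \<Gamma> y\<close>.  In the notation of the
  literature followed here the target is \<open>\<alpha>\<close> and the source is \<open>\<beta>\<close>.
\<close>

record ('a, 'b, 'e, 'f) groupoid =
  arrows :: "('a, 'e) manifold"
  gbase :: "('b, 'f) manifold"
  gtarget :: "'a \<Rightarrow> 'b"
  gsource :: "'a \<Rightarrow> 'b"
  gunit :: "'b \<Rightarrow> 'a"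
  gcomp :: "'a \<Rightarrow> 'a \<Rightarrow> 'a"

abbreviation arrs :: "('a, 'b, 'e, 'f, 'z) groupoid_scheme \<Rightarrow> 'a set" where
  "arrs \<Gamma> \<equiv> points (arrows \<Gamma>)"

definition composable :: "('a, 'b, 'e, 'f) groupoid \<Rightarrow> ('a \<times> 'a) set" where
  "composable \<Gamma> = {(x, y). x \<in> arrs \<Gamma> \<and> y \<in> arrs \<Gamma> \<and> gsource \<Gamma> x = gtarget \<Gamma> y}"

definition lie_groupoid :: "('a, 'b, 'e::real_normed_vector, 'f::real_normed_vector) groupoid \<Rightarrow> bool" where
  "lie_groupoid \<Gamma> \<longleftrightarrow>
     smooth_manifold (arrows \<Gamma>) \<and> smooth_manifold (gbase \<Gamma>) \<and>
     submersion (arrows \<Gamma>) (gbase \<Gamma>) (gtarget \<Gamma>) \<and> submersion (arrows \<Gamma>) (gbase \<Gamma>) (gsource \<Gamma>) \<and>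
     smooth_map (gbase \<Gamma>) (arrows \<Gamma>) (gunit \<Gamma>) \<and>
     smooth_map_on (prod_mfd (arrows \<Gamma>) (arrows \<Gamma>)) (composable \<Gamma>) (arrows \<Gamma>) (\<lambda>(x, y). gcomp \<Gamma> x y) \<and>
     (\<forall>b\<in>points (gbase \<Gamma>). gtarget \<Gamma> (gunit \<Gamma> b) = b \<and> gsource \<Gamma> (gunit \<Gamma> b) = b) \<and>
     (\<forall>(x, y)\<in>composable \<Gamma>. gcomp \<Gamma> x y \<in> arrs \<Gamma> \<and>
        gtarget \<Gamma> (gcomp \<Gamma> x y) = gtarget \<Gamma> x \<and> gsource \<Gamma> (gcomp \<Gamma> x y) = gsource \<Gamma> y) \<and>
     (\<forall>x y z. (x, y) \<in> composable \<Gamma> \<and> (y, z) \<in> composable \<Gamma> \<longrightarrow>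
        gcomp \<Gamma> (gcomp \<Gamma> x y) z = gcomp \<Gamma> x (gcomp \<Gamma> y z)) \<and>
     (\<forall>x\<in>arrs \<Gamma>. gcomp \<Gamma> (gunit \<Gamma> (gtarget \<Gamma> x)) x = x \<and> gcomp \<Gamma> x (gunit \<Gamma> (gsource \<Gamma> x)) = x) \<and>
     (\<exists>i. smooth_map (arrows \<Gamma>) (arrows \<Gamma>) i \<and> (\<forall>x\<in>arrs \<Gamma>.
        gtarget \<Gamma> (i x) = gsource \<Gamma> x \<and> gsource \<Gamma> (i x) = gtarget \<Gamma> x \<and>
        gcomp \<Gamma> x (i x) = gunit \<Gamma> (gtarget \<Gamma> x) \<and> gcomp \<Gamma> (i x) x = gunit \<Gamma> (gsource \<Gamma> x)))"

text \<open>Morphisms and isomorphisms of Lie groupoids over the same base, inducing the identity on it.\<close>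

definition groupoid_morphism ::
  "('a, 'b, 'e::real_normed_vector, 'f::real_normed_vector) groupoid \<Rightarrow>
   ('c, 'b, 'g::real_normed_vector, 'f) groupoid \<Rightarrow> ('a \<Rightarrow> 'c) \<Rightarrow> bool" where
  "groupoid_morphism \<Gamma> \<Delta> F \<longleftrightarrow>
     lie_groupoid \<Gamma> \<and> lie_groupoid \<Delta> \<and> gbase \<Gamma> = gbase \<Delta> \<and> smooth_map (arrows \<Gamma>) (arrows \<Delta>) F \<and>
     (\<forall>x\<in>arrs \<Gamma>. gtarget \<Delta> (F x) = gtarget \<Gamma> x \<and> gsource \<Delta> (F x) = gsource \<Gamma> x) \<and>
     (\<forall>b\<in>points (gbase \<Gamma>). F (gunit \<Gamma> b) = gunit \<Delta> b) \<and>
     (\<forall>(x, y)\<in>composable \<Gamma>. F (gcomp \<Gamma> x y) = gcomp \<Delta> (F x) (F y))"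

definition groupoid_iso ::
  "('a, 'b, 'e::real_normed_vector, 'f::real_normed_vector) groupoid \<Rightarrow>
   ('c, 'b, 'g::real_normed_vector, 'f) groupoid \<Rightarrow> bool" where
  "groupoid_iso \<Gamma> \<Delta> \<longleftrightarrow> (\<exists>F. groupoid_morphism \<Gamma> \<Delta> F \<and> diffeomorphism (arrows \<Gamma>) (arrows \<Delta>) F)"

text \<open>
  \<open>matched_product V K P\<close>: the Lie groupoid structure \<open>P\<close> on the fibre product \<open>V * K\<close> exhibits
  \<open>V\<close>, \<open>K\<close> as a matched pair.
\<close>

definition matched_product ::
  "('a, 'b, 'e::real_normed_vector, 'f::real_normed_vector) groupoid \<Rightarrow>
   ('c, 'b, 'g::real_normed_vector, 'f) groupoid \<Rightarrow>
   ('a \<times> 'c, 'b, 'k::real_normed_vector, 'f) groupoid \<Rightarrow> bool" where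
  "matched_product V K P \<longleftrightarrow>
     lie_groupoid V \<and> lie_groupoid K \<and> lie_groupoid P \<and> gbase V = gbase K \<and> gbase P = gbase V \<and>
     arrs P = {(v, h). v \<in> arrs V \<and> h \<in> arrs K \<and> gsource V v = gtarget K h} \<and>
     embedded_submanifold (arrows P) (prod_mfd (arrows V) (arrows K)) \<and>
     groupoid_morphism K P (\<lambda>h. (gunit V (gtarget K h), h)) \<and>
     groupoid_morphism V P (\<lambda>v. (v, gunit K (gsource V v))) \<and>
     diffeomorphism (arrows P) (arrows P)
       (\<lambda>(v, h). gcomp P (v, gunit K (gsource V v)) (gunit V (gtarget K h), h))"

definition trivial_groupoid ::
  "('a, 'e, 'z) lie_group_scheme \<Rightarrow>
    ('f \<times> 'a \<times> 'f, 'f::real_normed_vector, 'f \<times> 'e \<times> 'f, 'f) groupoid" where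
  "trivial_groupoid K = \<lparr>
     arrows = prod_mfd vec_mfd (prod_mfd (mfd K) vec_mfd), gbase = vec_mfd,
     gtarget = (\<lambda>(p, g, q). p), gsource = (\<lambda>(p, g, q). q), gunit = (\<lambda>q. (q, \<one>\<^bsub>K\<^esub>, q)),
     gcomp = (\<lambda>(p, g, q) (q', g', r). (p, g \<otimes>\<^bsub>K\<^esub> g', r))\<rparr>"

definition dual_groupoid ::
  "('a, 'e::real_normed_vector) exp_lie_group \<Rightarrow> ('a, 'f::real_inner) exp_lie_group \<Rightarrow>
   ('d, 'e) exp_lie_group \<Rightarrow> ('a \<Rightarrow> 'd \<Rightarrow> 'd) \<Rightarrow> ('d \<Rightarrow> 'f) \<Rightarrow>
    ('a \<times> 'f \<times> 'd, 'f, 'f \<times> 'f \<times> 'e, 'f) groupoid" where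
  "dual_groupoid G H Gs dp Is = \<lparr>
     arrows = prod_mfd (mfd H) (prod_mfd vec_mfd (mfd Gs)), gbase = vec_mfd,
     gtarget = (\<lambda>(h, p, u). coAd H (m_inv H h) p + Is u), gsource = (\<lambda>(h, p, u). p),
     gunit = (\<lambda>q. (\<one>\<^bsub>H\<^esub>, q, \<one>\<^bsub>Gs\<^esub>)),
     gcomp = (\<lambda>(h, p, u) (k, q, v). (h \<otimes>\<^bsub>H\<^esub> k, q, u \<otimes>\<^bsub>Gs\<^esub> dp (m_inv G h) v))\<rparr>"

end

theory Submission
  imports Defs
begin

text \<open>
  Write \<open>D\<close> for the Drinfeld double. In \<open>D\<close> both \<open>G\<close> and \<open>G*\<close> are subgroups, every element is
  uniquely a product \<open>g u\<close> as well as a product \<open>u g\<close>, and the two dressing actions are exactly the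
  rules for passing from one order to the other. Inside the trivial groupoid \<open>T\<close> on \<open>\<hh>*\<close> with vertex
  group \<open>H \<times> D\<close> there are two subgroupoids: \<open>(p, g, q) \<mapsto> (p, (1, g), q)\<close> embeds \<open>X\<close>, and
  \<open>(h, p, u) \<mapsto> (\<alpha>(h, p, u), (h, u h), p)\<close> embeds \<open>X*\<close>. That the second map is multiplicative is the
  semidirect product rule in \<open>X*\<close>: elements of \<open>H\<close> are fixed by the left dressing action, so in \<open>D\<close>
  they act on \<open>G*\<close> by automorphisms. An arrow \<open>(p, (h, d), r)\<close> of \<open>T\<close> is then uniquely a product of an
  arrow of \<open>X\<close> and an arrow of \<open>X*\<close>: the \<open>h\<close>-component and the endpoints prescribe \<open>h\<close>, \<open>p\<close>, \<open>r\<close>, and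
  \<open>d h\<^sup>-\<^sup>1 = g u\<close> determines \<open>g\<close> and \<open>u\<close>. Multiplication is therefore a bijection from the composable
  pairs \<open>X * X*\<close> onto \<open>T\<close> (\<open>factors_product\<close>, with the explicit inverse \<open>factorisation\<close>), smooth in
  both directions, and the matched product is \<open>T\<close> with its structure transported along it. By
  construction the map \<open>(v, k) \<mapsto> v k\<close> of the matched product is the identity.

  The statement that needs Lie theory is that \<open>X*\<close> is a groupoid at all: the target of a product must
  be the target of its first factor, which says \<open>I*(\<phi>\<^sup>+_h u) = Ad*_h I*(u)\<close> for \<open>h \<in> H\<close>
  (\<open>I_equivariant\<close>). It is derived from the Poisson structure by looking only at the functions
  \<open>\<langle>Z, I*\<rangle>\<close> with \<open>Z \<in> \<hh>\<close>, which are globally defined and have the constant left differential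
  \<open>\<iota> Z\<close>. Since the multiplication of \<open>G*\<close> is Poisson, the bracket of two of them is an additive
  function on \<open>G*\<close>; its differential at the unit is given by the bracket of \<open>\<gg>\<close>, and \<open>G*\<close> is connected,
  hence \<open>{\<langle>Z, I*\<rangle>, \<langle>W, I*\<rangle>} = \<langle>[Z, W], I*\<rangle>\<close> (\<open>br_inner_I\<close>). By the definition of the dressing action
  this is the infinitesimal form of the equivariance, and it integrates because \<open>H\<close> is connected.

  The remaining work is foundational: smooth maps between manifolds modelled on finite-dimensional
  inner product spaces compose, pair and differentiate as expected, and the adjoint representation
  is smooth. Both uses of connectedness go through the fact that a smooth function whose derivative
  vanishes along all curves \<open>x exp(t Y)\<close> is constant
  (\<open>constant_if_left_derivative_zero\<close>).
\<close>


section \<open>Finite-dimensional inner product spaces\<close>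

text \<open>
  The coefficients \<open>x \<bullet> b\<close> reproduce \<open>x\<close>, as for an orthonormal basis. A linear map is then given
  by an explicit finite sum, from which its continuity and its adjoint can be read off.
\<close>

definition parseval_frame :: "'e::real_inner set \<Rightarrow> bool" where
  "parseval_frame B \<longleftrightarrow> finite B \<and> (\<forall>x. (\<Sum>b\<in>B. (x \<bullet> b) *\<^sub>R b) = x)"

text \<open>
  One Gram-Schmidt step per vector. The model spaces may have dimension zero, so they are not of
  class \<open>euclidean_space\<close> and carry no canonical basis.
\<close>

lemma orthonormal_set_same_span:
  fixes T :: "'e::real_inner set"
  assumes "finite T"
  shows "\<exists>B. finite B \<and> (\<forall>b\<in>B. \<forall>c\<in>B. b \<bullet> c = (if b = c then 1 else 0)) \<and> span B = span T"
  using assms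
proof (induction T)
  case empty
  then show ?case by (intro exI[of _ "{}"]) auto
next
  case (insert a T)
  then obtain B where B: "finite B" "\<And>b c. b \<in> B \<Longrightarrow> c \<in> B \<Longrightarrow> b \<bullet> c = (if b = c then 1 else 0)"
      "span B = span T" by auto
  define s where "s = (\<Sum>b\<in>B. (a \<bullet> b) *\<^sub>R b)"
  define a' where "a' = a - s"
  have s: "s \<in> span B" unfolding s_def by (intro span_sum span_scale span_base)
  have ortho: "a' \<bullet> c = 0" if "c \<in> B" for c
  proof -
    have "s \<bullet> c = (\<Sum>b\<in>B. if b = c then a \<bullet> b else 0)"
      unfolding s_def inner_sum_left using B(2) that by (intro sum.cong) auto
    then show ?thesis using that B(1) by (simp add: a'_def inner_diff_left)
  qed
  have sp: "span (insert a T) = span (insert a' B)"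
  proof -
    have "span (insert a T) = span (insert a B)" using B(3)
      by (simp add: span_insert)
    also have "\<dots> = span (insert a' B)"
      using s by (intro eq_span_insert_eq) (simp add: a'_def)
    finally show ?thesis .
  qed
  show ?case
  proof (cases "a' = 0")
    case True
    then have "span (insert a T) = span B" using sp by simp
    then show ?thesis using B by (intro exI[of _ B]) auto
  next
    case False
    define e where "e = inverse (norm a') *\<^sub>R a'"
    have e: "e \<bullet> e = 1" "\<And>c. c \<in> B \<Longrightarrow> e \<bullet> c = 0"
      using False ortho by (auto simp: e_def dot_square_norm power2_eq_square)
    have "span (insert e B) = span (insert a' B)"
      unfolding span_insert
    proof safe
      fix x k assume "x - k *\<^sub>R e \<in> span B"
      then show "\<exists>k. x - k *\<^sub>R a' \<in> span B"
        by (intro exI[of _ "k * inverse (norm a')"]) (simp add: e_def)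
    next
      fix x k assume "x - k *\<^sub>R a' \<in> span B"
      then show "\<exists>k. x - k *\<^sub>R e \<in> span B"
        using False by (intro exI[of _ "k * norm a'"]) (simp add: e_def mult.assoc)
    qed
    moreover have "e \<notin> B" using e by force
    ultimately show ?thesis using B sp e
      by (intro exI[of _ "insert e B"]) (auto simp: inner_commute)
  qed
qed

lemma finite_dim_parseval_frame:
  assumes "finite_dim TYPE('e::real_inner)"
  obtains B :: "'e::real_inner set" where "parseval_frame B"
proof -
  obtain T :: "'e set" where T: "finite T" "span T = UNIV"
    using assms by (auto simp: finite_dim_def)
  obtain B where B: "finite B" "\<And>b c. b \<in> B \<Longrightarrow> c \<in> B \<Longrightarrow> b \<bullet> c = (if b = c then 1 else 0)"
      "span B = span T" using orthonormal_set_same_span[OF T(1)] by blast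
  have "(\<Sum>b\<in>B. (x \<bullet> b) *\<^sub>R b) = x" for x
  proof -
    have "x \<in> span B" using B T by auto
    then show ?thesis
    proof (induction rule: span_induct_alt)
      case base
      then show ?case by simp
    next
      case (step c x y)
      have "(\<Sum>b\<in>B. (x \<bullet> b) *\<^sub>R b) = (\<Sum>b\<in>B. if x = b then b else 0)"
        using step B by (intro sum.cong) auto
      also have "\<dots> = x" using step B(1) by simp
      finally have "(\<Sum>b\<in>B. ((c *\<^sub>R x) \<bullet> b) *\<^sub>R b) = c *\<^sub>R x"
        by (simp only: inner_scaleR_left scaleR_scaleR[symmetric] scaleR_sum_right[symmetric])
      then show ?case using step(2)
        by (simp only: inner_add_left scaleR_add_left sum.distrib)
    qed
  qed
  then show ?thesis using that B(1) by (auto simp: parseval_frame_def)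
qed

lemma parseval_frame_finite: "parseval_frame B \<Longrightarrow> finite B"
  by (simp add: parseval_frame_def)

lemma linear_frame_expansion:
  assumes "parseval_frame B" "linear f"
  shows "f x = (\<Sum>b\<in>B. (x \<bullet> b) *\<^sub>R f b)"
proof -
  have "f x = f (\<Sum>b\<in>B. (x \<bullet> b) *\<^sub>R b)" using assms by (simp add: parseval_frame_def)
  also have "\<dots> = (\<Sum>b\<in>B. (x \<bullet> b) *\<^sub>R f b)"
    using assms(2) by (simp add: linear_sum linear_scale)
  finally show ?thesis .
qed

lemma finite_dim_linear_imp_bounded_linear:
  fixes f :: "'e::real_inner \<Rightarrow> 'f::real_normed_vector"
  assumes "finite_dim TYPE('e)" "linear f"
  shows "bounded_linear f"
proof -
  obtain B :: "'e set" where B: "parseval_frame B"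
    using finite_dim_parseval_frame[OF assms(1)] .
  have "bounded_linear (\<lambda>x. \<Sum>b\<in>B. (x \<bullet> b) *\<^sub>R f b)"
    by (intro bounded_linear_sum bounded_linear_scaleR_left[THEN bounded_linear_compose]
          bounded_linear_inner_left)
  moreover have "f = (\<lambda>x. \<Sum>b\<in>B. (x \<bullet> b) *\<^sub>R f b)"
    using linear_frame_expansion[OF B assms(2)] by (rule ext)
  ultimately show ?thesis by (rule back_subst[of bounded_linear, OF _ sym])
qed

lemma finite_dim_adjoint:
  fixes f :: "'e::real_inner \<Rightarrow> 'f::real_inner"
  assumes "finite_dim TYPE('e)" "linear f"
  shows "x \<bullet> adjoint f y = f x \<bullet> y"
proof -
  obtain B :: "'e set" where B: "parseval_frame B"
    using finite_dim_parseval_frame[OF assms(1)] .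
  have eq: "\<forall>x y. f x \<bullet> y = x \<bullet> (\<Sum>b\<in>B. (f b \<bullet> y) *\<^sub>R b)"
  proof (intro allI)
    fix x y
    have "f x \<bullet> y = (\<Sum>b\<in>B. (x \<bullet> b) *\<^sub>R f b) \<bullet> y"
      by (rule arg_cong[OF linear_frame_expansion[OF B assms(2)]])
    then show "f x \<bullet> y = x \<bullet> (\<Sum>b\<in>B. (f b \<bullet> y) *\<^sub>R b)"
      by (simp add: inner_sum_left inner_sum_right mult.commute)
  qed
  show ?thesis unfolding adjoint_unique[OF eq] using eq by (metis (no_types))
qed

lemma finite_dim_prod:
  assumes "finite_dim TYPE('e::real_vector)" "finite_dim TYPE('f::real_vector)"
  shows "finite_dim TYPE('e::real_vector \<times> 'f::real_vector)"
proof -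
  obtain A :: "'e set" where A: "finite A" "span A = UNIV" using assms by (auto simp: finite_dim_def)
  obtain B :: "'f set" where B: "finite B" "span B = UNIV" using assms by (auto simp: finite_dim_def)
  let ?C = "(\<lambda>a. (a, 0)) ` A \<union> (\<lambda>b. (0, b)) ` B"
  have 1: "linear (\<lambda>a::'e. (a, 0::'f))" by (auto simp: linear_iff)
  have 2: "linear (\<lambda>a::'f. (0::'e, a))" by (auto simp: linear_iff)
  have "(x, y) \<in> span ?C" for x y
  proof -
    have "(x, 0) \<in> span ((\<lambda>a. (a, 0::'f)) ` A)"
      using A by (simp add: linear_span_image[OF 1])
    moreover have "(0, y) \<in> span ((\<lambda>b. (0::'e, b)) ` B)"
      using B by (simp add: linear_span_image[OF 2])
    ultimately have "(x, 0) + (0, y) \<in> span ?C"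
      by (meson span_add span_mono subsetD sup_ge1 sup_ge2)
    then show ?thesis by simp
  qed
  then show ?thesis unfolding finite_dim_def using A(1) B(1)
    by (intro exI[of _ ?C]) auto
qed

text \<open>
  The coordinates of a frame exhibit the space as a retract of the sequence space \<open>nat \<Rightarrow> real\<close>.
\<close>

lemma finite_dim_second_countable:
  assumes "finite_dim TYPE('e::real_inner)"
  shows "second_countable (euclidean :: 'e::real_inner topology)"
proof -
  obtain B :: "'e set" where B: "parseval_frame B"
    using finite_dim_parseval_frame[OF assms(1)] .
  obtain b and n :: nat where b: "bij_betw b {..<n} B"
    using ex_bij_betw_nat_finite[OF parseval_frame_finite[OF B]] by (auto simp: atLeast0LessThan)
  let ?r = "\<lambda>c::nat \<Rightarrow> real. \<Sum>i<n. c i *\<^sub>R b i"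
  have "retraction_maps (euclidean :: (nat \<Rightarrow> real) topology) euclidean ?r (\<lambda>x i. x \<bullet> b i)"
    unfolding retraction_maps_def continuous_map_iff_continuous2
  proof (intro conjI ballI)
    show "continuous_on UNIV ?r"
      by (intro continuous_on_sum continuous_on_scaleR continuous_on_const
            continuous_on_product_coordinates)
    show "continuous_on UNIV (\<lambda>x i. x \<bullet> b i)"
      by (intro continuous_on_coordinatewise_then_product continuous_intros)
    fix x :: 'e
    have "(\<Sum>i<n. (x \<bullet> b i) *\<^sub>R b i) = (\<Sum>c\<in>B. (x \<bullet> c) *\<^sub>R c)"
      using sum.reindex_bij_betw[OF b, of "\<lambda>c. (x \<bullet> c) *\<^sub>R c"] by simp
    then show "(\<Sum>i<n. (x \<bullet> b i) *\<^sub>R b i) = x"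
      using B by (simp add: parseval_frame_def)
  qed
  then have "retraction_map (euclidean :: (nat \<Rightarrow> real) topology) euclidean ?r"
    unfolding retraction_map_def by blast
  moreover have "second_countable (euclidean :: (nat \<Rightarrow> real) topology)"
  proof -
    obtain \<B> :: "(nat \<Rightarrow> real) set set" where "countable \<B>" "topological_basis \<B>"
      using ex_countable_basis by blast
    then show ?thesis unfolding second_countable_def
      by (metis open_openin topological_basis_def topological_basisE)
  qed
  ultimately show ?thesis by (rule second_countable_retraction_map_image)
qed

lemma second_countable_prod_topology:
  assumes "second_countable X" "second_countable Y"
  shows "second_countable (prod_topology X Y)"
proof -
  obtain A where A: "countable A" "\<And>V. V \<in> A \<Longrightarrow> openin X V"
    "\<And>U x. openin X U \<Longrightarrow> x \<in> U \<Longrightarrow> (\<exists>V \<in> A. x \<in> V \<and> V \<subseteq> U)"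
    using assms(1) by (auto simp: second_countable_def)
  obtain B where B: "countable B" "\<And>V. V \<in> B \<Longrightarrow> openin Y V"
    "\<And>U x. openin Y U \<Longrightarrow> x \<in> U \<Longrightarrow> (\<exists>V \<in> B. x \<in> V \<and> V \<subseteq> U)"
    using assms(2) by (auto simp: second_countable_def)
  show ?thesis unfolding second_countable_def
  proof (intro exI[of _ "(\<lambda>(U, V). U \<times> V) ` (A \<times> B)"] conjI allI impI)
    show "countable ((\<lambda>(U, V). U \<times> V) ` (A \<times> B))" using A B by auto
    show "\<forall>V\<in>(\<lambda>(U, V). U \<times> V) ` (A \<times> B). openin (prod_topology X Y) V"
      using A(2) B(2) by (auto simp: openin_prod_Times_iff)
    fix W z assume W: "openin (prod_topology X Y) W \<and> z \<in> W"
    obtain x y where z: "z = (x, y)" by fastforce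
    from W obtain U V where "openin X U" "openin Y V" "x \<in> U" "y \<in> V" "U \<times> V \<subseteq> W"
      unfolding z openin_prod_topology_alt by blast
    moreover obtain U' V' where "U' \<in> A" "x \<in> U'" "U' \<subseteq> U" "V' \<in> B" "y \<in> V'" "V' \<subseteq> V"
      using calculation A(3)[of U x] B(3)[of V y] by blast
    ultimately show "\<exists>V\<in>(\<lambda>(U, V). U \<times> V) ` (A \<times> B). z \<in> V \<and> V \<subseteq> W"
      unfolding z by (intro bexI[of _ "U' \<times> V'"]) auto
  qed
qed

section \<open>Smooth functions between vector spaces\<close>

lemma Ck_on_cong:
  assumes "open S" "\<And>x. x \<in> S \<Longrightarrow> f x = g x" "Ck_on k S f"
  shows "Ck_on k S g"
  using assms(2,3)
proof (induction k arbitrary: f g)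
  case 0
  then show ?case using continuous_on_cong by fastforce
next
  case (Suc k)
  have d: "(g has_derivative frechet_derivative f (at x)) (at x)" if "x \<in> S" for x
    using Suc.prems that assms(1)
    by (auto intro!: has_derivative_transform_within_open[of f _ x UNIV S g] simp: frechet_derivative_works)
  have e: "frechet_derivative f (at x) v = frechet_derivative g (at x) v" if "x \<in> S" for x v
    using frechet_derivative_at[OF d[OF that]] by simp
  have "Ck_on k S (\<lambda>x. frechet_derivative g (at x) v)" for v
    by (rule Suc.IH[of "\<lambda>x. frechet_derivative f (at x) v"]) (use Suc.prems e in auto)
  then show ?case using d by (auto simp: differentiable_def)
qed

lemma Ck_on_subset: "Ck_on k S f \<Longrightarrow> T \<subseteq> S \<Longrightarrow> Ck_on k T f"
  by (induction k arbitrary: f) (auto intro: continuous_on_subset)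

lemma Ck_on_Suc_imp: "Ck_on (Suc k) S f \<Longrightarrow> Ck_on k S f"
proof (induction k arbitrary: f)
  case 0
  then show ?case
    by (auto intro!: continuous_at_imp_continuous_on differentiable_imp_continuous_within)
next
  case (Suc k)
  then show ?case by auto
qed

lemma Ck_on_local:
  assumes "\<And>x. x \<in> S \<Longrightarrow> \<exists>T. open T \<and> x \<in> T \<and> Ck_on k T f"
  shows "Ck_on k S f"
  using assms
proof (induction k arbitrary: f)
  case 0
  then show ?case
    by (auto intro!: continuous_at_imp_continuous_on) (metis continuous_on_eq_continuous_at)
next
  case (Suc k)
  have "f differentiable at x" if "x \<in> S" for x using Suc.prems[OF that] by auto
  moreover have "Ck_on k S (\<lambda>x. frechet_derivative f (at x) v)" for v
    by (rule Suc.IH) (use Suc.prems in fastforce)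
  ultimately show ?case by auto
qed

lemma Ck_on_const: "Ck_on k S (\<lambda>x. c)"
  by (induction k arbitrary: c) auto

lemma Ck_on_bounded_linear:
  assumes "bounded_linear f" shows "Ck_on k S f"
proof (cases k)
  case 0
  then show ?thesis using assms by (simp add: linear_continuous_on)
next
  case (Suc j)
  have d: "(f has_derivative f) (at x)" for x
    using bounded_linear_imp_has_derivative[OF assms] .
  show ?thesis unfolding Suc
    using frechet_derivative_at[OF d, symmetric] d by (auto simp: differentiable_def Ck_on_const)
qed

lemma Ck_on_add:
  assumes "open S" "Ck_on k S f" "Ck_on k S g"
  shows "Ck_on k S (\<lambda>x. f x + g x)"
  using assms(2,3)
proof (induction k arbitrary: f g)
  case (Suc k)
  have d: "((\<lambda>x. f x + g x) has_derivative
      (\<lambda>v. frechet_derivative f (at x) v + frechet_derivative g (at x) v)) (at x)" if "x \<in> S" for x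
    using Suc.prems that by (auto intro!: has_derivative_add simp flip: frechet_derivative_works)
  have "Ck_on k S (\<lambda>x. frechet_derivative (\<lambda>x. f x + g x) (at x) v)" for v
    by (rule Ck_on_cong[OF assms(1) _ Suc.IH[of "\<lambda>x. frechet_derivative f (at x) v"
            "\<lambda>x. frechet_derivative g (at x) v"]])
      (use Suc.prems frechet_derivative_at[OF d] in \<open>auto simp: fun_eq_iff\<close>)
  then show ?case using d by (auto simp: differentiable_def)
qed (auto intro: continuous_intros)

lemma Ck_on_sum:
  assumes "open S" "\<And>i. i \<in> I \<Longrightarrow> Ck_on k S (f i)"
  shows "Ck_on k S (\<lambda>x. \<Sum>i\<in>I. f i x)"
  using assms(2)
  by (induction I rule: infinite_finite_induct) (auto intro: Ck_on_const Ck_on_add[OF assms(1)])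

lemma (in bounded_bilinear) Ck_on_bilinear:
  assumes "open S" "Ck_on k S f" "Ck_on k S g"
  shows "Ck_on k S (\<lambda>x. prod (f x) (g x))"
  using assms(2,3)
proof (induction k arbitrary: f g)
  case 0
  then show ?case by (auto intro: continuous_on)
next
  case (Suc k)
  let ?d = "\<lambda>x v. prod (f x) (frechet_derivative g (at x) v) + prod (frechet_derivative f (at x) v) (g x)"
  have d: "((\<lambda>x. prod (f x) (g x)) has_derivative ?d x) (at x)" if "x \<in> S" for x
    using Suc.prems that by (intro FDERIV) (auto simp flip: frechet_derivative_works)
  have "Ck_on k S (\<lambda>x. ?d x v)" for v
    using Suc.prems Ck_on_Suc_imp[OF Suc.prems(1)] Ck_on_Suc_imp[OF Suc.prems(2)]
    by (intro Ck_on_add assms Suc.IH) auto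
  then have "Ck_on k S (\<lambda>x. frechet_derivative (\<lambda>x. prod (f x) (g x)) (at x) v)" for v
    by (rule Ck_on_cong[OF assms(1), rotated]) (use frechet_derivative_at[OF d] in \<open>simp add: fun_eq_iff\<close>)
  then show ?case using d by (auto simp: differentiable_def)
qed

lemma Ck_on_bounded_linear_compose:
  assumes "bounded_linear h" "open S" "Ck_on k S f"
  shows "Ck_on k S (\<lambda>x. h (f x))"
  using assms(3)
proof (induction k arbitrary: f)
  case 0
  then show ?case using bounded_linear.continuous_on[OF assms(1)] by auto
next
  case (Suc k)
  have d: "((\<lambda>x. h (f x)) has_derivative (\<lambda>v. h (frechet_derivative f (at x) v))) (at x)" if "x \<in> S" for x
    using Suc.prems that
    by (intro bounded_linear.has_derivative[OF assms(1)]) (auto simp flip: frechet_derivative_works)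
  have "Ck_on k S (\<lambda>x. frechet_derivative (\<lambda>x. h (f x)) (at x) v)" for v
    by (rule Ck_on_cong[OF assms(2) _ Suc.IH[of "\<lambda>x. frechet_derivative f (at x) v"]])
      (use Suc.prems frechet_derivative_at[OF d] in \<open>auto simp: fun_eq_iff\<close>)
  then show ?case using d by (auto simp: differentiable_def)
qed

text \<open>
  The definition of \<open>Ck_on\<close> speaks of the derivative in each fixed direction. In the chain rule
  the direction \<open>f'(x) v\<close> moves with \<open>x\<close>; expanding it in a frame of the intermediate space leaves
  only the fixed directions \<open>b\<close>, which is why that space has to be finite-dimensional.
\<close>

lemma Ck_on_compose:
  fixes f :: "'e::real_normed_vector \<Rightarrow> 'f::real_inner"
  assumes fin: "finite_dim TYPE('f)" and S: "open S" and T: "open T" and ST: "f ` S \<subseteq> T"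
    and f: "Ck_on k S f" and g: "Ck_on k T g"
  shows "Ck_on k S (\<lambda>x. g (f x))"
  using f g
proof (induction k arbitrary: g)
  case 0
  then show ?case using continuous_on_compose2 ST by auto
next
  case (Suc k)
  obtain B :: "'f set" where B: "parseval_frame B"
    using finite_dim_parseval_frame[OF fin] .
  have d: "((\<lambda>x. g (f x)) has_derivative
      (\<lambda>v. frechet_derivative g (at (f x)) (frechet_derivative f (at x) v))) (at x)" if "x \<in> S" for x
    using Suc.prems that ST
    by (intro has_derivative_compose[of f _ x UNIV g]) (auto simp flip: frechet_derivative_works)
  have e: "frechet_derivative (\<lambda>x. g (f x)) (at x) v
      = (\<Sum>b\<in>B. (frechet_derivative f (at x) v \<bullet> b) *\<^sub>R frechet_derivative g (at (f x)) b)"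
    if "x \<in> S" for x v
    unfolding frechet_derivative_at[OF d[OF that], symmetric]
    by (rule linear_frame_expansion[OF B])
      (use Suc.prems that ST in \<open>auto intro!: linear_frechet_derivative\<close>)
  have "Ck_on k S (\<lambda>x. \<Sum>b\<in>B. (frechet_derivative f (at x) v \<bullet> b) *\<^sub>R frechet_derivative g (at (f x)) b)" for v
    using Suc.prems Ck_on_Suc_imp[OF Suc.prems(1)]
    by (intro Ck_on_sum S bounded_bilinear.Ck_on_bilinear[OF bounded_bilinear_scaleR] Suc.IH
        Ck_on_bounded_linear_compose[OF bounded_linear_inner_left]) auto
  then have "Ck_on k S (\<lambda>x. frechet_derivative (\<lambda>x. g (f x)) (at x) v)" for v
    by (rule Ck_on_cong[OF S, rotated]) (simp add: e)
  then show ?case using d by (auto simp: differentiable_def)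
qed

text \<open>
  Smoothness near a point. Since smoothness on an open set is local, all later arguments can be made
  pointwise, without keeping track of the domains of charts.
\<close>

definition cinf_at :: "('e::real_normed_vector \<Rightarrow> 'f::real_normed_vector) \<Rightarrow> 'e \<Rightarrow> bool" where
  "cinf_at f x \<longleftrightarrow> (\<exists>T. open T \<and> x \<in> T \<and> Cinf_on T f)"

lemma Cinf_on_iff_cinf_at: "open S \<Longrightarrow> Cinf_on S f \<longleftrightarrow> (\<forall>x\<in>S. cinf_at f x)"
  unfolding cinf_at_def Cinf_on_def by (meson Ck_on_local)

lemma cinf_at_cong:
  assumes "cinf_at f x" "\<forall>\<^sub>F y in nhds x. f y = g y"
  shows "cinf_at g x"
proof -
  obtain S T where "open S" "x \<in> S" "\<And>y. y \<in> S \<Longrightarrow> f y = g y" "open T" "x \<in> T" "Cinf_on T f"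
    using assms by (auto simp: eventually_nhds cinf_at_def)
  then show ?thesis unfolding cinf_at_def Cinf_on_def
    by (intro exI[of _ "S \<inter> T"]) (auto intro: Ck_on_cong[of _ f] Ck_on_subset)
qed

lemma cinf_at_differentiable: "cinf_at f x \<Longrightarrow> f differentiable (at x)"
  unfolding cinf_at_def Cinf_on_def by (metis Ck_on.simps(2))

lemma cinf_at_has_derivative: "cinf_at f x \<Longrightarrow> (f has_derivative frechet_derivative f (at x)) (at x)"
  using cinf_at_differentiable frechet_derivative_works by blast

lemma cinf_at_isCont: "cinf_at f x \<Longrightarrow> isCont f x"
  by (simp add: cinf_at_differentiable differentiable_imp_continuous_within)

lemma cinf_at_frechet_derivative: "cinf_at f x \<Longrightarrow> cinf_at (\<lambda>y. frechet_derivative f (at y) v) x"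
  unfolding cinf_at_def Cinf_on_def by (metis Ck_on.simps(2))

lemma cinf_at_compose:
  fixes f :: "'e::real_normed_vector \<Rightarrow> 'f::real_inner"
  assumes fin: "finite_dim TYPE('f)" and f: "cinf_at f x" and g: "cinf_at g (f x)"
  shows "cinf_at (\<lambda>y. g (f y)) x"
proof -
  obtain S T where ST: "open S" "x \<in> S" "Cinf_on S f" "open T" "f x \<in> T" "Cinf_on T g"
    using assms by (auto simp: cinf_at_def)
  have c: "continuous_on S f" using ST(3) unfolding Cinf_on_def by (metis Ck_on.simps(1))
  then have "open (S \<inter> f -` T)" using ST by (simp add: continuous_open_preimage)
  moreover have "Ck_on k (S \<inter> f -` T) (\<lambda>y. g (f y))" for k
    by (rule Ck_on_compose[OF fin calculation ST(4)])
      (use ST in \<open>auto simp: Cinf_on_def intro: Ck_on_subset\<close>)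
  ultimately show ?thesis unfolding cinf_at_def Cinf_on_def using ST by blast
qed

lemma cinf_at_bounded_linear: "bounded_linear f \<Longrightarrow> cinf_at f x"
  unfolding cinf_at_def Cinf_on_def using Ck_on_bounded_linear by blast

lemma cinf_at_const: "cinf_at (\<lambda>_. c) x"
  unfolding cinf_at_def Cinf_on_def using Ck_on_const by blast

lemma cinf_at_ident: "cinf_at (\<lambda>x. x) x"
  by (rule cinf_at_bounded_linear) (rule bounded_linear_ident)

lemma cinf_at_add:
  assumes "cinf_at f x" "cinf_at g x"
  shows "cinf_at (\<lambda>y. f y + g y) x"
proof -
  obtain S T where "open S" "x \<in> S" "Cinf_on S f" "open T" "x \<in> T" "Cinf_on T g"
    using assms by (auto simp: cinf_at_def)
  then show ?thesis unfolding cinf_at_def Cinf_on_def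
    by (intro exI[of _ "S \<inter> T"] conjI allI Ck_on_add) (auto intro: Ck_on_subset)
qed

lemma (in bounded_bilinear) cinf_at_bilinear:
  assumes "cinf_at f x" "cinf_at g x"
  shows "cinf_at (\<lambda>y. prod (f y) (g y)) x"
proof -
  obtain S T where "open S" "x \<in> S" "Cinf_on S f" "open T" "x \<in> T" "Cinf_on T g"
    using assms by (auto simp: cinf_at_def)
  then show ?thesis unfolding cinf_at_def Cinf_on_def
    by (intro exI[of _ "S \<inter> T"] conjI allI Ck_on_bilinear) (auto intro: Ck_on_subset)
qed

lemma cinf_at_bounded_linear_compose:
  assumes "bounded_linear h" "cinf_at f x"
  shows "cinf_at (\<lambda>y. h (f y)) x"
  using assms(2) unfolding cinf_at_def Cinf_on_def
  using Ck_on_bounded_linear_compose[OF assms(1)] by blast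

lemma cinf_at_Pair:
  assumes "cinf_at f x" "cinf_at g x"
  shows "cinf_at (\<lambda>y. (f y, g y)) x"
proof -
  have "cinf_at (\<lambda>y. (f y, 0) + (0, g y)) x"
    by (intro cinf_at_add cinf_at_bounded_linear_compose[OF _ assms(1)]
        cinf_at_bounded_linear_compose[OF _ assms(2)])
      (auto intro!: bounded_linear_Pair bounded_linear_zero bounded_linear_ident)
  then show ?thesis by simp
qed

section \<open>Charts and smooth maps\<close>

context
  fixes M :: "('a, 'e::real_normed_vector) manifold" and U \<phi>
  assumes M: "smooth_manifold M" and ch: "(U, \<phi>) \<in> atlas M"
begin

lemma chart_openin: "openin (mtop M) U"
  using M ch by (auto simp: smooth_manifold_def)

lemma chart_subset: "U \<subseteq> points M"
  using chart_openin openin_subset by blast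

lemma chart_homeomorphic_map: "homeomorphic_map (subtopology (mtop M) U) (top_of_set (\<phi> ` U)) \<phi>"
  using M ch by (auto simp: smooth_manifold_def)

lemma chart_inj_on: "inj_on \<phi> U"
  using homeomorphic_imp_injective_map[OF chart_homeomorphic_map] chart_subset
  by (simp add: Int_absorb1)

lemma chart_inverse: "x \<in> U \<Longrightarrow> inv_into U \<phi> (\<phi> x) = x"
  using chart_inj_on by simp

lemma chart_image_open:
  assumes "openin (mtop M) W"
  shows "open (\<phi> ` (U \<inter> W))"
proof -
  have "openin (subtopology (mtop M) U) (U \<inter> W)"
    using assms by (simp add: openin_subtopology_Int2)
  then have "openin (top_of_set (\<phi> ` U)) (\<phi> ` (U \<inter> W))"
    using homeomorphic_imp_open_map[OF chart_homeomorphic_map] by (simp add: open_map_def)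
  moreover have "open (\<phi> ` U)" using M ch by (auto simp: smooth_manifold_def)
  ultimately show ?thesis using openin_open_trans by blast
qed

lemma chart_preimage_openin:
  assumes "open T"
  shows "openin (mtop M) (U \<inter> \<phi> -` T)"
proof -
  have "continuous_map (subtopology (mtop M) U) euclidean \<phi>"
    using homeomorphic_imp_continuous_map[OF chart_homeomorphic_map] continuous_map_into_fulltopology by blast
  then have "openin (subtopology (mtop M) U) {x \<in> topspace (subtopology (mtop M) U). \<phi> x \<in> T}"
    using assms by (intro openin_continuous_map_preimage[where Y=euclidean]) auto
  moreover have "{x \<in> topspace (subtopology (mtop M) U). \<phi> x \<in> T} = U \<inter> \<phi> -` T"
    using chart_subset by auto
  ultimately show ?thesis using chart_openin openin_trans_full by metis
qed

lemma eventually_chart_inverse: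
  assumes "x \<in> U" "openin (mtop M) W" "x \<in> W"
  shows "\<forall>\<^sub>F a in nhds (\<phi> x). inv_into U \<phi> a \<in> U \<and> inv_into U \<phi> a \<in> W \<and> \<phi> (inv_into U \<phi> a) = a"
  unfolding eventually_nhds
proof (intro exI conjI ballI)
  show "open (\<phi> ` (U \<inter> W))" by (rule chart_image_open) fact
  show "\<phi> x \<in> \<phi> ` (U \<inter> W)" using assms by auto
qed (auto simp: chart_inverse)

end

lemma chart_at:
  assumes "smooth_manifold M" "x \<in> points M"
  obtains U \<phi> where "(U, \<phi>) \<in> atlas M" "x \<in> U"
  using assms by (force simp: smooth_manifold_def)

lemma chart_transition:
  assumes M: "smooth_manifold M" and c: "(U, \<phi>) \<in> atlas M" "(V, \<psi>) \<in> atlas M" "x \<in> U" "x \<in> V"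
  shows "cinf_at (\<lambda>a. \<psi> (inv_into U \<phi> a)) (\<phi> x)"
proof -
  have "Cinf_on (\<phi> ` (U \<inter> V)) (\<psi> \<circ> inv_into U \<phi>)"
    using assms unfolding smooth_manifold_def by fast
  moreover have "open (\<phi> ` (U \<inter> V))" using chart_image_open[OF M c(1) chart_openin[OF M c(2)]] .
  ultimately show ?thesis using c by (auto simp: Cinf_on_iff_cinf_at o_def)
qed

lemma smooth_manifold_finite_dim:
  "smooth_manifold (M :: ('a, 'e::real_normed_vector) manifold) \<Longrightarrow> finite_dim TYPE('e)"
  by (simp add: smooth_manifold_def)

text \<open>
  A smooth map together with the fact that both sides are manifolds, so that the rules below compose
  without side conditions.
\<close>

definition smap ::
  "('a, 'e::real_inner) manifold \<Rightarrow> ('b, 'f::real_inner) manifold \<Rightarrow> ('a \<Rightarrow> 'b) \<Rightarrow> bool"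
  where "smap M N f \<longleftrightarrow> smooth_manifold M \<and> smooth_manifold N \<and> smooth_map M N f"

lemma smap_smooth_map: "smap M N f \<Longrightarrow> smooth_map M N f"
  and smap_source: "smap M N f \<Longrightarrow> smooth_manifold M"
  and smap_target: "smap M N f \<Longrightarrow> smooth_manifold N"
  and smap_continuous_map: "smap M N f \<Longrightarrow> continuous_map (mtop M) (mtop N) f"
  and smap_points: "smap M N f \<Longrightarrow> x \<in> points M \<Longrightarrow> f x \<in> points N"
  by (auto simp: smap_def smooth_map_def dest: continuous_map_funspace)

lemma smap_preimage_openin:
  assumes "smap M N f" "openin (mtop N) V"
  shows "openin (mtop M) {x \<in> points M. f x \<in> V}"
  using openin_continuous_map_preimage[OF smap_continuous_map[OF assms(1)] assms(2)] .

lemma smap_in_charts: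
  assumes f: "smap M N f" and c: "(U, \<phi>) \<in> atlas M" "(V, \<psi>) \<in> atlas N" "x \<in> U" "f x \<in> V"
  shows "cinf_at (\<lambda>a. \<psi> (f (inv_into U \<phi> a))) (\<phi> x)"
proof -
  have "Cinf_on (\<phi> ` (U \<inter> f -` V)) (\<psi> \<circ> f \<circ> inv_into U \<phi>)"
    using f c unfolding smap_def smooth_map_def by fast
  moreover have "U \<inter> f -` V = U \<inter> {x \<in> points M. f x \<in> V}"
    using chart_subset[OF smap_source[OF f] c(1)] by auto
  then have "open (\<phi> ` (U \<inter> f -` V))"
    using chart_image_open[OF smap_source[OF f] c(1)]
      smap_preimage_openin[OF f chart_openin[OF smap_target[OF f] c(2)]] by simp
  ultimately show ?thesis using c by (auto simp: Cinf_on_iff_cinf_at o_def)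
qed

text \<open>
  One pair of charts around each point suffices, because the transition maps are smooth.
\<close>

lemma smapI:
  assumes M: "smooth_manifold M" and N: "smooth_manifold N"
    and cont: "continuous_map (mtop M) (mtop N) f"
    and loc: "\<And>x. x \<in> points M \<Longrightarrow> \<exists>U \<phi> V \<psi>. (U, \<phi>) \<in> atlas M \<and> (V, \<psi>) \<in> atlas N \<and> x \<in> U \<and> f x \<in> V \<and>
      cinf_at (\<lambda>a. \<psi> (f (inv_into U \<phi> a))) (\<phi> x)"
  shows "smap M N f"
  unfolding smap_def smooth_map_def
proof (intro conjI M N cont, safe)
  fix U \<phi> V \<psi> assume c: "(U, \<phi>) \<in> atlas M" "(V, \<psi>) \<in> atlas N"
  have pre: "openin (mtop M) {x \<in> points M. f x \<in> W}" if "openin (mtop N) W" for W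
    using openin_continuous_map_preimage[OF cont that] .
  have "U \<inter> f -` V = U \<inter> {x \<in> points M. f x \<in> V}" using chart_subset[OF M c(1)] by auto
  then have op: "open (\<phi> ` (U \<inter> f -` V))"
    using chart_image_open[OF M c(1)] pre chart_openin[OF N c(2)] by simp
  show "Cinf_on (\<phi> ` (U \<inter> f -` V)) (\<psi> \<circ> f \<circ> inv_into U \<phi>)"
    unfolding Cinf_on_iff_cinf_at[OF op]
  proof safe
    fix x assume x: "x \<in> U" "f x \<in> V"
    then have xM: "x \<in> points M" using chart_subset[OF M c(1)] by auto
    obtain U' \<phi>' V' \<psi>' where c': "(U', \<phi>') \<in> atlas M" "(V', \<psi>') \<in> atlas N" "x \<in> U'" "f x \<in> V'"
      and sm: "cinf_at (\<lambda>a. \<psi>' (f (inv_into U' \<phi>' a))) (\<phi>' x)"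
      using loc[OF xM] by blast
    note [simp] = chart_inverse[OF M c(1) x(1)] chart_inverse[OF M c'(1) c'(3)]
    have 1: "cinf_at (\<lambda>a. \<phi>' (inv_into U \<phi> a)) (\<phi> x)"
      using chart_transition[OF M c(1) c'(1) x(1) c'(3)] .
    have 2: "cinf_at (\<lambda>b. \<psi> (inv_into V' \<psi>' b)) (\<psi>' (f x))"
      using chart_transition[OF N c'(2) c(2) c'(4) x(2)] .
    have 3: "cinf_at (\<lambda>a. \<psi>' (f (inv_into U' \<phi>' (\<phi>' (inv_into U \<phi> a))))) (\<phi> x)"
      by (rule cinf_at_compose[OF smooth_manifold_finite_dim[OF M] 1]) (simp add: sm)
    have 4: "cinf_at (\<lambda>a. \<psi> (inv_into V' \<psi>' (\<psi>' (f (inv_into U' \<phi>' (\<phi>' (inv_into U \<phi> a))))))) (\<phi> x)"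
      by (rule cinf_at_compose[OF smooth_manifold_finite_dim[OF N] 3]) (simp add: 2)
    show "cinf_at (\<psi> \<circ> f \<circ> inv_into U \<phi>) (\<phi> x)"
    proof (rule cinf_at_cong[OF 4])
      let ?W = "U' \<inter> {x \<in> points M. f x \<in> V'}"
      have "openin (mtop M) ?W"
        using pre[OF chart_openin[OF N c'(2)]] chart_openin[OF M c'(1)] by blast
      then have "\<forall>\<^sub>F a in nhds (\<phi> x). inv_into U \<phi> a \<in> ?W"
        using eventually_chart_inverse[OF M c(1) x(1), of ?W] c' xM by (auto elim: eventually_mono)
      then show "\<forall>\<^sub>F a in nhds (\<phi> x). \<psi> (inv_into V' \<psi>' (\<psi>' (f (inv_into U' \<phi>' (\<phi>' (inv_into U \<phi> a))))))
          = (\<psi> \<circ> f \<circ> inv_into U \<phi>) a"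
        by eventually_elim (simp add: chart_inverse[OF M c'(1)] chart_inverse[OF N c'(2)])
    qed
  qed
qed

lemma smap_compose:
  assumes g: "smap N K g" and f: "smap M N f"
  shows "smap M K (\<lambda>x. g (f x))"
proof (rule smapI)
  show "smooth_manifold M" "smooth_manifold K" using assms by (auto simp: smap_def)
  show "continuous_map (mtop M) (mtop K) (\<lambda>x. g (f x))"
    using continuous_map_compose[OF smap_continuous_map[OF f] smap_continuous_map[OF g]] by (simp add: o_def)
  fix x assume x: "x \<in> points M"
  obtain U \<phi> where c: "(U, \<phi>) \<in> atlas M" "x \<in> U" using chart_at[OF smap_source[OF f] x] .
  obtain V \<psi> where d: "(V, \<psi>) \<in> atlas N" "f x \<in> V" using chart_at[OF smap_source[OF g] smap_points[OF f x]] .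
  obtain W \<theta> where e: "(W, \<theta>) \<in> atlas K" "g (f x) \<in> W"
    using chart_at[OF smap_target[OF g] smap_points[OF g smap_points[OF f x]]] .
  have 1: "cinf_at (\<lambda>a. \<psi> (f (inv_into U \<phi> a))) (\<phi> x)" by (rule smap_in_charts) fact+
  have 2: "cinf_at (\<lambda>a. \<theta> (g (inv_into V \<psi> a))) (\<psi> (f x))" by (rule smap_in_charts) fact+
  have 3: "cinf_at (\<lambda>a. \<theta> (g (inv_into V \<psi> (\<psi> (f (inv_into U \<phi> a)))))) (\<phi> x)"
    by (rule cinf_at_compose[OF smooth_manifold_finite_dim[OF smap_source[OF g]] 1])
      (simp add: 2 chart_inverse[OF smap_source[OF f] c])
  have "cinf_at (\<lambda>a. \<theta> (g (f (inv_into U \<phi> a)))) (\<phi> x)"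
  proof (rule cinf_at_cong[OF 3])
    have "\<forall>\<^sub>F a in nhds (\<phi> x). inv_into U \<phi> a \<in> {x \<in> points M. f x \<in> V}"
      using eventually_chart_inverse[OF smap_source[OF f] c
        smap_preimage_openin[OF f chart_openin[OF smap_source[OF g] d(1)]]] x d
      by (auto elim: eventually_mono)
    then show "\<forall>\<^sub>F a in nhds (\<phi> x). \<theta> (g (inv_into V \<psi> (\<psi> (f (inv_into U \<phi> a))))) = \<theta> (g (f (inv_into U \<phi> a)))"
      by eventually_elim (simp add: chart_inverse[OF smap_source[OF g] d(1)])
  qed
  then show "\<exists>U \<phi> V \<psi>. (U, \<phi>) \<in> atlas M \<and> (V, \<psi>) \<in> atlas K \<and> x \<in> U \<and> g (f x) \<in> V \<and>
      cinf_at (\<lambda>a. \<psi> (g (f (inv_into U \<phi> a)))) (\<phi> x)"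
    using c e by blast
qed

lemma smap_ident:
  assumes "smooth_manifold M" shows "smap M M (\<lambda>x. x)"
proof (rule smapI)
  fix x assume "x \<in> points M"
  then obtain U \<phi> where c: "(U, \<phi>) \<in> atlas M" "x \<in> U" using chart_at[OF assms] by blast
  then show "\<exists>U \<phi> V \<psi>. (U, \<phi>) \<in> atlas M \<and> (V, \<psi>) \<in> atlas M \<and> x \<in> U \<and> x \<in> V \<and>
      cinf_at (\<lambda>a. \<psi> (inv_into U \<phi> a)) (\<phi> x)"
    using chart_transition[OF assms c(1) c(1)] by blast
qed (use assms in auto)

lemma smap_const:
  assumes "smooth_manifold M" "smooth_manifold N" "y \<in> points N" shows "smap M N (\<lambda>x. y)"
proof (rule smapI)
  fix x assume "x \<in> points M"
  then obtain U \<phi> where c: "(U, \<phi>) \<in> atlas M" "x \<in> U" using chart_at[OF assms(1)] by blast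
  obtain V \<psi> where d: "(V, \<psi>) \<in> atlas N" "y \<in> V" using chart_at[OF assms(2,3)] by blast
  with c show "\<exists>U \<phi> V \<psi>. (U, \<phi>) \<in> atlas M \<and> (V, \<psi>) \<in> atlas N \<and> x \<in> U \<and> y \<in> V \<and>
      cinf_at (\<lambda>a. \<psi> y) (\<phi> x)"
    using cinf_at_const by blast
qed (use assms in auto)

lemma smap_cong:
  assumes f: "smap M N f" and eq: "\<And>x. x \<in> points M \<Longrightarrow> f x = g x"
  shows "smap M N g"
proof (rule smapI)
  show M: "smooth_manifold M" and N: "smooth_manifold N" using f by (auto simp: smap_def)
  show "continuous_map (mtop M) (mtop N) g"
    using continuous_map_eq[OF smap_continuous_map[OF f]] eq by blast
  fix x assume x: "x \<in> points M"
  then obtain U \<phi> where c: "(U, \<phi>) \<in> atlas M" "x \<in> U" using chart_at[OF M] by blast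
  obtain V \<psi> where d: "(V, \<psi>) \<in> atlas N" "f x \<in> V" using chart_at[OF N smap_points[OF f x]] .
  have "cinf_at (\<lambda>a. \<psi> (g (inv_into U \<phi> a))) (\<phi> x)"
  proof (rule cinf_at_cong)
    show "cinf_at (\<lambda>a. \<psi> (f (inv_into U \<phi> a))) (\<phi> x)" by (rule smap_in_charts) fact+
    have "\<forall>\<^sub>F a in nhds (\<phi> x). inv_into U \<phi> a \<in> points M"
      using eventually_chart_inverse[OF M c, of "points M"] x by (auto elim: eventually_mono)
    then show "\<forall>\<^sub>F a in nhds (\<phi> x). \<psi> (f (inv_into U \<phi> a)) = \<psi> (g (inv_into U \<phi> a))"
      by eventually_elim (simp add: eq)
  qed
  then show "\<exists>U \<phi> V \<psi>. (U, \<phi>) \<in> atlas M \<and> (V, \<psi>) \<in> atlas N \<and> x \<in> U \<and> g x \<in> V \<and>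
      cinf_at (\<lambda>a. \<psi> (g (inv_into U \<phi> a))) (\<phi> x)"
    unfolding eq[OF x, symmetric] using c d by blast
qed

section \<open>Product manifolds\<close>

lemma points_prod_mfd [simp]: "points (prod_mfd M N) = points M \<times> points N"
  by (simp add: prod_mfd_def)

lemma mtop_prod_mfd: "mtop (prod_mfd M N) = prod_topology (mtop M) (mtop N)"
  by (simp add: prod_mfd_def)

lemma prod_mfd_chartI:
  "(U, \<phi>) \<in> atlas M \<Longrightarrow> (V, \<psi>) \<in> atlas N \<Longrightarrow> (U \<times> V, map_prod \<phi> \<psi>) \<in> atlas (prod_mfd M N)"
  by (auto simp: prod_mfd_def)

lemma inv_into_map_prod:
  assumes "inj_on f A" "inj_on g B" "a \<in> f ` A" "b \<in> g ` B"
  shows "inv_into (A \<times> B) (map_prod f g) (a, b) = (inv_into A f a, inv_into B g b)"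
proof -
  obtain x y where xy: "a = f x" "x \<in> A" "b = g y" "y \<in> B" using assms by auto
  have "inj_on (map_prod f g) (A \<times> B)" using assms by (auto simp: inj_on_def)
  then have "inv_into (A \<times> B) (map_prod f g) (map_prod f g (x, y)) = (x, y)"
    using xy by (intro inv_into_f_f) auto
  then show ?thesis using xy assms by simp
qed

lemma smooth_manifold_prod:
  fixes M :: "('a, 'e::real_inner) manifold" and N :: "('b, 'f::real_inner) manifold"
  assumes M: "smooth_manifold M" and N: "smooth_manifold N"
  shows "smooth_manifold (prod_mfd M N)"
  unfolding smooth_manifold_def
proof (intro conjI)
  note fd = smooth_manifold_finite_dim[OF M] smooth_manifold_finite_dim[OF N]
  show fd2: "finite_dim TYPE('e \<times> 'f)" by (intro finite_dim_prod fd)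
  show "Hausdorff_space (mtop (prod_mfd M N))"
    using M N by (simp add: mtop_prod_mfd smooth_manifold_def Hausdorff_space_prod_topology)
  show "second_countable (mtop (prod_mfd M N))"
    using M N by (simp add: mtop_prod_mfd smooth_manifold_def second_countable_prod_topology)
  have cov: "(\<Union>(U, \<phi>)\<in>atlas M. U) = points M" "(\<Union>(U, \<phi>)\<in>atlas N. U) = points N"
    using M N by (auto simp: smooth_manifold_def)
  show "(\<Union>(U, \<phi>)\<in>atlas (prod_mfd M N). U) = points (prod_mfd M N)"
  proof -
    have "(\<Union>(U, \<phi>)\<in>atlas (prod_mfd M N). U) = (\<Union>(U, \<phi>)\<in>atlas M. U) \<times> (\<Union>(U, \<phi>)\<in>atlas N. U)"
      by (auto simp: prod_mfd_def) blast
    then show ?thesis by (simp add: cov)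
  qed
  show "\<forall>(U, \<phi>)\<in>atlas (prod_mfd M N). openin (mtop (prod_mfd M N)) U \<and> open (\<phi> ` U) \<and>
      homeomorphic_map (subtopology (mtop (prod_mfd M N)) U) (top_of_set (\<phi> ` U)) \<phi>"
  proof safe
    fix W \<theta> assume "(W, \<theta>) \<in> atlas (prod_mfd M N)"
    then obtain U \<phi> V \<psi> where c: "(U, \<phi>) \<in> atlas M" "(V, \<psi>) \<in> atlas N"
      and W: "W = U \<times> V" "\<theta> = map_prod \<phi> \<psi>" by (auto simp: prod_mfd_def)
    show "openin (mtop (prod_mfd M N)) W"
      using chart_openin[OF M c(1)] chart_openin[OF N c(2)] W
      by (simp add: mtop_prod_mfd openin_prod_Times_iff)
    have im: "\<theta> ` W = \<phi> ` U \<times> \<psi> ` V" unfolding W by (auto simp: map_prod_def)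
    show "open (\<theta> ` W)" unfolding im
      using chart_image_open[OF M c(1) chart_openin[OF M c(1)]]
        chart_image_open[OF N c(2) chart_openin[OF N c(2)]] by (simp add: open_Times)
    obtain \<phi>' \<psi>' where
      "homeomorphic_maps (subtopology (mtop M) U) (top_of_set (\<phi> ` U)) \<phi> \<phi>'"
      "homeomorphic_maps (subtopology (mtop N) V) (top_of_set (\<psi> ` V)) \<psi> \<psi>'"
      using chart_homeomorphic_map[OF M c(1)] chart_homeomorphic_map[OF N c(2)]
      by (auto simp: homeomorphic_map_maps)
    then have "homeomorphic_maps (subtopology (mtop (prod_mfd M N)) W) (top_of_set (\<theta> ` W))
        (\<lambda>(x, y). (\<phi> x, \<psi> y)) (\<lambda>(x, y). (\<phi>' x, \<psi>' y))"
      unfolding im unfolding W(1) mtop_prod_mfd subtopology_Times prod_topology_subtopology_eu[symmetric]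
      by (simp only: homeomorphic_maps_prod) simp
    then show "homeomorphic_map (subtopology (mtop (prod_mfd M N)) W) (top_of_set (\<theta> ` W)) \<theta>"
      unfolding W(2) map_prod_def homeomorphic_map_maps by blast
  qed
  show "\<forall>(U, \<phi>)\<in>atlas (prod_mfd M N). \<forall>(V, \<psi>)\<in>atlas (prod_mfd M N).
      Cinf_on (\<phi> ` (U \<inter> V)) (\<psi> \<circ> inv_into U \<phi>)"
  proof safe
    fix W \<theta> W' \<theta>' assume "(W, \<theta>) \<in> atlas (prod_mfd M N)" "(W', \<theta>') \<in> atlas (prod_mfd M N)"
    then obtain U \<phi> V \<psi> U' \<phi>' V' \<psi>' where c: "(U, \<phi>) \<in> atlas M" "(V, \<psi>) \<in> atlas N"
      "(U', \<phi>') \<in> atlas M" "(V', \<psi>') \<in> atlas N"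
      and W: "W = U \<times> V" "\<theta> = map_prod \<phi> \<psi>" "W' = U' \<times> V'" "\<theta>' = map_prod \<phi>' \<psi>'"
      by (auto simp: prod_mfd_def)
    have im: "\<theta> ` (W \<inter> W') = \<phi> ` (U \<inter> U') \<times> \<psi> ` (V \<inter> V')" unfolding W by (auto simp: map_prod_def)
    have op: "open (\<theta> ` (W \<inter> W'))" unfolding im
      using chart_image_open[OF M c(1) chart_openin[OF M c(3)]]
        chart_image_open[OF N c(2) chart_openin[OF N c(4)]] by (simp add: open_Times)
    show "Cinf_on (\<theta> ` (W \<inter> W')) (\<theta>' \<circ> inv_into W \<theta>)"
      unfolding Cinf_on_iff_cinf_at[OF op]
    proof
      fix z assume "z \<in> \<theta> ` (W \<inter> W')"
      then obtain x y where z: "z = (\<phi> x, \<psi> y)" "x \<in> U" "x \<in> U'" "y \<in> V" "y \<in> V'"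
        unfolding im by auto
      have "cinf_at (\<lambda>z. \<phi>' (inv_into U \<phi> (fst z))) z"
        by (rule cinf_at_compose[of fst, OF fd(1) cinf_at_bounded_linear[OF bounded_linear_fst]])
          (use z c chart_transition[OF M] in auto)
      moreover have "cinf_at (\<lambda>z. \<psi>' (inv_into V \<psi> (snd z))) z"
        by (rule cinf_at_compose[of snd, OF fd(2) cinf_at_bounded_linear[OF bounded_linear_snd]])
          (use z c chart_transition[OF N] in auto)
      ultimately have "cinf_at (\<lambda>z. (\<phi>' (inv_into U \<phi> (fst z)), \<psi>' (inv_into V \<psi> (snd z)))) z"
        by (rule cinf_at_Pair)
      then show "cinf_at (\<theta>' \<circ> inv_into W \<theta>) z"
      proof (rule cinf_at_cong)
        have "(\<phi>' (inv_into U \<phi> (fst z)), \<psi>' (inv_into V \<psi> (snd z))) = (\<theta>' \<circ> inv_into W \<theta>) z"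
          if "z \<in> \<theta> ` (W \<inter> W')" for z
        proof -
          have "inv_into W \<theta> (fst z, snd z) = (inv_into U \<phi> (fst z), inv_into V \<psi> (snd z))"
            unfolding W using that im
            by (intro inv_into_map_prod chart_inj_on[OF M c(1)] chart_inj_on[OF N c(2)]) auto
          then show ?thesis by (simp add: W)
        qed
        then show "\<forall>\<^sub>F z in nhds z. (\<phi>' (inv_into U \<phi> (fst z)), \<psi>' (inv_into V \<psi> (snd z))) = (\<theta>' \<circ> inv_into W \<theta>) z"
          using op \<open>z \<in> \<theta> ` (W \<inter> W')\<close> unfolding eventually_nhds by blast
      qed
    qed
  qed
qed

lemma eventually_inv_into_map_prod:
  fixes M :: "('a, 'e::real_inner) manifold" and N :: "('b, 'f::real_inner) manifold"
  assumes M: "smooth_manifold M" and N: "smooth_manifold N"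
    and c: "(U, \<phi>) \<in> atlas M" "(V, \<psi>) \<in> atlas N" "x \<in> U" "y \<in> V"
  shows "\<forall>\<^sub>F a in nhds (\<phi> x, \<psi> y). inv_into (U \<times> V) (map_prod \<phi> \<psi>) a = (inv_into U \<phi> (fst a), inv_into V \<psi> (snd a))"
  unfolding eventually_nhds
proof (intro exI conjI ballI)
  show "open (\<phi> ` U \<times> \<psi> ` V)"
    using chart_image_open[OF M c(1) chart_openin[OF M c(1)]]
        chart_image_open[OF N c(2) chart_openin[OF N c(2)]] by (simp add: open_Times)
  show "(\<phi> x, \<psi> y) \<in> \<phi> ` U \<times> \<psi> ` V" using c by auto
  fix a assume "a \<in> \<phi> ` U \<times> \<psi> ` V"
  then have "inv_into (U \<times> V) (map_prod \<phi> \<psi>) (fst a, snd a) = (inv_into U \<phi> (fst a), inv_into V \<psi> (snd a))"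
    by (intro inv_into_map_prod chart_inj_on[OF M c(1)] chart_inj_on[OF N c(2)]) auto
  then show "inv_into (U \<times> V) (map_prod \<phi> \<psi>) a = (inv_into U \<phi> (fst a), inv_into V \<psi> (snd a))" by simp
qed

lemma smap_Pair:
  assumes f: "smap M N f" and g: "smap M K g"
  shows "smap M (prod_mfd N K) (\<lambda>x. (f x, g x))"
proof (rule smapI)
  show "smooth_manifold M" "smooth_manifold (prod_mfd N K)"
    using assms by (auto simp: smap_def smooth_manifold_prod)
  show "continuous_map (mtop M) (mtop (prod_mfd N K)) (\<lambda>x. (f x, g x))"
    unfolding mtop_prod_mfd
    using smap_continuous_map[OF f] smap_continuous_map[OF g] by (rule continuous_map_pairedI)
  fix x assume x: "x \<in> points M"
  obtain U \<phi> where c: "(U, \<phi>) \<in> atlas M" "x \<in> U" using chart_at[OF smap_source[OF f] x] .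
  obtain V \<psi> where d: "(V, \<psi>) \<in> atlas N" "f x \<in> V" using chart_at[OF smap_target[OF f] smap_points[OF f x]] .
  obtain W \<theta> where e: "(W, \<theta>) \<in> atlas K" "g x \<in> W" using chart_at[OF smap_target[OF g] smap_points[OF g x]] .
  have "cinf_at (\<lambda>a. map_prod \<psi> \<theta> (f (inv_into U \<phi> a), g (inv_into U \<phi> a))) (\<phi> x)"
    using c d e by (auto intro!: cinf_at_Pair smap_in_charts[OF f] smap_in_charts[OF g])
  then show "\<exists>U \<phi> V \<psi>. (U, \<phi>) \<in> atlas M \<and> (V, \<psi>) \<in> atlas (prod_mfd N K) \<and> x \<in> U \<and> (f x, g x) \<in> V \<and>
      cinf_at (\<lambda>a. \<psi> (f (inv_into U \<phi> a), g (inv_into U \<phi> a))) (\<phi> x)"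
    using c d e prod_mfd_chartI[OF d(1) e(1)] by blast
qed

lemma smap_fst:
  fixes M :: "('a, 'e::real_inner) manifold" and N :: "('b, 'f::real_inner) manifold"
  assumes M: "smooth_manifold M" and N: "smooth_manifold N"
  shows "smap (prod_mfd M N) M fst"
proof (rule smapI)
  show "continuous_map (mtop (prod_mfd M N)) (mtop M) fst"
    by (simp add: mtop_prod_mfd continuous_map_fst)
  fix z assume "z \<in> points (prod_mfd M N)"
  then obtain x y where z: "z = (x, y)" "x \<in> points M" "y \<in> points N" by auto
  obtain U \<phi> where c: "(U, \<phi>) \<in> atlas M" "x \<in> U" using chart_at[OF M z(2)] .
  obtain V \<psi> where d: "(V, \<psi>) \<in> atlas N" "y \<in> V" using chart_at[OF N z(3)] .
  have "cinf_at (\<lambda>a. \<phi> (fst (inv_into (U \<times> V) (map_prod \<phi> \<psi>) a))) (map_prod \<phi> \<psi> (x, y))"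
  proof (rule cinf_at_cong)
    show "cinf_at (\<lambda>a. \<phi> (inv_into U \<phi> (fst a))) (map_prod \<phi> \<psi> (x, y))"
      by (rule cinf_at_compose[of fst, OF smooth_manifold_finite_dim[OF M]
            cinf_at_bounded_linear[OF bounded_linear_fst]])
        (use chart_transition[OF M c(1) c(1) c(2) c(2)] in auto)
    show "\<forall>\<^sub>F a in nhds (map_prod \<phi> \<psi> (x, y)). \<phi> (inv_into U \<phi> (fst a)) =
        \<phi> (fst (inv_into (U \<times> V) (map_prod \<phi> \<psi>) a))"
      using eventually_inv_into_map_prod[OF M N c(1) d(1) c(2) d(2)] by (auto elim: eventually_mono)
  qed
  then show "\<exists>U \<phi> V \<psi>. (U, \<phi>) \<in> atlas (prod_mfd M N) \<and> (V, \<psi>) \<in> atlas M \<and> z \<in> U \<and> fst z \<in> V \<and>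
      cinf_at (\<lambda>a. \<psi> (fst (inv_into U \<phi> a))) (\<phi> z)"
    using c d z prod_mfd_chartI[OF c(1) d(1)] by (intro exI[of _ "U \<times> V"] exI conjI) auto
qed (simp_all add: M N smooth_manifold_prod)

lemma smap_snd:
  fixes M :: "('a, 'e::real_inner) manifold" and N :: "('b, 'f::real_inner) manifold"
  assumes M: "smooth_manifold M" and N: "smooth_manifold N"
  shows "smap (prod_mfd M N) N snd"
proof (rule smapI)
  show "continuous_map (mtop (prod_mfd M N)) (mtop N) snd"
    by (simp add: mtop_prod_mfd continuous_map_snd)
  fix z assume "z \<in> points (prod_mfd M N)"
  then obtain x y where z: "z = (x, y)" "x \<in> points M" "y \<in> points N" by auto
  obtain U \<phi> where c: "(U, \<phi>) \<in> atlas M" "x \<in> U" using chart_at[OF M z(2)] .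
  obtain V \<psi> where d: "(V, \<psi>) \<in> atlas N" "y \<in> V" using chart_at[OF N z(3)] .
  have "cinf_at (\<lambda>a. \<psi> (snd (inv_into (U \<times> V) (map_prod \<phi> \<psi>) a))) (map_prod \<phi> \<psi> (x, y))"
  proof (rule cinf_at_cong)
    show "cinf_at (\<lambda>a. \<psi> (inv_into V \<psi> (snd a))) (map_prod \<phi> \<psi> (x, y))"
      by (rule cinf_at_compose[of snd, OF smooth_manifold_finite_dim[OF N]
            cinf_at_bounded_linear[OF bounded_linear_snd]])
        (use chart_transition[OF N d(1) d(1) d(2) d(2)] in auto)
    show "\<forall>\<^sub>F a in nhds (map_prod \<phi> \<psi> (x, y)). \<psi> (inv_into V \<psi> (snd a)) =
        \<psi> (snd (inv_into (U \<times> V) (map_prod \<phi> \<psi>) a))"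
      using eventually_inv_into_map_prod[OF M N c(1) d(1) c(2) d(2)] by (auto elim: eventually_mono)
  qed
  then show "\<exists>U \<phi> V \<psi>. (U, \<phi>) \<in> atlas (prod_mfd M N) \<and> (V, \<psi>) \<in> atlas N \<and> z \<in> U \<and> snd z \<in> V \<and>
      cinf_at (\<lambda>a. \<psi> (snd (inv_into U \<phi> a))) (\<phi> z)"
    using c d z prod_mfd_chartI[OF c(1) d(1)] by (intro exI[of _ "U \<times> V"] exI conjI) auto
qed (simp_all add: M N smooth_manifold_prod)

section \<open>Vector spaces as manifolds\<close>

lemma points_vec_mfd [simp]: "points vec_mfd = UNIV"
  and mtop_vec_mfd: "mtop vec_mfd = euclidean"
  and atlas_vec_mfd [simp]: "atlas vec_mfd = {(UNIV, \<lambda>x. x)}"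
  by (simp_all add: vec_mfd_def)

lemma inv_into_UNIV_ident [simp]: "inv_into UNIV (\<lambda>x. x) = (\<lambda>x. x)"
  by (rule ext) (metis UNIV_I inj_on_id2 inv_into_f_f)

lemma smooth_manifold_vec:
  assumes "finite_dim TYPE('e::real_inner)"
  shows "smooth_manifold (vec_mfd :: ('e::real_inner, 'e) manifold)"
  unfolding smooth_manifold_def
  using assms finite_dim_second_countable[OF assms] homeomorphic_map_id[of euclidean euclidean, unfolded id_def]
  by (simp add: mtop_vec_mfd o_def Cinf_on_iff_cinf_at cinf_at_ident)

lemma prod_mfd_vec_vec: "prod_mfd vec_mfd vec_mfd = vec_mfd"
  by (simp add: prod_mfd_def vec_mfd_def map_prod_def id_def)

lemma finite_dim_real: "finite_dim TYPE(real)"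
  unfolding finite_dim_def by (intro exI[of _ "{1}"]) (auto simp: span_singleton)

lemma smap_vecD:
  fixes M :: "('a, 'e::real_inner) manifold" and f :: "'a \<Rightarrow> 'f::real_inner"
  assumes "smap M vec_mfd f" "(U, \<phi>) \<in> atlas M" "x \<in> U"
  shows "cinf_at (\<lambda>a. f (inv_into U \<phi> a)) (\<phi> x)"
  using smap_in_charts[OF assms(1,2) _ assms(3), of UNIV "\<lambda>x. x"] by simp

text \<open>
  The target is covered by a single chart, so that smoothness of the coordinate expressions implies
  continuity.
\<close>

lemma smap_vecI:
  fixes M :: "('a, 'e::real_inner) manifold" and f :: "'a \<Rightarrow> 'f::real_inner"
  assumes M: "smooth_manifold M" and fin: "finite_dim TYPE('f)"
    and loc: "\<And>x. x \<in> points M \<Longrightarrow> \<exists>U \<phi>. (U, \<phi>) \<in> atlas M \<and> x \<in> U \<and> cinf_at (\<lambda>a. f (inv_into U \<phi> a)) (\<phi> x)"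
  shows "smap M vec_mfd f"
proof (rule smapI[OF M smooth_manifold_vec[OF fin]])
  show "continuous_map (mtop M) (mtop vec_mfd) f"
    unfolding continuous_map_def mtop_vec_mfd
  proof (intro conjI allI impI)
    fix T :: "'f set" assume T: "openin euclidean T"
    show "openin (mtop M) {x \<in> points M. f x \<in> T}"
    proof (subst openin_subopen, intro ballI)
      fix x assume "x \<in> {x \<in> points M. f x \<in> T}"
      then have x: "x \<in> points M" "f x \<in> T" by auto
      obtain U \<phi> where c: "(U, \<phi>) \<in> atlas M" "x \<in> U" "cinf_at (\<lambda>a. f (inv_into U \<phi> a)) (\<phi> x)"
        using loc[OF x(1)] by blast
      have "((\<lambda>a. f (inv_into U \<phi> a)) \<longlongrightarrow> f x) (nhds (\<phi> x))"
        using cinf_at_isCont[OF c(3)] chart_inverse[OF M c(1,2)]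
          tendsto_at_iff_tendsto_nhds[of "\<lambda>a. f (inv_into U \<phi> a)" "\<phi> x"]
        by (simp add: continuous_within)
      then have "\<forall>\<^sub>F a in nhds (\<phi> x). f (inv_into U \<phi> a) \<in> T"
        using T x by (auto dest: topological_tendstoD)
      then obtain S where S: "open S" "\<phi> x \<in> S" "\<And>a. a \<in> S \<Longrightarrow> f (inv_into U \<phi> a) \<in> T"
        unfolding eventually_nhds by blast
      have "U \<inter> \<phi> -` S \<subseteq> {x \<in> points M. f x \<in> T}"
        using S(3) chart_inverse[OF M c(1)] chart_subset[OF M c(1)] by force
      then show "\<exists>V. openin (mtop M) V \<and> x \<in> V \<and> V \<subseteq> {x \<in> points M. f x \<in> T}"
        using chart_preimage_openin[OF M c(1) S(1)] c(2) S(2) by blast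
    qed
  qed auto
  fix x assume "x \<in> points M"
  then show "\<exists>U \<phi> V \<psi>. (U, \<phi>) \<in> atlas M \<and> (V, \<psi>) \<in> atlas vec_mfd \<and> x \<in> U \<and> f x \<in> V \<and>
    cinf_at (\<lambda>a. \<psi> (f (inv_into U \<phi> a))) (\<phi> x)" using loc by auto
qed

lemma smap_vec_finite_dim: "smap M (vec_mfd :: ('f::real_inner, 'f) manifold) f \<Longrightarrow> finite_dim TYPE('f)"
  using smap_target smooth_manifold_finite_dim by blast

lemma smap_vec_vecI:
  fixes h :: "'e::real_inner \<Rightarrow> 'f::real_inner"
  assumes "finite_dim TYPE('e)" "finite_dim TYPE('f)" "\<And>x. cinf_at h x"
  shows "smap vec_mfd vec_mfd h"
  by (rule smap_vecI[OF smooth_manifold_vec]) (use assms in auto)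

lemma smap_bounded_linear:
  fixes M :: "('m, 'e::real_inner) manifold" and f :: "'m \<Rightarrow> 'f::real_inner" and h :: "'f \<Rightarrow> 'g::real_inner"
  assumes h: "bounded_linear h" and fin: "finite_dim TYPE('g)" and f: "smap M vec_mfd f"
  shows "smap M vec_mfd (\<lambda>x. h (f x))"
  by (rule smap_compose[OF smap_vec_vecI[OF smap_vec_finite_dim[OF f] fin cinf_at_bounded_linear[OF h]] f])

lemma smap_bilinear:
  fixes M :: "('m, 'e::real_inner) manifold"
    and prod :: "'a::real_inner \<Rightarrow> 'b::real_inner \<Rightarrow> 'c::real_inner"
  assumes prod: "bounded_bilinear prod" and fin: "finite_dim TYPE('c)"
    and f: "smap M vec_mfd f" and g: "smap M vec_mfd g"
  shows "smap M vec_mfd (\<lambda>x. prod (f x) (g x))"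
proof -
  have "finite_dim TYPE('a \<times> 'b)"
    by (rule finite_dim_prod[OF smap_vec_finite_dim[OF f] smap_vec_finite_dim[OF g]])
  then have "smap vec_mfd vec_mfd (\<lambda>z. prod (fst z) (snd z))"
    by (rule smap_vec_vecI[OF _ fin]) (rule bounded_bilinear.cinf_at_bilinear[OF prod
        cinf_at_bounded_linear[OF bounded_linear_fst] cinf_at_bounded_linear[OF bounded_linear_snd]])
  from smap_compose[OF this smap_Pair[OF f g, unfolded prod_mfd_vec_vec]] show ?thesis by simp
qed

lemma smap_add:
  fixes M :: "('m, 'e::real_inner) manifold" and f :: "'m \<Rightarrow> 'f::real_inner"
  assumes f: "smap M vec_mfd f" and g: "smap M vec_mfd g"
  shows "smap M vec_mfd (\<lambda>x. f x + g x)"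
proof -
  have "bounded_linear (\<lambda>z :: 'f \<times> 'f. fst z + snd z)"
    by (intro bounded_linear_add bounded_linear_fst bounded_linear_snd)
  from smap_bounded_linear[OF this smap_vec_finite_dim[OF f] smap_Pair[OF f g, unfolded prod_mfd_vec_vec]]
  show ?thesis by simp
qed

lemma smap_sum:
  fixes M :: "('m, 'e::real_inner) manifold" and f :: "'i \<Rightarrow> 'm \<Rightarrow> 'f::real_inner"
  assumes M: "smooth_manifold M" and fin: "finite_dim TYPE('f)"
    and "\<And>i. i \<in> I \<Longrightarrow> smap M vec_mfd (f i)"
  shows "smap M vec_mfd (\<lambda>x. \<Sum>i\<in>I. f i x)"
  using assms(3)
  by (induction I rule: infinite_finite_induct)
    (auto intro: smap_add smap_const[OF M smooth_manifold_vec[OF fin]])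

lemma smap_uminus:
  fixes M :: "('m, 'e::real_inner) manifold" and f :: "'m \<Rightarrow> 'f::real_inner"
  assumes f: "smap M vec_mfd f" shows "smap M vec_mfd (\<lambda>x. - f x)"
  by (rule smap_bounded_linear[OF _ smap_vec_finite_dim[OF f] f])
    (intro bounded_linear_minus bounded_linear_ident)

lemma smap_fst_of:
  fixes L :: "('l, 'k::real_inner) manifold"
    and M :: "('a, 'e::real_inner) manifold" and N :: "('b, 'f::real_inner) manifold"
  assumes "smap L (prod_mfd M N) f" "smooth_manifold M" "smooth_manifold N"
  shows "smap L M (\<lambda>x. fst (f x))"
  by (rule smap_compose[OF smap_fst assms(1)]) fact+

lemma smap_snd_of:
  fixes L :: "('l, 'k::real_inner) manifold"
    and M :: "('a, 'e::real_inner) manifold" and N :: "('b, 'f::real_inner) manifold"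
  assumes "smap L (prod_mfd M N) f" "smooth_manifold M" "smooth_manifold N"
  shows "smap L N (\<lambda>x. snd (f x))"
  by (rule smap_compose[OF smap_snd assms(1)]) fact+

section \<open>Tangent maps in charts\<close>

lemma chart_derivative_compose:
  assumes f: "smap M N f" and g: "smap N K g"
    and c: "(U, \<phi>) \<in> atlas M" "x \<in> U" and d: "(V, \<psi>) \<in> atlas N" "f x \<in> V"
    and e: "(W, \<theta>) \<in> atlas K" "g (f x) \<in> W"
  shows "((\<lambda>a. \<theta> (g (f (inv_into U \<phi> a)))) has_derivative
    frechet_derivative (\<theta> \<circ> g \<circ> inv_into V \<psi>) (at (\<psi> (f x))) \<circ>
      frechet_derivative (\<psi> \<circ> f \<circ> inv_into U \<phi>) (at (\<phi> x))) (at (\<phi> x))"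
proof -
  note inv = chart_inverse[OF smap_source[OF f] c]
  have 1: "((\<psi> \<circ> f \<circ> inv_into U \<phi>) has_derivative
      frechet_derivative (\<psi> \<circ> f \<circ> inv_into U \<phi>) (at (\<phi> x))) (at (\<phi> x))"
    using smap_in_charts[OF f c(1) d(1) c(2) d(2)] by (intro cinf_at_has_derivative) (simp add: o_def)
  have 2: "((\<theta> \<circ> g \<circ> inv_into V \<psi>) has_derivative
      frechet_derivative (\<theta> \<circ> g \<circ> inv_into V \<psi>) (at (\<psi> (f x)))) (at ((\<psi> \<circ> f \<circ> inv_into U \<phi>) (\<phi> x)))"
    using smap_in_charts[OF g d(1) e(1) d(2) e(2)] inv
    by (simp add: cinf_at_has_derivative o_def)
  have 3: "((\<theta> \<circ> g \<circ> inv_into V \<psi>) \<circ> (\<psi> \<circ> f \<circ> inv_into U \<phi>) has_derivative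
    frechet_derivative (\<theta> \<circ> g \<circ> inv_into V \<psi>) (at (\<psi> (f x))) \<circ>
      frechet_derivative (\<psi> \<circ> f \<circ> inv_into U \<phi>) (at (\<phi> x))) (at (\<phi> x))"
    by (rule diff_chain_at[OF 1 2])
  have "x \<in> {x \<in> points M. f x \<in> V}"
    using chart_subset[OF smap_source[OF f] c(1)] c d by auto
  from eventually_chart_inverse[OF smap_source[OF f] c
        smap_preimage_openin[OF f chart_openin[OF smap_target[OF f] d(1)]] this]
  have "\<forall>\<^sub>F a in nhds (\<phi> x). inv_into U \<phi> a \<in> {x \<in> points M. f x \<in> V}"
    by (rule eventually_mono) blast
  then have "\<forall>\<^sub>F a in nhds (\<phi> x). ((\<theta> \<circ> g \<circ> inv_into V \<psi>) \<circ> (\<psi> \<circ> f \<circ> inv_into U \<phi>)) a =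
      \<theta> (g (f (inv_into U \<phi> a)))"
    by eventually_elim (simp add: chart_inverse[OF smap_target[OF f] d(1)])
  then obtain S where S: "open S" "\<phi> x \<in> S" "\<And>a. a \<in> S \<Longrightarrow> ((\<theta> \<circ> g \<circ> inv_into V \<psi>) \<circ> (\<psi> \<circ> f \<circ> inv_into U \<phi>)) a =
      \<theta> (g (f (inv_into U \<phi> a)))" unfolding eventually_nhds by blast
  show ?thesis by (rule has_derivative_transform_within_open[OF 3 S])
qed

lemma chart_derivative_left_inverse:
  assumes f: "smap M N f" and g: "smap N M g" and gf: "\<And>x. x \<in> points M \<Longrightarrow> g (f x) = x"
    and c: "(U, \<phi>) \<in> atlas M" "x \<in> U" and d: "(V, \<psi>) \<in> atlas N" "f x \<in> V"
  shows "frechet_derivative (\<phi> \<circ> g \<circ> inv_into V \<psi>) (at (\<psi> (f x)))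
      (frechet_derivative (\<psi> \<circ> f \<circ> inv_into U \<phi>) (at (\<phi> x)) v) = v"
proof -
  have x: "x \<in> points M" using chart_subset[OF smap_source[OF f] c(1)] c by auto
  have 1: "((\<lambda>a. \<phi> (g (f (inv_into U \<phi> a)))) has_derivative
    frechet_derivative (\<phi> \<circ> g \<circ> inv_into V \<psi>) (at (\<psi> (f x))) \<circ>
      frechet_derivative (\<psi> \<circ> f \<circ> inv_into U \<phi>) (at (\<phi> x))) (at (\<phi> x))"
    by (rule chart_derivative_compose[OF f g c d c(1)]) (simp add: gf x c)
  have "\<forall>\<^sub>F a in nhds (\<phi> x). \<phi> (g (f (inv_into U \<phi> a))) = a"
    using eventually_chart_inverse[OF smap_source[OF f] c openin_topspace x]
    by eventually_elim (simp add: gf)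
  then obtain S where S: "open S" "\<phi> x \<in> S" "\<And>a. a \<in> S \<Longrightarrow> \<phi> (g (f (inv_into U \<phi> a))) = a"
    unfolding eventually_nhds by blast
  have "((\<lambda>a. a) has_derivative
    frechet_derivative (\<phi> \<circ> g \<circ> inv_into V \<psi>) (at (\<psi> (f x))) \<circ>
      frechet_derivative (\<psi> \<circ> f \<circ> inv_into U \<phi>) (at (\<phi> x))) (at (\<phi> x))"
    by (rule has_derivative_transform_within_open[OF 1 S])
  from fun_cong[OF has_derivative_unique[OF this has_derivative_ident], of v] show ?thesis by simp
qed

text \<open>
  By the chain rule a smooth left inverse provides a left inverse of each derivative; dually, smooth
  sections through every point provide right inverses, which gives the next criterion.
\<close>

lemma immersionI_left_inverse:
  assumes f: "smap M N f" and g: "smap N M g" and gf: "\<And>x. x \<in> points M \<Longrightarrow> g (f x) = x"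
  shows "immersion M N f"
  unfolding immersion_def
proof (intro conjI smap_smooth_map[OF f], safe)
  fix U \<phi> V \<psi> x assume "(U, \<phi>) \<in> atlas M" "(V, \<psi>) \<in> atlas N" "x \<in> U" "f x \<in> V"
  then show "inj (frechet_derivative (\<psi> \<circ> f \<circ> inv_into U \<phi>) (at (\<phi> x)))"
    by (intro inj_on_inverseI[where g = "frechet_derivative (\<phi> \<circ> g \<circ> inv_into V \<psi>) (at (\<psi> (f x)))"]
        chart_derivative_left_inverse[OF f g gf])
qed

lemma submersionI_sections:
  assumes f: "smap M N f"
    and sec: "\<And>x. x \<in> points M \<Longrightarrow> \<exists>s. smap N M s \<and> s (f x) = x \<and> (\<forall>y\<in>points N. f (s y) = y)"
  shows "submersion M N f"
proof -
  have "surj (frechet_derivative (\<psi> \<circ> f \<circ> inv_into U \<phi>) (at (\<phi> x)))"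
    if c: "(U, \<phi>) \<in> atlas M" "(V, \<psi>) \<in> atlas N" "x \<in> U" "f x \<in> V" for U \<phi> V \<psi> x
  proof -
    have "x \<in> points M" using chart_subset[OF smap_source[OF f] c(1)] c by auto
    then obtain s where s: "smap N M s" "s (f x) = x" "\<And>y. y \<in> points N \<Longrightarrow> f (s y) = y" using sec by blast
    have "frechet_derivative (\<psi> \<circ> f \<circ> inv_into U \<phi>) (at (\<phi> x))
        (frechet_derivative (\<phi> \<circ> s \<circ> inv_into V \<psi>) (at (\<psi> (f x))) v) = v" for v
      using chart_derivative_left_inverse[OF s(1) f s(3) c(2,4,1)] c(3) s(2) by simp
    then show ?thesis by (rule surjI)
  qed
  then show ?thesis unfolding submersion_def using smap_smooth_map[OF f] by blast
qed

lemma smooth_map_on_if_smap: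
  assumes f: "smap M N f" and S: "S \<subseteq> points M"
  shows "smooth_map_on M S N f"
proof -
  have "(\<lambda>(U, \<phi>). (U \<inter> points M, \<phi>)) c = c" if "c \<in> atlas M" for c
    using chart_subset[OF smap_source[OF f]] that by (cases c) auto
  then have "(\<lambda>(U, \<phi>). (U \<inter> points M, \<phi>)) ` atlas M = atlas M"
    by (simp cong: image_cong)
  then have "open_part M (points M) = M" by (simp add: open_part_def subtopology_topspace)
  then show ?thesis unfolding smooth_map_on_def
    using f S by (intro conjI ballI exI[of _ "points M"] exI[of _ f]) (auto simp: smap_def)
qed

lemma diffeomorphismI:
  assumes "smap M N f" "smap N M g" "\<And>x. x \<in> points M \<Longrightarrow> g (f x) = x" "\<And>y. y \<in> points N \<Longrightarrow> f (g y) = y"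
  shows "diffeomorphism M N f"
  using assms unfolding diffeomorphism_def smap_def by blast

section \<open>Transport of a manifold structure along a homeomorphism\<close>

definition pullback_mfd :: "'b topology \<Rightarrow> ('b \<Rightarrow> 'a) \<Rightarrow> ('a, 'e) manifold \<Rightarrow> ('b, 'e) manifold" where
  "pullback_mfd X F M = \<lparr>mtop = X, atlas = (\<lambda>(U, \<phi>). (topspace X \<inter> F -` U, \<phi> \<circ> F)) ` atlas M\<rparr>"

context
  fixes M :: "('a, 'e::real_inner) manifold" and X :: "'b topology" and F E
  assumes M: "smooth_manifold M" and hom: "homeomorphic_maps X (mtop M) F E"
begin

lemma pullback_inverses:
  shows "x \<in> topspace X \<Longrightarrow> F x \<in> points M" "y \<in> points M \<Longrightarrow> E y \<in> topspace X"
    "x \<in> topspace X \<Longrightarrow> E (F x) = x" "y \<in> points M \<Longrightarrow> F (E y) = y"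
  using hom by (auto simp: homeomorphic_maps_def dest: continuous_map_funspace)

lemma pullback_chart_image:
  assumes "A \<subseteq> points M" shows "F ` (topspace X \<inter> F -` A) = A"
proof
  show "A \<subseteq> F ` (topspace X \<inter> F -` A)"
  proof
    fix y assume "y \<in> A"
    then have "y = F (E y)" "E y \<in> topspace X \<inter> F -` A" using assms pullback_inverses by auto
    then show "y \<in> F ` (topspace X \<inter> F -` A)" by (rule image_eqI)
  qed
qed auto

lemma pullback_chart_inverse:
  assumes c: "(U, \<phi>) \<in> atlas M" and a: "a \<in> \<phi> ` U"
  shows "inv_into (topspace X \<inter> F -` U) (\<phi> \<circ> F) a = E (inv_into U \<phi> a)"
proof (rule inv_into_f_eq)
  have U: "U \<subseteq> points M" using chart_subset[OF M c] .
  show "inj_on (\<phi> \<circ> F) (topspace X \<inter> F -` U)"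
    using chart_inj_on[OF M c] pullback_inverses by (auto simp: inj_on_def) metis
  obtain y where y: "y \<in> U" "a = \<phi> y" using a by blast
  then show "E (inv_into U \<phi> a) \<in> topspace X \<inter> F -` U" "(\<phi> \<circ> F) (E (inv_into U \<phi> a)) = a"
    using U pullback_inverses by (auto simp: chart_inverse[OF M c] subset_iff)
qed

lemma smooth_manifold_pullback: "smooth_manifold (pullback_mfd X F M)"
  unfolding smooth_manifold_def
proof (intro conjI)
  have hs: "X homeomorphic_space mtop M" using hom unfolding homeomorphic_space_def by blast
  show "finite_dim TYPE('e)" by (rule smooth_manifold_finite_dim[OF M])
  show "Hausdorff_space (mtop (pullback_mfd X F M))"
    using M homeomorphic_Hausdorff_space[OF hs] by (simp add: pullback_mfd_def smooth_manifold_def)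
  show "second_countable (mtop (pullback_mfd X F M))"
    using M homeomorphic_space_second_countability[OF hs] by (simp add: pullback_mfd_def smooth_manifold_def)
  have at: "\<exists>U \<phi>. (U, \<phi>) \<in> atlas M \<and> V = topspace X \<inter> F -` U \<and> \<psi> = \<phi> \<circ> F"
    if "(V, \<psi>) \<in> atlas (pullback_mfd X F M)" for V \<psi>
    using that by (auto simp: pullback_mfd_def)
  show "(\<Union>(U, \<phi>)\<in>atlas (pullback_mfd X F M). U) = points (pullback_mfd X F M)"
  proof -
    have "x \<in> (\<Union>(U, \<phi>)\<in>atlas (pullback_mfd X F M). U)" if x: "x \<in> topspace X" for x
    proof -
      obtain U \<phi> where "(U, \<phi>) \<in> atlas M" "F x \<in> U"
        using chart_at[OF M pullback_inverses(1)[OF x]] .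
      then show ?thesis using x unfolding pullback_mfd_def by fastforce
    qed
    then show ?thesis by (auto dest!: at) (auto simp: pullback_mfd_def)
  qed
  have im: "(\<phi> \<circ> F) ` (topspace X \<inter> F -` U \<inter> (topspace X \<inter> F -` V)) = \<phi> ` (U \<inter> V)"
    if "(U, \<phi>) \<in> atlas M" for U \<phi> V
  proof -
    have "(topspace X \<inter> F -` U \<inter> (topspace X \<inter> F -` V)) = topspace X \<inter> F -` (U \<inter> V)" by auto
    then show ?thesis using pullback_chart_image[of "U \<inter> V"] chart_subset[OF M that]
      by (metis image_comp le_infI1)
  qed
  show "\<forall>(U, \<phi>)\<in>atlas (pullback_mfd X F M). openin (mtop (pullback_mfd X F M)) U \<and> open (\<phi> ` U) \<and>
      homeomorphic_map (subtopology (mtop (pullback_mfd X F M)) U) (top_of_set (\<phi> ` U)) \<phi>"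
  proof safe
    fix V \<psi> assume "(V, \<psi>) \<in> atlas (pullback_mfd X F M)"
    then obtain U \<phi> where c: "(U, \<phi>) \<in> atlas M" and V: "V = topspace X \<inter> F -` U" "\<psi> = \<phi> \<circ> F"
      using at by blast
    have X: "mtop (pullback_mfd X F M) = X" by (simp add: pullback_mfd_def)
    have "continuous_map X (mtop M) F" using hom by (simp add: homeomorphic_maps_def)
    then show "openin (mtop (pullback_mfd X F M)) V"
      using openin_continuous_map_preimage[OF _ chart_openin[OF M c]]
      unfolding X V by (simp add: vimage_def Int_def)
    have im': "\<psi> ` V = \<phi> ` U" using im[OF c, of U] V by simp
    show "open (\<psi> ` V)" unfolding im' using chart_image_open[OF M c chart_openin[OF M c]] by simp
    have "homeomorphic_map (subtopology X V) (subtopology (mtop M) U) F"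
    proof (rule homeomorphic_map_subtopologies)
      show "homeomorphic_map X (mtop M) F" using hom homeomorphic_map_maps by blast
      show "F ` (topspace X \<inter> V) = points M \<inter> U"
        using pullback_chart_image[OF chart_subset[OF M c]] chart_subset[OF M c] unfolding V
        by (simp add: Int_absorb1)
    qed
    then show "homeomorphic_map (subtopology (mtop (pullback_mfd X F M)) V) (top_of_set (\<psi> ` V)) \<psi>"
      unfolding X im' unfolding V(2) by (rule homeomorphic_map_compose) (rule chart_homeomorphic_map[OF M c])
  qed
  show "\<forall>(U, \<phi>)\<in>atlas (pullback_mfd X F M). \<forall>(V, \<psi>)\<in>atlas (pullback_mfd X F M).
      Cinf_on (\<phi> ` (U \<inter> V)) (\<psi> \<circ> inv_into U \<phi>)"
  proof safe
    fix A \<alpha> B \<beta> assume "(A, \<alpha>) \<in> atlas (pullback_mfd X F M)" "(B, \<beta>) \<in> atlas (pullback_mfd X F M)"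
    then obtain U \<phi> V \<psi> where c: "(U, \<phi>) \<in> atlas M" "(V, \<psi>) \<in> atlas M"
      and AB: "A = topspace X \<inter> F -` U" "\<alpha> = \<phi> \<circ> F" "B = topspace X \<inter> F -` V" "\<beta> = \<psi> \<circ> F"
      using at by metis
    have op: "open (\<phi> ` (U \<inter> V))" using chart_image_open[OF M c(1) chart_openin[OF M c(2)]] .
    show "Cinf_on (\<alpha> ` (A \<inter> B)) (\<beta> \<circ> inv_into A \<alpha>)"
      unfolding AB im[OF c(1)] Cinf_on_def
    proof
      fix k
      show "Ck_on k (\<phi> ` (U \<inter> V)) (\<psi> \<circ> F \<circ> inv_into (topspace X \<inter> F -` U) (\<phi> \<circ> F))"
      proof (rule Ck_on_cong[OF op])
        show "Ck_on k (\<phi> ` (U \<inter> V)) (\<psi> \<circ> inv_into U \<phi>)"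
          using M c unfolding smooth_manifold_def Cinf_on_def by fast
        fix a assume "a \<in> \<phi> ` (U \<inter> V)"
        then have "a \<in> \<phi> ` U" "inv_into U \<phi> a \<in> points M"
          using chart_subset[OF M c(1)] by (auto simp: chart_inverse[OF M c(1)])
        then show "(\<psi> \<circ> inv_into U \<phi>) a = (\<psi> \<circ> F \<circ> inv_into (topspace X \<inter> F -` U) (\<phi> \<circ> F)) a"
          using pullback_chart_inverse[OF c(1)] pullback_inverses by simp
      qed
    qed
  qed
qed

lemma pullback_charts_identity:
  assumes c: "(U, \<phi>) \<in> atlas M" "y \<in> U"
  shows "\<forall>\<^sub>F a in nhds (\<phi> y). \<phi> (F (inv_into (topspace X \<inter> F -` U) (\<phi> \<circ> F) a)) = a \<and>
    (\<phi> \<circ> F) (E (inv_into U \<phi> a)) = a"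
  unfolding eventually_nhds
proof (intro exI conjI ballI)
  show "open (\<phi> ` (U \<inter> points M))" using chart_image_open[OF M c(1) openin_topspace] .
  show "\<phi> y \<in> \<phi> ` (U \<inter> points M)" using c chart_subset[OF M c(1)] by auto
  fix a assume "a \<in> \<phi> ` (U \<inter> points M)"
  then show "\<phi> (F (inv_into (topspace X \<inter> F -` U) (\<phi> \<circ> F) a)) = a" "(\<phi> \<circ> F) (E (inv_into U \<phi> a)) = a"
    using pullback_inverses
    by (auto simp: pullback_chart_inverse[OF c(1)] chart_inverse[OF M c(1)])
qed

lemma pullback_chartI: "(U, \<phi>) \<in> atlas M \<Longrightarrow> (topspace X \<inter> F -` U, \<phi> \<circ> F) \<in> atlas (pullback_mfd X F M)"
  by (force simp: pullback_mfd_def)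

lemma mtop_pullback_mfd: "mtop (pullback_mfd X F M) = X"
  by (simp add: pullback_mfd_def)

lemma smap_pullback: "smap (pullback_mfd X F M) M F"
proof (rule smapI[OF smooth_manifold_pullback M])
  show "continuous_map (mtop (pullback_mfd X F M)) (mtop M) F"
    using hom by (simp add: homeomorphic_maps_def mtop_pullback_mfd)
  fix x assume "x \<in> points (pullback_mfd X F M)"
  then have x: "x \<in> topspace X" by (simp add: mtop_pullback_mfd)
  obtain U \<phi> where c: "(U, \<phi>) \<in> atlas M" "F x \<in> U" using chart_at[OF M pullback_inverses(1)[OF x]] .
  have "cinf_at (\<lambda>a. \<phi> (F (inv_into (topspace X \<inter> F -` U) (\<phi> \<circ> F) a))) ((\<phi> \<circ> F) x)"
    by (rule cinf_at_cong[OF cinf_at_ident])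
      (use pullback_charts_identity[OF c] in \<open>auto elim: eventually_mono\<close>)
  then show "\<exists>U \<phi> V \<psi>. (U, \<phi>) \<in> atlas (pullback_mfd X F M) \<and> (V, \<psi>) \<in> atlas M \<and> x \<in> U \<and> F x \<in> V \<and>
      cinf_at (\<lambda>a. \<psi> (F (inv_into U \<phi> a))) (\<phi> x)"
    using c x pullback_chartI[OF c(1)] by blast
qed

lemma smap_pullback_inverse: "smap M (pullback_mfd X F M) E"
proof (rule smapI[OF M smooth_manifold_pullback])
  show "continuous_map (mtop M) (mtop (pullback_mfd X F M)) E"
    using hom by (simp add: homeomorphic_maps_def mtop_pullback_mfd)
  fix y assume y: "y \<in> points M"
  obtain U \<phi> where c: "(U, \<phi>) \<in> atlas M" "y \<in> U" using chart_at[OF M y] .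
  have "cinf_at (\<lambda>a. (\<phi> \<circ> F) (E (inv_into U \<phi> a))) (\<phi> y)"
    by (rule cinf_at_cong[OF cinf_at_ident])
      (use pullback_charts_identity[OF c] in \<open>auto elim: eventually_mono\<close>)
  then show "\<exists>U \<phi> V \<psi>. (U, \<phi>) \<in> atlas M \<and> (V, \<psi>) \<in> atlas (pullback_mfd X F M) \<and> y \<in> U \<and> E y \<in> V \<and>
      cinf_at (\<lambda>a. \<psi> (E (inv_into U \<phi> a))) (\<phi> y)"
    using c pullback_chartI[OF c(1)] pullback_inverses(2,4)[OF y]
    by (intro exI[of _ U] exI[of _ \<phi>] exI[of _ "topspace X \<inter> F -` U"] exI[of _ "\<phi> \<circ> F"] conjI) auto
qed

end

section \<open>Velocities of curves\<close>

lemma smooth_manifold_real: "smooth_manifold (vec_mfd :: (real, real) manifold)"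
  by (rule smooth_manifold_vec[OF finite_dim_real])

lemma smap_vec_vec_cinf_at:
  fixes h :: "'e::real_inner \<Rightarrow> 'f::real_inner"
  assumes "smap vec_mfd vec_mfd h" shows "cinf_at h x"
  using smap_vecD[OF assms, of UNIV "\<lambda>x. x"] by simp

lemma smap_real_has_vector_derivative:
  fixes h :: "real \<Rightarrow> 'f::real_inner"
  assumes "smap vec_mfd vec_mfd h"
  shows "(h has_vector_derivative vector_derivative h (at t)) (at t)"
  using cinf_at_differentiable[OF smap_vec_vec_cinf_at[OF assms]]
  by (simp add: vector_derivative_works)

lemma smap_real_has_real_derivative:
  fixes h :: "real \<Rightarrow> real"
  assumes "smap vec_mfd vec_mfd h"
  shows "(h has_real_derivative deriv h t) (at t)"
  using cinf_at_differentiable[OF smap_vec_vec_cinf_at[OF assms]]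
  by (metis DERIV_deriv_iff_real_differentiable)

lemma deriv_eq_vector_derivative:
  fixes h :: "real \<Rightarrow> real"
  assumes "smap vec_mfd vec_mfd h"
  shows "deriv h t = vector_derivative h (at t)"
  using smap_real_has_real_derivative[OF assms, of t]
  by (metis has_real_derivative_iff_has_vector_derivative vector_derivative_at)

lemma curve_push_forward:
  assumes c: "smap (vec_mfd :: (real, real) manifold) M c" and f: "smap M N f"
    and U: "(U, \<phi>) \<in> atlas M" "c 0 \<in> U" and V: "(V, \<psi>) \<in> atlas N" "f (c 0) \<in> V"
  shows "((\<lambda>t. \<psi> (f (c t))) has_vector_derivative
    frechet_derivative (\<psi> \<circ> f \<circ> inv_into U \<phi>) (at (\<phi> (c 0))) (vector_derivative (\<lambda>t. \<phi> (c t)) (at 0))) (at 0)"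
proof -
  let ?D = "frechet_derivative (\<psi> \<circ> f \<circ> inv_into U \<phi>) (at (\<phi> (c 0)))"
  have 0: "((\<lambda>t. \<psi> (f (c t))) has_derivative ?D \<circ> frechet_derivative (\<lambda>t. \<phi> (c t)) (at 0)) (at 0)"
    using chart_derivative_compose[OF c f, of UNIV "\<lambda>x. x" 0 U \<phi> V \<psi>] U V by (simp add: o_def)
  have "cinf_at (\<lambda>t. \<phi> (c t)) 0"
    using smap_in_charts[OF c, of UNIV "\<lambda>x. x" U \<phi> 0] U by simp
  then have d: "(\<lambda>t. \<phi> (c t)) differentiable at 0" by (rule cinf_at_differentiable)
  have "cinf_at (\<psi> \<circ> f \<circ> inv_into U \<phi>) (\<phi> (c 0))"
    using smap_in_charts[OF f U(1) V(1) U(2) V(2)] by (simp add: o_def)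
  then have lin: "linear ?D" by (intro linear_frechet_derivative cinf_at_differentiable)
  have "?D \<circ> frechet_derivative (\<lambda>t. \<phi> (c t)) (at 0)
      = (\<lambda>h. h *\<^sub>R ?D (vector_derivative (\<lambda>t. \<phi> (c t)) (at 0)))"
  proof
    fix h :: real
    show "(?D \<circ> frechet_derivative (\<lambda>t. \<phi> (c t)) (at 0)) h = h *\<^sub>R ?D (vector_derivative (\<lambda>t. \<phi> (c t)) (at 0))"
      using frechet_derivative_eq_vector_derivative[OF d] linear_scale[OF lin] by simp
  qed
  then show ?thesis using 0 by (simp add: has_vector_derivative_def)
qed

lemma same_velocity_alt:
  "same_velocity M c d \<longleftrightarrow> c 0 = d 0 \<and> (\<forall>U \<phi>. (U, \<phi>) \<in> atlas M \<longrightarrow> c 0 \<in> U \<longrightarrow>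
    vector_derivative (\<lambda>t. \<phi> (c t)) (at 0) = vector_derivative (\<lambda>t. \<phi> (d t)) (at 0))"
  unfolding same_velocity_def o_def by auto

text \<open>
  Transition maps carry velocities to velocities, so one chart decides.
\<close>

lemma same_velocityI_chart:
  assumes c: "smap (vec_mfd :: (real, real) manifold) M c" and d: "smap vec_mfd M d" and cd: "c 0 = d 0"
    and U: "(U, \<phi>) \<in> atlas M" "c 0 \<in> U"
    and vel: "vector_derivative (\<lambda>t. \<phi> (c t)) (at 0) = vector_derivative (\<lambda>t. \<phi> (d t)) (at 0)"
  shows "same_velocity M c d"
  unfolding same_velocity_alt
proof (intro conjI allI impI cd)
  fix V \<psi> assume V: "(V, \<psi>) \<in> atlas M" "c 0 \<in> V"
  have "vector_derivative (\<lambda>t. \<psi> (c t)) (at 0) =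
      frechet_derivative (\<psi> \<circ> (\<lambda>x. x) \<circ> inv_into U \<phi>) (at (\<phi> (c 0))) (vector_derivative (\<lambda>t. \<phi> (c t)) (at 0))"
    by (intro vector_derivative_at curve_push_forward[OF c smap_ident[OF smap_target[OF c]] U V])
  moreover have "vector_derivative (\<lambda>t. \<psi> (d t)) (at 0) =
      frechet_derivative (\<psi> \<circ> (\<lambda>x. x) \<circ> inv_into U \<phi>) (at (\<phi> (d 0))) (vector_derivative (\<lambda>t. \<phi> (d t)) (at 0))"
    using U V cd
    by (intro vector_derivative_at curve_push_forward[OF d smap_ident[OF smap_target[OF d]] U(1) _ V(1)]) auto
  ultimately show "vector_derivative (\<lambda>t. \<psi> (c t)) (at 0) = vector_derivative (\<lambda>t. \<psi> (d t)) (at 0)"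
    using cd vel by simp
qed

lemma same_velocity_sym: "same_velocity M c d \<Longrightarrow> same_velocity M d c"
  by (simp add: same_velocity_alt)

lemma same_velocity_trans: "same_velocity M c d \<Longrightarrow> same_velocity M d e \<Longrightarrow> same_velocity M c e"
  by (simp add: same_velocity_alt)

lemma same_velocity_refl: "same_velocity M c c"
  by (simp add: same_velocity_alt)

lemma same_velocity_push_forward:
  assumes sv: "same_velocity M c d"
    and c: "smap (vec_mfd :: (real, real) manifold) M c" and d: "smap vec_mfd M d" and f: "smap M N f"
  shows "same_velocity N (\<lambda>t. f (c t)) (\<lambda>t. f (d t))"
  unfolding same_velocity_alt
proof (intro conjI allI impI)
  have cd: "c 0 = d 0" using sv by (simp add: same_velocity_alt)
  then show "f (c 0) = f (d 0)" by simp
  fix V \<psi> assume V: "(V, \<psi>) \<in> atlas N" "f (c 0) \<in> V"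
  obtain U \<phi> where U: "(U, \<phi>) \<in> atlas M" "c 0 \<in> U"
    using chart_at[OF smap_target[OF c] smap_points[OF c]] by (metis UNIV_I points_vec_mfd)
  have "vector_derivative (\<lambda>t. \<psi> (f (c t))) (at 0) =
      frechet_derivative (\<psi> \<circ> f \<circ> inv_into U \<phi>) (at (\<phi> (c 0))) (vector_derivative (\<lambda>t. \<phi> (c t)) (at 0))"
    by (intro vector_derivative_at curve_push_forward[OF c f U V])
  moreover have "vector_derivative (\<lambda>t. \<psi> (f (d t))) (at 0) =
      frechet_derivative (\<psi> \<circ> f \<circ> inv_into U \<phi>) (at (\<phi> (d 0))) (vector_derivative (\<lambda>t. \<phi> (d t)) (at 0))"
    using U V cd by (intro vector_derivative_at curve_push_forward[OF d f U(1) _ V(1)]) auto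
  moreover have "vector_derivative (\<lambda>t. \<phi> (c t)) (at 0) = vector_derivative (\<lambda>t. \<phi> (d t)) (at 0)"
    using sv U by (simp add: same_velocity_alt)
  ultimately show "vector_derivative (\<lambda>t. \<psi> (f (c t))) (at 0) = vector_derivative (\<lambda>t. \<psi> (f (d t))) (at 0)"
    using cd by simp
qed

lemma same_velocity_vec_mfd:
  "same_velocity vec_mfd c d \<longleftrightarrow> c 0 = d 0 \<and> vector_derivative c (at 0) = vector_derivative d (at 0)"
  by (simp add: same_velocity_alt)

lemma same_velocity_vector_derivative:
  fixes M :: "('a, 'e::real_inner) manifold" and f :: "'a \<Rightarrow> 'f::real_inner"
  assumes "same_velocity M c d" "smap (vec_mfd :: (real, real) manifold) M c" "smap vec_mfd M d" "smap M vec_mfd f"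
  shows "vector_derivative (\<lambda>t. f (c t)) (at 0) = vector_derivative (\<lambda>t. f (d t)) (at 0)"
  using same_velocity_push_forward[OF assms] by (simp add: same_velocity_vec_mfd)

lemma eventually_cinf_at: "cinf_at f x \<Longrightarrow> \<forall>\<^sub>F y in nhds x. cinf_at f y"
  unfolding eventually_nhds cinf_at_def by blast

text \<open>
  The velocity at time zero of a smooth family of curves is a partial derivative, hence smooth in the
  parameter. This yields smoothness of the adjoint representation.
\<close>

lemma smap_velocity_of_family:
  fixes M :: "('a, 'e::real_inner) manifold" and N :: "('b, 'f::real_inner) manifold"
    and c :: "'a \<times> real \<Rightarrow> 'b"
  assumes c: "smap (prod_mfd M vec_mfd) N c" and M: "smooth_manifold M"
    and V: "(V, \<psi>) \<in> atlas N" "\<And>x. x \<in> points M \<Longrightarrow> c (x, 0) \<in> V"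
  shows "smap M vec_mfd (\<lambda>x. vector_derivative (\<lambda>t. \<psi> (c (x, t))) (at 0))"
proof (rule smap_vecI[OF M smooth_manifold_finite_dim[OF smap_target[OF c]]])
  fix x assume x: "x \<in> points M"
  obtain U \<phi> where U: "(U, \<phi>) \<in> atlas M" "x \<in> U" using chart_at[OF M x] .
  define h where "h = (\<lambda>z. \<psi> (c (inv_into U \<phi> (fst z), snd z)))"
  have "cinf_at (\<lambda>a. \<psi> (c (inv_into (U \<times> UNIV) (map_prod \<phi> (\<lambda>x. x)) a))) (map_prod \<phi> (\<lambda>x. x) (x, 0))"
    using U V(2)[OF x]
    by (intro smap_in_charts[OF c _ V(1)] prod_mfd_chartI) auto
  then have "cinf_at (\<lambda>a. \<psi> (c (inv_into (U \<times> UNIV) (map_prod \<phi> (\<lambda>x. x)) a))) (\<phi> x, 0)" by simp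
  then have h: "cinf_at h (\<phi> x, 0)"
  proof (rule cinf_at_cong)
    show "\<forall>\<^sub>F z in nhds (\<phi> x, 0). \<psi> (c (inv_into (U \<times> UNIV) (map_prod \<phi> (\<lambda>x. x)) z)) = h z"
      using eventually_inv_into_map_prod[OF M smooth_manifold_real U(1) _ U(2), of UNIV "\<lambda>x. x" 0]
      by (auto simp: h_def elim: eventually_mono)
  qed
  have fin: "finite_dim TYPE('e \<times> real)"
    by (rule finite_dim_prod[OF smooth_manifold_finite_dim[OF M] finite_dim_real])
  have emb: "cinf_at (\<lambda>a::'e. (a, 0::real)) (\<phi> x)"
    by (intro cinf_at_Pair cinf_at_ident cinf_at_const)
  have "cinf_at (\<lambda>a. frechet_derivative h (at (a, 0)) (0, 1)) (\<phi> x)"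
    by (rule cinf_at_compose[OF fin emb]) (rule cinf_at_frechet_derivative[OF h])
  then have "cinf_at (\<lambda>a. vector_derivative (\<lambda>t. \<psi> (c (inv_into U \<phi> a, t))) (at 0)) (\<phi> x)"
  proof (rule cinf_at_cong)
    have "((\<lambda>a. (a, 0::real)) \<longlongrightarrow> (\<phi> x, 0)) (nhds (\<phi> x))"
      by (intro tendsto_intros filterlim_ident)
    then have "\<forall>\<^sub>F a in nhds (\<phi> x). cinf_at h (a, 0)"
      using eventually_cinf_at[OF h] by (simp add: filterlim_iff)
    then show "\<forall>\<^sub>F a in nhds (\<phi> x). frechet_derivative h (at (a, 0)) (0, 1) =
        vector_derivative (\<lambda>t. \<psi> (c (inv_into U \<phi> a, t))) (at 0)"
    proof eventually_elim
      case (elim a)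
      have "((\<lambda>t. h (a, t)) has_derivative (\<lambda>t. frechet_derivative h (at (a, 0)) (0, t))) (at 0)"
      proof (rule has_derivative_compose[of "\<lambda>t. (a, t)" _ _ UNIV h])
        show "((\<lambda>t. (a, t)) has_derivative (\<lambda>t. (0, t))) (at (0::real))"
          by (intro derivative_intros)
        show "(h has_derivative frechet_derivative h (at (a, 0))) (at (a, 0))"
          by (rule cinf_at_has_derivative[OF elim])
      qed
      moreover have "frechet_derivative h (at (a, 0)) (0, t) = t *\<^sub>R frechet_derivative h (at (a, 0)) (0, 1)" for t
        using linear_scale[OF linear_frechet_derivative[OF cinf_at_differentiable[OF elim]], of t "(0, 1)"]
        by simp
      ultimately have "((\<lambda>t. h (a, t)) has_vector_derivative frechet_derivative h (at (a, 0)) (0, 1)) (at 0)"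
        unfolding has_vector_derivative_def by (rule has_derivative_eq_rhs[OF _ ext])
      from vector_derivative_at[OF this] show ?case by (simp add: h_def)
    qed
  qed
  then show "\<exists>U \<phi>. (U, \<phi>) \<in> atlas M \<and> x \<in> U \<and>
      cinf_at (\<lambda>a. vector_derivative (\<lambda>t. \<psi> (c (inv_into U \<phi> a, t))) (at 0)) (\<phi> x)" using U by blast
qed

text \<open>
  In a ball contained in the image of a chart the derivative test applies, so all level sets are open.
\<close>

lemma constant_if_derivative_zero:
  fixes M :: "('a, 'e::real_inner) manifold" and f :: "'a \<Rightarrow> 'f::real_inner"
  assumes f: "smap M vec_mfd f" and conn: "connected_space (mtop M)"
    and zero: "\<And>U \<phi> x v. (U, \<phi>) \<in> atlas M \<Longrightarrow> x \<in> U \<Longrightarrow> frechet_derivative (f \<circ> inv_into U \<phi>) (at (\<phi> x)) v = 0"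
    and xy: "x \<in> points M" "y \<in> points M"
  shows "f x = f y"
proof -
  note M = smap_source[OF f]
  have op: "openin (mtop M) {z \<in> points M. P (f z)}" for P
  proof (subst openin_subopen, intro ballI)
    fix z assume "z \<in> {z \<in> points M. P (f z)}"
    then have z: "z \<in> points M" "P (f z)" by auto
    obtain U \<phi> where U: "(U, \<phi>) \<in> atlas M" "z \<in> U" using chart_at[OF M z(1)] .
    have "open (\<phi> ` U)" using chart_image_open[OF M U(1) chart_openin[OF M U(1)]] by simp
    then obtain r where r: "r > 0" "ball (\<phi> z) r \<subseteq> \<phi> ` U" using U(2) by (metis imageI openE)
    have const: "f w = f z" if w: "w \<in> U \<inter> \<phi> -` ball (\<phi> z) r" for w
    proof -
      have "(f \<circ> inv_into U \<phi>) (\<phi> w) = (f \<circ> inv_into U \<phi>) (\<phi> z)"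
      proof (rule has_derivative_zero_unique[of "ball (\<phi> z) r"])
        fix a assume a: "a \<in> ball (\<phi> z) r"
        then obtain b where b: "b \<in> U" "a = \<phi> b" using r(2) by auto
        have "cinf_at (f \<circ> inv_into U \<phi>) a" using smap_vecD[OF f U(1) b(1)] b by (simp add: o_def)
        from cinf_at_has_derivative[OF this]
        moreover have "frechet_derivative (f \<circ> inv_into U \<phi>) (at a) = (\<lambda>_. 0)"
          using zero[OF U(1) b(1)] b(2) by (simp add: fun_eq_iff)
        ultimately have "((f \<circ> inv_into U \<phi>) has_derivative (\<lambda>_. 0)) (at a)" by simp
        then show "((f \<circ> inv_into U \<phi>) has_derivative (\<lambda>_. 0)) (at a within ball (\<phi> z) r)"
          by (rule has_derivative_at_withinI)
      qed (use w r(1) in auto)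
      then show ?thesis using w U by (simp add: chart_inverse[OF M U(1)])
    qed
    have "U \<inter> \<phi> -` ball (\<phi> z) r \<subseteq> {z \<in> points M. P (f z)}"
      using const chart_subset[OF M U(1)] z(2) by auto
    then show "\<exists>T. openin (mtop M) T \<and> z \<in> T \<and> T \<subseteq> {z \<in> points M. P (f z)}"
      using U(2) r(1) by (intro exI[of _ "U \<inter> \<phi> -` ball (\<phi> z) r"] conjI chart_preimage_openin[OF M U(1) open_ball]) auto
  qed
  let ?A = "{z \<in> points M. f z = f x}"
  have "openin (mtop M) ?A" using op[of "\<lambda>w. w = f x"] .
  moreover have "closedin (mtop M) ?A"
  proof -
    have "points M - ?A = {z \<in> points M. f z \<noteq> f x}" by auto
    then show ?thesis using op[of "\<lambda>w. w \<noteq> f x"] by (simp add: closedin_def)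
  qed
  ultimately have "?A = {} \<or> ?A = points M" using conn by (auto simp: connected_space_clopen_in)
  then have "y \<in> ?A" using xy by blast
  then show ?thesis by simp
qed

section \<open>Lie groups and the adjoint representation\<close>

lemma lie_group_group: "is_lie_group G \<Longrightarrow> group G"
  and lie_group_manifold: "is_lie_group G \<Longrightarrow> smooth_manifold (mfd G)"
  and lie_group_points: "is_lie_group G \<Longrightarrow> points (mfd G) = carrier G"
  by (simp_all add: is_lie_group_def)

lemma smap_lie_mult:
  fixes G :: "('a, 'e::real_inner, 'z) lie_group_scheme" and M :: "('m, 'f::real_inner) manifold"
  assumes G: "is_lie_group G" and f: "smap M (mfd G) f" and g: "smap M (mfd G) g"
  shows "smap M (mfd G) (\<lambda>x. f x \<otimes>\<^bsub>G\<^esub> g x)"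
proof -
  have "smap (prod_mfd (mfd G) (mfd G)) (mfd G) (\<lambda>(x, y). x \<otimes>\<^bsub>G\<^esub> y)"
    using G by (simp add: smap_def is_lie_group_def smooth_manifold_prod)
  from smap_compose[OF this smap_Pair[OF f g]] show ?thesis by simp
qed

lemma smap_lie_inv:
  fixes G :: "('a, 'e::real_inner, 'z) lie_group_scheme" and M :: "('m, 'f::real_inner) manifold"
  assumes G: "is_lie_group G" and f: "smap M (mfd G) f"
  shows "smap M (mfd G) (\<lambda>x. inv\<^bsub>G\<^esub> f x)"
proof -
  have "smap (mfd G) (mfd G) (\<lambda>x. inv\<^bsub>G\<^esub> x)"
    using G by (simp add: smap_def is_lie_group_def)
  from smap_compose[OF this f] show ?thesis .
qed

lemma smap_lie_const:
  fixes G :: "('a, 'e::real_inner, 'z) lie_group_scheme" and M :: "('m, 'f::real_inner) manifold"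
  assumes "is_lie_group G" "smooth_manifold M" "x \<in> carrier G"
  shows "smap M (mfd G) (\<lambda>_. x)"
  using assms by (intro smap_const) (auto simp: is_lie_group_def)

lemma smap_lie_ident:
  fixes G :: "('a, 'e::real_inner, 'z) lie_group_scheme"
  assumes "is_lie_group G" shows "smap (mfd G) (mfd G) (\<lambda>x. x)"
  using smap_ident[OF lie_group_manifold[OF assms]] .

locale exp_lie =
  fixes G :: "('a, 'e::real_inner) exp_lie_group" (structure)
  assumes is_exp: "is_exp_lie_group G"
begin

lemma is_lie: "is_lie_group G"
  using is_exp by (simp add: is_exp_lie_group_def)

sublocale group G using lie_group_group[OF is_lie] .

lemma manifold: "smooth_manifold (mfd G)" by (rule lie_group_manifold[OF is_lie])

lemma points_carrier: "points (mfd G) = carrier G" by (rule lie_group_points[OF is_lie])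

lemma finite_dim: "finite_dim TYPE('e)" by (rule smooth_manifold_finite_dim[OF manifold])

lemmas smap_mult = smap_lie_mult[OF is_lie]
  and smap_inv = smap_lie_inv[OF is_lie]
  and smap_group_const = smap_lie_const[OF is_lie]
  and smap_group_ident = smap_lie_ident[OF is_lie]

lemma smap_exp: "smap (vec_mfd :: (real, real) manifold) (mfd G) (\<lambda>t. lexp G (t *\<^sub>R Y))"
  using is_exp manifold smooth_manifold_real by (simp add: is_exp_lie_group_def smap_def)

lemma exp_closed [simp]: "lexp G (t *\<^sub>R Y) \<in> carrier G"
  using smap_points[OF smap_exp, of t Y] by (simp add: points_carrier)

lemma exp_add: "lexp G ((s + t) *\<^sub>R Y) = lexp G (s *\<^sub>R Y) \<otimes> lexp G (t *\<^sub>R Y)"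
  using is_exp by (simp add: is_exp_lie_group_def)

lemma exp_zero [simp]: "lexp G 0 = \<one>"
proof -
  have "lexp G 0 \<in> carrier G" using exp_closed[of 0] by simp
  moreover have "lexp G 0 = lexp G 0 \<otimes> lexp G 0" using exp_add[of 0 0] by simp
  ultimately show ?thesis using l_cancel_one' by simp
qed

lemma exp_minus: "inv (lexp G (t *\<^sub>R Y)) = lexp G ((- t) *\<^sub>R Y)"
  using exp_add[of "-t" t Y] by (intro inv_equality) (auto simp del: scaleR_minus_left)

lemma chart_at_one: obtains U \<phi> where "(U, \<phi>) \<in> atlas (mfd G)" "\<one> \<in> U"
  using chart_at[OF manifold, of \<one>] points_carrier by blast

lemma exp_velocity:
  assumes "(U, \<phi>) \<in> atlas (mfd G)" "\<one> \<in> U"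
  shows "linear (\<lambda>Y. vector_derivative (\<lambda>t. \<phi> (lexp G (t *\<^sub>R Y))) (at 0))"
    and "bij (\<lambda>Y. vector_derivative (\<lambda>t. \<phi> (lexp G (t *\<^sub>R Y))) (at 0))"
  using is_exp assms by (auto simp: is_exp_lie_group_def)

text \<open>
  This makes the definite description in \<open>lie_diff\<close> meaningful: at the unit the velocities of the
  one-parameter subgroups form a bijective image of the Lie algebra.
\<close>

lemma velocity_at_one_exp:
  assumes c: "smap (vec_mfd :: (real, real) manifold) (mfd G) c" and c0: "c 0 = \<one>"
  shows "\<exists>!W. same_velocity (mfd G) c (\<lambda>t. lexp G (t *\<^sub>R W))"
proof -
  obtain U \<phi> where U: "(U, \<phi>) \<in> atlas (mfd G)" "\<one> \<in> U" by (rule chart_at_one)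
  let ?L = "\<lambda>Y. vector_derivative (\<lambda>t. \<phi> (lexp G (t *\<^sub>R Y))) (at 0)"
  have "same_velocity (mfd G) c (\<lambda>t. lexp G (t *\<^sub>R W)) \<longleftrightarrow> vector_derivative (\<lambda>t. \<phi> (c t)) (at 0) = ?L W" for W
  proof
    assume "same_velocity (mfd G) c (\<lambda>t. lexp G (t *\<^sub>R W))"
    then show "vector_derivative (\<lambda>t. \<phi> (c t)) (at 0) = ?L W" using U c0 by (simp add: same_velocity_alt)
  next
    assume "vector_derivative (\<lambda>t. \<phi> (c t)) (at 0) = ?L W"
    then show "same_velocity (mfd G) c (\<lambda>t. lexp G (t *\<^sub>R W))"
      using U c0 by (intro same_velocityI_chart[OF c smap_exp _ U(1)]) auto
  qed
  then show ?thesis using exp_velocity(2)[OF U] by (simp add: bij_iff) metis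
qed

text \<open>
  The curves \<open>x exp(t Y)\<close> realise every tangent vector at \<open>x\<close>, since left translation by \<open>x\<close> is a
  diffeomorphism carrying the unit to \<open>x\<close>. Hence the derivative of \<open>f\<close> vanishes in every chart.
\<close>

lemma constant_if_left_derivative_zero:
  fixes f :: "'a \<Rightarrow> 'f::real_inner"
  assumes f: "smap (mfd G) vec_mfd f" and conn: "connected_space (mtop (mfd G))"
    and zero: "\<And>x Y. x \<in> carrier G \<Longrightarrow> vector_derivative (\<lambda>t. f (x \<otimes> lexp G (t *\<^sub>R Y))) (at 0) = 0"
    and x: "x \<in> carrier G"
  shows "f x = f \<one>"
proof (rule constant_if_derivative_zero[OF f conn])
  show "x \<in> points (mfd G)" "\<one> \<in> points (mfd G)" using x by (auto simp: points_carrier)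
  fix U \<phi> x v assume U: "(U, \<phi>) \<in> atlas (mfd G)" "x \<in> U"
  then have x: "x \<in> carrier G" using chart_subset[OF manifold U(1)] points_carrier by auto
  obtain V \<psi> where V: "(V, \<psi>) \<in> atlas (mfd G)" "\<one> \<in> V" by (rule chart_at_one)
  have l: "smap (mfd G) (mfd G) (\<lambda>y. z \<otimes> y)" if "z \<in> carrier G" for z
    by (intro smap_mult smap_group_const smap_group_ident manifold that)
  define w where "w = frechet_derivative (\<psi> \<circ> (\<lambda>y. inv x \<otimes> y) \<circ> inv_into U \<phi>) (at (\<phi> x)) v"
  have w: "frechet_derivative (\<phi> \<circ> (\<lambda>y. x \<otimes> y) \<circ> inv_into V \<psi>) (at (\<psi> \<one>)) w = v"
  proof -
    have gf: "x \<otimes> (inv x \<otimes> y) = y" if "y \<in> points (mfd G)" for y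
      using that x by (simp add: points_carrier flip: m_assoc)
    show ?thesis unfolding w_def
      using chart_derivative_left_inverse[OF l[of "inv x"] l[OF x] gf U V(1)] x V(2) by simp
  qed
  \<comment> \<open>The direction \<open>v\<close> at \<open>x\<close> is moved to the unit, where it is the velocity of a one-parameter subgroup.\<close>
  obtain Y where Y: "vector_derivative (\<lambda>t. \<psi> (lexp G (t *\<^sub>R Y))) (at 0) = w"
    using surjD[OF bij_is_surj[OF exp_velocity(2)[OF V]], of w] by auto
  have "((\<lambda>t. \<phi> (x \<otimes> lexp G (t *\<^sub>R Y))) has_vector_derivative v) (at 0)"
    using curve_push_forward[OF smap_exp l[OF x] V(1) _ U(1), of Y] V U x w Y by simp
  then have v: "vector_derivative (\<lambda>t. \<phi> (x \<otimes> lexp G (t *\<^sub>R Y))) (at 0) = v"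
    by (rule vector_derivative_at)
  have c: "smap vec_mfd (mfd G) (\<lambda>t. x \<otimes> lexp G (t *\<^sub>R Y))"
    by (rule smap_compose[OF l[OF x] smap_exp])
  have "((\<lambda>t. f (x \<otimes> lexp G (t *\<^sub>R Y))) has_vector_derivative
      frechet_derivative (f \<circ> inv_into U \<phi>) (at (\<phi> x)) v) (at 0)"
    using curve_push_forward[OF c f U(1), of UNIV "\<lambda>x. x"] U x v by (simp add: o_def)
  then show "frechet_derivative (f \<circ> inv_into U \<phi>) (at (\<phi> x)) v = 0"
    using zero[OF x] by (metis vector_derivative_at)
qed

text \<open>
  Along \<open>x exp(t Y)\<close> an additive function differs from its values on \<open>exp(t Y)\<close> by the constant
  \<open>f x\<close>, so that only its differential at the unit matters.
\<close>

lemma additive_zero_if_derivative_zero: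
  fixes f :: "'a \<Rightarrow> 'f::real_inner"
  assumes f: "smap (mfd G) vec_mfd f" and conn: "connected_space (mtop (mfd G))"
    and add: "\<And>x y. x \<in> carrier G \<Longrightarrow> y \<in> carrier G \<Longrightarrow> f (x \<otimes> y) = f x + f y"
    and zero: "\<And>Y. vector_derivative (\<lambda>t. f (lexp G (t *\<^sub>R Y))) (at 0) = 0"
    and x: "x \<in> carrier G"
  shows "f x = 0"
proof -
  have "f x = f \<one>"
  proof (rule constant_if_left_derivative_zero[OF f conn _ x])
    fix x Y assume x: "x \<in> carrier G"
    have "((\<lambda>t. f (lexp G (t *\<^sub>R Y))) has_vector_derivative 0) (at 0)"
      using smap_real_has_vector_derivative[OF smap_compose[OF f smap_exp], of Y 0] zero by simp
    then have "((\<lambda>t. f x + f (lexp G (t *\<^sub>R Y))) has_vector_derivative 0) (at 0)"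
      using has_vector_derivative_add[OF has_vector_derivative_const, of _ 0 "at 0" "f x"] by simp
    then show "vector_derivative (\<lambda>t. f (x \<otimes> lexp G (t *\<^sub>R Y))) (at 0) = 0"
      using x by (simp add: add vector_derivative_at)
  qed
  also have "f \<one> = 0" using add[of \<one> \<one>] by simp
  finally show ?thesis .
qed

end

text \<open>
  A smooth map preserving the unit has a tangent map there, which is linear. The instances below are
  conjugations and the inclusion of a Lie subgroup.
\<close>

locale lie_diff_map = G: exp_lie G + K: exp_lie K
  for G :: "('a, 'e::real_inner) exp_lie_group" and K :: "('b, 'f::real_inner) exp_lie_group" +
  fixes F :: "'a \<Rightarrow> 'b"
  assumes F: "smap (mfd G) (mfd K) F" and F_one: "F \<one>\<^bsub>G\<^esub> = \<one>\<^bsub>K\<^esub>"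
begin

lemma curve: "smap (vec_mfd :: (real, real) manifold) (mfd K) (\<lambda>t. F (lexp G (t *\<^sub>R Y)))"
  by (rule smap_compose[OF F G.smap_exp])

lemma unique: "\<exists>!W. same_velocity (mfd K) (\<lambda>t. F (lexp G (t *\<^sub>R Y))) (\<lambda>t. lexp K (t *\<^sub>R W))"
  by (rule K.velocity_at_one_exp[OF curve]) (simp add: F_one)

lemma lie_diff_velocity:
  "same_velocity (mfd K) (\<lambda>t. F (lexp G (t *\<^sub>R Y))) (\<lambda>t. lexp K (t *\<^sub>R lie_diff G K F Y))"
  unfolding lie_diff_def by (rule theI'[OF unique])

lemma lie_diff_eqI:
  "same_velocity (mfd K) (\<lambda>t. F (lexp G (t *\<^sub>R Y))) (\<lambda>t. lexp K (t *\<^sub>R W)) \<Longrightarrow> lie_diff G K F Y = W"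
  using unique lie_diff_velocity by blast

lemma linear_lie_diff: "linear (lie_diff G K F)"
proof -
  obtain U \<phi> where U: "(U, \<phi>) \<in> atlas (mfd G)" "\<one>\<^bsub>G\<^esub> \<in> U" by (rule G.chart_at_one)
  obtain V \<psi> where V: "(V, \<psi>) \<in> atlas (mfd K)" "\<one>\<^bsub>K\<^esub> \<in> V" by (rule K.chart_at_one)
  let ?L = "\<lambda>Y. vector_derivative (\<lambda>t. \<phi> (lexp G (t *\<^sub>R Y))) (at 0)"
  let ?N = "\<lambda>W. vector_derivative (\<lambda>t. \<psi> (lexp K (t *\<^sub>R W))) (at 0)"
  let ?D = "frechet_derivative (\<psi> \<circ> F \<circ> inv_into U \<phi>) (at (\<phi> \<one>\<^bsub>G\<^esub>))"
  have D: "linear ?D"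
    using smap_in_charts[OF F U(1) V(1) U(2)] V(2) F_one
    by (intro linear_frechet_derivative cinf_at_differentiable) (simp add: o_def)
  have eq: "?N (lie_diff G K F Y) = ?D (?L Y)" for Y
  proof -
    have "?N (lie_diff G K F Y) = vector_derivative (\<lambda>t. \<psi> (F (lexp G (t *\<^sub>R Y)))) (at 0)"
      using lie_diff_velocity[of Y] V F_one by (simp add: same_velocity_alt)
    also have "\<dots> = ?D (?L Y)"
      using curve_push_forward[OF G.smap_exp F U(1) _ V(1), of Y] U V F_one
      by (simp add: vector_derivative_at)
    finally show ?thesis .
  qed
  have inj: "inj ?N" using K.exp_velocity(2)[OF V] bij_is_inj by blast
  note lin = K.exp_velocity(1)[OF V] G.exp_velocity(1)[OF U] D
  show ?thesis
  proof (rule linearI)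
    fix Y Z
    have "?N (lie_diff G K F (Y + Z)) = ?N (lie_diff G K F Y + lie_diff G K F Z)"
      unfolding linear_add[OF lin(1)] eq linear_add[OF lin(2)] linear_add[OF lin(3)] ..
    then show "lie_diff G K F (Y + Z) = lie_diff G K F Y + lie_diff G K F Z"
      by (rule injD[OF inj])
  next
    fix r Y
    have "?N (lie_diff G K F (r *\<^sub>R Y)) = ?N (r *\<^sub>R lie_diff G K F Y)"
      unfolding linear_scale[OF lin(1)] eq linear_scale[OF lin(2)] linear_scale[OF lin(3)] ..
    then show "lie_diff G K F (r *\<^sub>R Y) = r *\<^sub>R lie_diff G K F Y"
      by (rule injD[OF inj])
  qed
qed

end

context exp_lie
begin

lemma smap_conj: "x \<in> carrier G \<Longrightarrow> smap (mfd G) (mfd G) (\<lambda>y. x \<otimes> y \<otimes> inv x)"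
  by (intro smap_mult smap_group_const smap_group_ident manifold) auto

lemma conj_lie_diff_map: "x \<in> carrier G \<Longrightarrow> lie_diff_map G G (\<lambda>y. x \<otimes> y \<otimes> inv x)"
  by unfold_locales (auto simp: smap_conj)

lemma Ad_velocity: "x \<in> carrier G \<Longrightarrow>
    same_velocity (mfd G) (\<lambda>t. x \<otimes> lexp G (t *\<^sub>R Y) \<otimes> inv x) (\<lambda>t. lexp G (t *\<^sub>R Ad G x Y))"
  unfolding Ad_def by (rule lie_diff_map.lie_diff_velocity[OF conj_lie_diff_map])

lemma Ad_eqI: "x \<in> carrier G \<Longrightarrow>
    same_velocity (mfd G) (\<lambda>t. x \<otimes> lexp G (t *\<^sub>R Y) \<otimes> inv x) (\<lambda>t. lexp G (t *\<^sub>R W)) \<Longrightarrow> Ad G x Y = W"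
  unfolding Ad_def by (rule lie_diff_map.lie_diff_eqI[OF conj_lie_diff_map])

lemma linear_Ad: "x \<in> carrier G \<Longrightarrow> linear (Ad G x)"
  unfolding Ad_def by (rule lie_diff_map.linear_lie_diff[OF conj_lie_diff_map])

lemma Ad_mult:
  assumes "x \<in> carrier G" "y \<in> carrier G"
  shows "Ad G (x \<otimes> y) Y = Ad G x (Ad G y Y)"
proof (rule Ad_eqI)
  have "same_velocity (mfd G) (\<lambda>t. x \<otimes> (y \<otimes> lexp G (t *\<^sub>R Y) \<otimes> inv y) \<otimes> inv x)
      (\<lambda>t. x \<otimes> lexp G (t *\<^sub>R Ad G y Y) \<otimes> inv x)"
    by (rule same_velocity_push_forward[OF Ad_velocity[OF assms(2)] _ smap_exp smap_conj[OF assms(1)]])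
      (rule smap_compose[OF smap_conj[OF assms(2)] smap_exp])
  moreover have "(\<lambda>t. x \<otimes> (y \<otimes> lexp G (t *\<^sub>R Y) \<otimes> inv y) \<otimes> inv x)
      = (\<lambda>t. x \<otimes> y \<otimes> lexp G (t *\<^sub>R Y) \<otimes> inv (x \<otimes> y))"
    using assms by (simp add: inv_mult_group m_assoc)
  ultimately show "same_velocity (mfd G) (\<lambda>t. x \<otimes> y \<otimes> lexp G (t *\<^sub>R Y) \<otimes> inv (x \<otimes> y))
      (\<lambda>t. lexp G (t *\<^sub>R Ad G x (Ad G y Y)))"
    using same_velocity_trans[OF _ Ad_velocity[OF assms(1)]] by simp
qed (use assms in auto)

lemma Ad_one: "Ad G \<one> Y = Y"
  by (rule Ad_eqI) (simp_all add: same_velocity_refl)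

text \<open>
  In a chart at the unit, the velocity of \<open>x exp(t Y) x\<^sup>-\<^sup>1\<close> is the image of \<open>Ad x Y\<close> under a linear
  bijection that does not depend on \<open>x\<close>.
\<close>

lemma smap_Ad: "smap (mfd G) vec_mfd (\<lambda>x. Ad G x Y)"
proof -
  obtain U \<phi> where U: "(U, \<phi>) \<in> atlas (mfd G)" "\<one> \<in> U" by (rule chart_at_one)
  let ?L = "\<lambda>Y. vector_derivative (\<lambda>t. \<phi> (lexp G (t *\<^sub>R Y))) (at 0)"
  note L = exp_velocity[OF U]
  have linv: "linear (inv_into UNIV ?L)"
  proof (rule linearI)
    have LL: "?L (inv_into UNIV ?L y) = y" for y by (rule surj_f_inv_f[OF bij_is_surj[OF L(2)]])
    have eqI: "inv_into UNIV ?L y = z" if "y = ?L z" for y z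
      unfolding that by (rule inv_f_f[OF bij_is_inj[OF L(2)]])
    show "inv_into UNIV ?L (x + y) = inv_into UNIV ?L x + inv_into UNIV ?L y" for x y
      by (rule eqI) (simp only: linear_add[OF L(1)] LL)
    show "inv_into UNIV ?L (r *\<^sub>R x) = r *\<^sub>R inv_into UNIV ?L x" for r x
      by (rule eqI) (simp only: linear_scale[OF L(1)] LL)
  qed
  have c: "smap (prod_mfd (mfd G) vec_mfd) (mfd G) (\<lambda>z. fst z \<otimes> lexp G (snd z *\<^sub>R Y) \<otimes> inv (fst z))"
    by (intro smap_mult smap_inv smap_fst manifold smooth_manifold_real
        smap_compose[OF smap_exp smap_snd[OF manifold smooth_manifold_real]])
  have "smap (mfd G) vec_mfd (\<lambda>x. vector_derivative (\<lambda>t. \<phi> (x \<otimes> lexp G (t *\<^sub>R Y) \<otimes> inv x)) (at 0))"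
    using smap_velocity_of_family[OF c manifold U(1)] U(2) by (simp add: points_carrier)
  then have *: "smap (mfd G) vec_mfd (\<lambda>x. inv_into UNIV ?L (vector_derivative (\<lambda>t. \<phi> (x \<otimes> lexp G (t *\<^sub>R Y) \<otimes> inv x)) (at 0)))"
    by (rule smap_bounded_linear[OF finite_dim_linear_imp_bounded_linear[OF finite_dim linv] finite_dim])
  show ?thesis
  proof (rule smap_cong[OF *])
    fix x assume "x \<in> points (mfd G)"
    then have x: "x \<in> carrier G" by (simp add: points_carrier)
    have "vector_derivative (\<lambda>t. \<phi> (x \<otimes> lexp G (t *\<^sub>R Y) \<otimes> inv x)) (at 0) = ?L (Ad G x Y)"
      using Ad_velocity[OF x, of Y] U x by (simp add: same_velocity_alt)
    then show "inv_into UNIV ?L (vector_derivative (\<lambda>t. \<phi> (x \<otimes> lexp G (t *\<^sub>R Y) \<otimes> inv x)) (at 0)) = Ad G x Y"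
      using inv_f_f[OF bij_is_inj[OF L(2)]] by simp
  qed
qed

lemma coAd_adjoint: "x \<in> carrier G \<Longrightarrow> Y \<bullet> coAd G x p = Ad G x Y \<bullet> p"
  unfolding coAd_def by (rule finite_dim_adjoint[OF finite_dim linear_Ad])

lemma coAd_eqI: "x \<in> carrier G \<Longrightarrow> (\<And>Y. Y \<bullet> q = Ad G x Y \<bullet> p) \<Longrightarrow> coAd G x p = q"
  using coAd_adjoint by (metis vector_eq_ldot)

lemma coAd_mult: "x \<in> carrier G \<Longrightarrow> y \<in> carrier G \<Longrightarrow> coAd G (x \<otimes> y) p = coAd G y (coAd G x p)"
  by (rule coAd_eqI) (simp_all add: coAd_adjoint Ad_mult)

lemma coAd_one: "coAd G \<one> p = p"
  by (rule coAd_eqI) (simp_all add: Ad_one)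

lemma coAd_add: "x \<in> carrier G \<Longrightarrow> coAd G x (p + q) = coAd G x p + coAd G x q"
  by (rule coAd_eqI) (simp_all add: coAd_adjoint inner_add_right)

lemma coAd_minus: "x \<in> carrier G \<Longrightarrow> coAd G x (- p) = - coAd G x p"
  by (rule coAd_eqI) (simp_all add: coAd_adjoint)

lemma coAd_inv:
  assumes "x \<in> carrier G"
  shows "coAd G (inv x) (coAd G x p) = p" "coAd G x (coAd G (inv x) p) = p"
  using coAd_mult[of x "inv x" p] coAd_mult[of "inv x" x p] assms by (simp_all add: coAd_one)

text \<open>
  In a frame the coadjoint action has the coefficients \<open>Ad x b \<bullet> p\<close>, which are smooth in \<open>x\<close> and \<open>p\<close>.
\<close>

lemma smap_coAd:
  assumes f: "smap M (mfd G) f" and p: "smap M vec_mfd p"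
  shows "smap M vec_mfd (\<lambda>x. coAd G (f x) (p x))"
proof -
  obtain B :: "'e set" where B: "parseval_frame B"
    using finite_dim_parseval_frame[OF finite_dim] .
  have *: "smap M vec_mfd (\<lambda>x. \<Sum>b\<in>B. (Ad G (f x) b \<bullet> p x) *\<^sub>R b)"
    by (intro smap_sum smap_source[OF f] finite_dim smap_bilinear[OF bounded_bilinear_scaleR finite_dim]
        smap_bilinear[OF bounded_bilinear_inner finite_dim_real] smap_compose[OF smap_Ad f] p
        smap_const smooth_manifold_vec) auto
  show ?thesis
  proof (rule smap_cong[OF *])
    fix x assume "x \<in> points M"
    then have "f x \<in> carrier G" using smap_points[OF f] points_carrier by auto
    then have "(\<Sum>b\<in>B. (Ad G (f x) b \<bullet> p x) *\<^sub>R b) = (\<Sum>b\<in>B. (coAd G (f x) (p x) \<bullet> b) *\<^sub>R b)"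
      by (intro sum.cong arg_cong2[where f=scaleR]) (simp_all add: inner_commute[of "coAd _ _ _"] coAd_adjoint)
    then show "(\<Sum>b\<in>B. (Ad G (f x) b \<bullet> p x) *\<^sub>R b) = coAd G (f x) (p x)"
      using B by (simp add: parseval_frame_def)
  qed
qed

end

section \<open>Lie subgroups\<close>

locale lie_subgroup_pair = G: exp_lie G + H: exp_lie H
  for G :: "('a, 'e::real_inner) exp_lie_group" and H :: "('a, 'f::real_inner) exp_lie_group" +
  assumes sub: "lie_subgroup H G"
begin

lemma subgroup: "subgroup (carrier H) G"
  and mult_eq: "x \<in> carrier H \<Longrightarrow> y \<in> carrier H \<Longrightarrow> x \<otimes>\<^bsub>H\<^esub> y = x \<otimes>\<^bsub>G\<^esub> y"
  using sub by (auto simp: lie_subgroup_def)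

lemma in_G: "x \<in> carrier H \<Longrightarrow> x \<in> carrier G"
  using subgroup subgroup.subset by blast

lemma one_eq: "\<one>\<^bsub>H\<^esub> = \<one>\<^bsub>G\<^esub>"
  by (metis G.l_cancel_one' H.one_closed H.r_one in_G mult_eq)

lemma inv_eq: "x \<in> carrier H \<Longrightarrow> inv\<^bsub>H\<^esub> x = inv\<^bsub>G\<^esub> x"
  by (metis G.inv_equality H.inv_closed H.l_inv in_G mult_eq one_eq)

lemma smap_incl: "smap (mfd H) (mfd G) (\<lambda>x. x)"
  using sub G.manifold H.manifold by (simp add: lie_subgroup_def immersion_def smap_def)

lemma smap_into_G: 
  shows "smap M (mfd H) f \<Longrightarrow> smap M (mfd G) f"
  using smap_compose[OF smap_incl] .

sublocale incl: lie_diff_map H G "\<lambda>x. x"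
  by unfold_locales (simp_all add: smap_incl one_eq)

lemma lie_incl_velocity:
  "same_velocity (mfd G) (\<lambda>t. lexp H (t *\<^sub>R Z)) (\<lambda>t. lexp G (t *\<^sub>R lie_incl H G Z))"
  unfolding lie_incl_def by (rule incl.lie_diff_velocity)

lemma linear_lie_incl: "linear (lie_incl H G)"
  unfolding lie_incl_def by (rule incl.linear_lie_diff)

text \<open>
  Replacing \<open>exp_G(t \<iota> Z)\<close> by \<open>exp_H(t Z)\<close> does not change velocities at the unit, and conjugation by
  \<open>h\<close> can be performed in either group.
\<close>

lemma Ad_lie_incl:
  assumes h: "h \<in> carrier H"
  shows "Ad G h (lie_incl H G Z) = lie_incl H G (Ad H h Z)"
proof (rule G.Ad_eqI[OF in_G[OF h]])
  note exp = smap_into_G[OF H.smap_exp]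
  have "same_velocity (mfd G) (\<lambda>t. h \<otimes>\<^bsub>G\<^esub> lexp G (t *\<^sub>R lie_incl H G Z) \<otimes>\<^bsub>G\<^esub> inv\<^bsub>G\<^esub> h)
      (\<lambda>t. h \<otimes>\<^bsub>G\<^esub> lexp H (t *\<^sub>R Z) \<otimes>\<^bsub>G\<^esub> inv\<^bsub>G\<^esub> h)"
    by (rule same_velocity_push_forward[OF same_velocity_sym[OF lie_incl_velocity] G.smap_exp exp G.smap_conj[OF in_G[OF h]]])
  also have "(\<lambda>t. h \<otimes>\<^bsub>G\<^esub> lexp H (t *\<^sub>R Z) \<otimes>\<^bsub>G\<^esub> inv\<^bsub>G\<^esub> h) = (\<lambda>t. h \<otimes>\<^bsub>H\<^esub> lexp H (t *\<^sub>R Z) \<otimes>\<^bsub>H\<^esub> inv\<^bsub>H\<^esub> h)"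
    using h by (simp flip: inv_eq mult_eq)
  finally have 1: "same_velocity (mfd G) (\<lambda>t. h \<otimes>\<^bsub>G\<^esub> lexp G (t *\<^sub>R lie_incl H G Z) \<otimes>\<^bsub>G\<^esub> inv\<^bsub>G\<^esub> h)
     (\<lambda>t. h \<otimes>\<^bsub>H\<^esub> lexp H (t *\<^sub>R Z) \<otimes>\<^bsub>H\<^esub> inv\<^bsub>H\<^esub> h)" .
  have 2: "same_velocity (mfd G) (\<lambda>t. h \<otimes>\<^bsub>H\<^esub> lexp H (t *\<^sub>R Z) \<otimes>\<^bsub>H\<^esub> inv\<^bsub>H\<^esub> h) (\<lambda>t. lexp H (t *\<^sub>R Ad H h Z))"
    by (rule same_velocity_push_forward[OF H.Ad_velocity[OF h] smap_compose[OF H.smap_conj[OF h] H.smap_exp]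
          H.smap_exp smap_incl])
  show "same_velocity (mfd G) (\<lambda>t. h \<otimes>\<^bsub>G\<^esub> lexp G (t *\<^sub>R lie_incl H G Z) \<otimes>\<^bsub>G\<^esub> inv\<^bsub>G\<^esub> h)
      (\<lambda>t. lexp G (t *\<^sub>R lie_incl H G (Ad H h Z)))"
    by (rule same_velocity_trans[OF 1 same_velocity_trans[OF 2 lie_incl_velocity]])
qed

lemma ad_lie_incl: "ad G (lie_incl H G Y) (lie_incl H G Z) = lie_incl H G (ad H Y Z)"
proof -
  have "ad G (lie_incl H G Y) (lie_incl H G Z) =
      vector_derivative (\<lambda>t. Ad G (lexp H (t *\<^sub>R Y)) (lie_incl H G Z)) (at 0)"
    unfolding ad_def
    by (rule same_velocity_vector_derivative[OF same_velocity_sym[OF lie_incl_velocity] G.smap_exp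
          smap_into_G[OF H.smap_exp] G.smap_Ad])
  also have "\<dots> = vector_derivative (\<lambda>t. lie_incl H G (Ad H (lexp H (t *\<^sub>R Y)) Z)) (at 0)"
    by (simp add: Ad_lie_incl)
  also have "\<dots> = lie_incl H G (ad H Y Z)"
  proof (rule vector_derivative_at)
    have "((\<lambda>t. Ad H (lexp H (t *\<^sub>R Y)) Z) has_vector_derivative ad H Y Z) (at 0)"
      unfolding ad_def
      by (rule smap_real_has_vector_derivative[OF smap_compose[OF H.smap_Ad H.smap_exp]])
    then show "((\<lambda>t. lie_incl H G (Ad H (lexp H (t *\<^sub>R Y)) Z)) has_vector_derivative lie_incl H G (ad H Y Z)) (at 0)"
      by (rule bounded_linear.has_vector_derivative[OF finite_dim_linear_imp_bounded_linear[OF H.finite_dim linear_lie_incl]])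
  qed
  finally show ?thesis .
qed

end

section \<open>The momentum morphism is equivariant\<close>

text \<open>
  The next lemmas show that a Poisson bracket does not change when constants are added to its
  arguments. As functions are total, equality of two functions holds only on the points of the
  manifold, and independence of the values elsewhere has to be derived from the Leibniz rule.
\<close>

context
  fixes M :: "('a, 'e::real_inner) manifold" and br
  assumes br: "poisson_bracket M br" and M: "smooth_manifold M"
begin

lemma smooth_fun_iff_smap: "smooth_fun M f \<longleftrightarrow> smap M vec_mfd f"
  using M smooth_manifold_real by (simp add: smooth_fun_def smap_def)

lemma poisson_bracket_smap: "smap M vec_mfd f \<Longrightarrow> smap M vec_mfd g \<Longrightarrow> smap M vec_mfd (br f g)"
  using br by (simp add: poisson_bracket_def smooth_fun_iff_smap)

lemma poisson_bracket_rules: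
  assumes "smap M vec_mfd f" "smap M vec_mfd g" "smap M vec_mfd h" "x \<in> points M"
  shows poisson_bracket_skew: "br f g x = - br g f x"
    and poisson_bracket_linear: "br (\<lambda>y. a * f y + b * g y) h x = a * br f h x + b * br g h x"
    and poisson_bracket_Leibniz: "br (\<lambda>y. f y * g y) h x = f x * br g h x + g x * br f h x"
  using br assms unfolding poisson_bracket_def smooth_fun_iff_smap by blast+

lemma poisson_bracket_cong_left:
  assumes f: "smap M vec_mfd f" and h: "smap M vec_mfd h" and x: "x \<in> points M"
    and eq: "\<And>y. y \<in> points M \<Longrightarrow> f y = f' y"
  shows "br f h x = br f' h x"
proof -
  have f': "smap M vec_mfd f'" by (rule smap_cong[OF f eq])
  \<comment> \<open>A function vanishing on the manifold equals its own product with this one, and both factors vanish there.\<close>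
  define outside where "outside = (\<lambda>y. if y \<in> points M then 0 else 1 :: real)"
  have 0: "smap M vec_mfd (\<lambda>_. 0 :: real)" by (intro smap_const M smooth_manifold_real) simp
  have outside: "smap M vec_mfd outside" by (rule smap_cong[OF 0]) (simp add: outside_def)
  have n: "smap M vec_mfd (\<lambda>y. 1 * f y + (-1) * f' y)" by (rule smap_cong[OF 0]) (simp add: eq)
  have "br (\<lambda>y. 1 * f y + (-1) * f' y) h x = 1 * br f h x + (-1) * br f' h x"
    by (rule poisson_bracket_linear[OF f f' h x])
  moreover have "(\<lambda>y. 1 * f y + (-1) * f' y) = (\<lambda>y. (1 * f y + (-1) * f' y) * outside y)"
    by (auto simp: outside_def eq)
  moreover have "br (\<lambda>y. (1 * f y + (-1) * f' y) * outside y) h x = 0"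
    using x by (subst poisson_bracket_Leibniz[OF n outside h x]) (simp add: outside_def eq)
  ultimately show ?thesis by simp
qed

lemma poisson_bracket_add_const_left:
  assumes f: "smap M vec_mfd f" and h: "smap M vec_mfd h" and x: "x \<in> points M"
    and eq: "\<And>y. y \<in> points M \<Longrightarrow> f' y = f y + c"
  shows "br f' h x = br f h x"
proof -
  have 1: "smap M vec_mfd (\<lambda>_. 1 :: real)" by (intro smap_const M smooth_manifold_real) simp
  have c: "smap M vec_mfd (\<lambda>y. 1 * f y + c * 1)"
    using smap_add[OF f smap_const[OF M smooth_manifold_real, of c]] by simp
  have "br (\<lambda>y. 1 * 1) h x = 0" using poisson_bracket_Leibniz[OF 1 1 h x] by simp
  moreover have "br (\<lambda>y. 1 * f y + c * 1) h x = 1 * br f h x + c * br (\<lambda>_. 1) h x"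
    by (rule poisson_bracket_linear[OF f 1 h x])
  moreover have "br (\<lambda>y. 1 * f y + c * 1) h x = br f' h x"
    by (rule poisson_bracket_cong_left[OF c h x]) (simp add: eq)
  ultimately show ?thesis by simp
qed

lemma poisson_bracket_add_const:
  assumes f: "smap M vec_mfd f" and g: "smap M vec_mfd g" and x: "x \<in> points M"
    and f': "\<And>y. y \<in> points M \<Longrightarrow> f' y = f y + c" and g': "\<And>y. y \<in> points M \<Longrightarrow> g' y = g y + d"
  shows "br f' g' x = br f g x"
proof -
  have sg: "smap M vec_mfd g'"
    by (rule smap_cong[OF smap_add[OF g smap_const[OF M smooth_manifold_real, of d]]]) (simp_all add: g')
  have "br f' g' x = br f g' x" by (rule poisson_bracket_add_const_left[OF f sg x f'])
  also have "\<dots> = - br g' f x" by (rule poisson_bracket_skew[OF f sg f x])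
  also have "br g' f x = br g f x" by (rule poisson_bracket_add_const_left[OF g f x g'])
  also have "- br g f x = br f g x" using poisson_bracket_skew[OF f g f x] by simp
  finally show ?thesis .
qed

end

text \<open>
  Here \<open>S\<close> is the dual Poisson Lie group, \<open>dp\<close> the right dressing action and \<open>I\<close> the morphism
  \<open>I* : G* \<rightarrow> \<hh>*\<close>.
\<close>

locale momentum_morphism = lie_subgroup_pair G H + S: exp_lie S
  for G :: "('a, 'g::real_inner) exp_lie_group" and H :: "('a, 'h::real_inner) exp_lie_group"
    and S :: "('d, 'g) exp_lie_group" +
  fixes br :: "('d \<Rightarrow> real) \<Rightarrow> ('d \<Rightarrow> real) \<Rightarrow> 'd \<Rightarrow> real" and dp :: "'a \<Rightarrow> 'd \<Rightarrow> 'd" and I :: "'d \<Rightarrow> 'h"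
  assumes H_connected: "connected_space (mtop (mfd H))" and S_connected: "connected_space (mtop (mfd S))"
    and poisson: "poisson_lie_group S br"
    and br_linearised: "\<And>\<phi> \<psi> A. smooth_fun (mfd S) \<phi> \<Longrightarrow> smooth_fun (mfd S) \<psi> \<Longrightarrow>
      deriv (\<lambda>t. br \<phi> \<psi> (lexp S (t *\<^sub>R A))) 0 = A \<bullet> ad G (left_diff S \<phi> \<one>\<^bsub>S\<^esub>) (left_diff S \<psi> \<one>\<^bsub>S\<^esub>)"
    and dressing: "right_dressing_action G S br dp"
    and I: "lie_hom S (vec_lie_group :: ('h, 'h) exp_lie_group) I"
    and I_diff: "lie_diff S (vec_lie_group :: ('h, 'h) exp_lie_group) I = adjoint (lie_incl H G)"
begin

lemma br: "poisson_bracket (mfd S) br" using poisson by (simp add: poisson_lie_group_def)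

lemmas smooth_fun_S = smooth_fun_iff_smap[OF br S.manifold]

lemma smap_I: "smap (mfd S) vec_mfd I"
  using I S.manifold smooth_manifold_vec[OF H.finite_dim] by (simp add: lie_hom_def vec_lie_group_def smap_def)

lemma I_mult: "u \<in> carrier S \<Longrightarrow> v \<in> carrier S \<Longrightarrow> I (u \<otimes>\<^bsub>S\<^esub> v) = I u + I v"
  using I by (simp add: lie_hom_def hom_def vec_lie_group_def)

lemma I_one: "I \<one>\<^bsub>S\<^esub> = 0"
  using I_mult[of "\<one>\<^bsub>S\<^esub>" "\<one>\<^bsub>S\<^esub>"] by simp

lemma adjoint_lie_incl: "Z \<bullet> adjoint (lie_incl H G) A = lie_incl H G Z \<bullet> A"
  by (rule finite_dim_adjoint[OF H.finite_dim linear_lie_incl])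

lemma I_exp_derivative:
  "((\<lambda>t. I (lexp S (t *\<^sub>R A))) has_vector_derivative adjoint (lie_incl H G) A) (at 0)"
proof -
  have vd: "vector_derivative (\<lambda>t. t *\<^sub>R W) (at 0) = W" for W :: 'h
    using has_vector_derivative_scaleR[of "\<lambda>t. t" 1 0 UNIV "\<lambda>_. W" 0]
    by (intro vector_derivative_at) (auto simp: has_vector_derivative_const)
  have "adjoint (lie_incl H G) A = (THE W. vector_derivative (\<lambda>t. I (lexp S (t *\<^sub>R A))) (at 0) = W)"
    unfolding I_diff[symmetric] lie_diff_def
    by (simp add: vec_lie_group_def same_velocity_vec_mfd I_one vd)
  then have "adjoint (lie_incl H G) A = vector_derivative (\<lambda>t. I (lexp S (t *\<^sub>R A))) (at 0)" by simp
  then show ?thesis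
    using smap_real_has_vector_derivative[OF smap_compose[OF smap_I S.smap_exp], of A 0] by simp
qed

lemma smap_inner_I: "smap (mfd S) vec_mfd (\<lambda>u. Z \<bullet> I u)"
  by (rule smap_bounded_linear[OF bounded_linear_inner_right finite_dim_real smap_I])

text \<open>
  As \<open>I\<close> is a homomorphism into a vector group, the left differential of \<open>\<langle>Z, I\<rangle>\<close> is the same at
  every point, namely its value \<open>\<iota> Z\<close> at the unit.
\<close>

lemma left_diff_inner_I:
  assumes u: "u \<in> carrier S"
  shows "left_diff S (\<lambda>u. Z \<bullet> I u) u = lie_incl H G Z"
proof -
  have "deriv (\<lambda>t. Z \<bullet> I (u \<otimes>\<^bsub>S\<^esub> lexp S (t *\<^sub>R Y))) 0 = lie_incl H G Z \<bullet> Y" for Y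
  proof (rule DERIV_imp_deriv)
    have "((\<lambda>t. Z \<bullet> I u + Z \<bullet> I (lexp S (t *\<^sub>R Y))) has_vector_derivative
        0 + Z \<bullet> adjoint (lie_incl H G) Y) (at 0)"
      by (intro has_vector_derivative_add has_vector_derivative_const
          bounded_linear.has_vector_derivative[OF bounded_linear_inner_right I_exp_derivative])
    then show "((\<lambda>t. Z \<bullet> I (u \<otimes>\<^bsub>S\<^esub> lexp S (t *\<^sub>R Y))) has_real_derivative lie_incl H G Z \<bullet> Y) (at 0)"
      using u by (simp add: I_mult inner_add_right adjoint_lie_incl has_real_derivative_iff_has_vector_derivative)
  qed
  then show ?thesis unfolding left_diff_def by (simp add: vector_eq_rdot)
qed

text \<open>
  Both sides are additive: the right hand side because \<open>I\<close> is, the left hand side because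
  multiplication is a Poisson map and translating \<open>\<langle>Z, I\<rangle>\<close> only adds a constant. Their
  differentials at the unit agree by the linearisation of the bracket, as \<open>\<iota>\<close> preserves brackets.
\<close>

lemma br_inner_I:
  assumes u: "u \<in> carrier S"
  shows "br (\<lambda>u. Z \<bullet> I u) (\<lambda>u. W \<bullet> I u) u = ad H Z W \<bullet> I u"
proof -
  let ?b = "br (\<lambda>u. Z \<bullet> I u) (\<lambda>u. W \<bullet> I u)"
  have smb: "smap (mfd S) vec_mfd ?b"
    by (intro poisson_bracket_smap[OF br S.manifold] smap_inner_I)
  have sm: "smap (mfd S) vec_mfd (\<lambda>u. ?b u + - (ad H Z W \<bullet> I u))"
    by (intro smap_add smap_uminus smb smap_inner_I)
  have add: "?b (u \<otimes>\<^bsub>S\<^esub> v) = ?b u + ?b v" if uv: "u \<in> carrier S" "v \<in> carrier S" for u v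
  proof -
    have "?b (u \<otimes>\<^bsub>S\<^esub> v) = br (\<lambda>z. Z \<bullet> I (z \<otimes>\<^bsub>S\<^esub> v)) (\<lambda>z. W \<bullet> I (z \<otimes>\<^bsub>S\<^esub> v)) u
        + br (\<lambda>z. Z \<bullet> I (u \<otimes>\<^bsub>S\<^esub> z)) (\<lambda>z. W \<bullet> I (u \<otimes>\<^bsub>S\<^esub> z)) v"
      using poisson smap_inner_I uv unfolding poisson_lie_group_def smooth_fun_S by blast
    also have "br (\<lambda>z. Z \<bullet> I (z \<otimes>\<^bsub>S\<^esub> v)) (\<lambda>z. W \<bullet> I (z \<otimes>\<^bsub>S\<^esub> v)) u = ?b u"
      using uv by (intro poisson_bracket_add_const[OF br S.manifold smap_inner_I smap_inner_I])
        (auto simp: S.points_carrier I_mult inner_add_right)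
    also have "br (\<lambda>z. Z \<bullet> I (u \<otimes>\<^bsub>S\<^esub> z)) (\<lambda>z. W \<bullet> I (u \<otimes>\<^bsub>S\<^esub> z)) v = ?b v"
      using uv by (intro poisson_bracket_add_const[OF br S.manifold smap_inner_I smap_inner_I])
        (auto simp: S.points_carrier I_mult inner_add_right)
    finally show ?thesis .
  qed
  have "?b u + - (ad H Z W \<bullet> I u) = 0"
  proof (rule S.additive_zero_if_derivative_zero[OF sm S_connected _ _ u])
    show "?b (u \<otimes>\<^bsub>S\<^esub> v) + - (ad H Z W \<bullet> I (u \<otimes>\<^bsub>S\<^esub> v)) =
        ?b u + - (ad H Z W \<bullet> I u) + (?b v + - (ad H Z W \<bullet> I v))"
      if "u \<in> carrier S" "v \<in> carrier S" for u v
      using that by (simp add: add I_mult inner_add_right)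
    fix A
    have "deriv (\<lambda>t. ?b (lexp S (t *\<^sub>R A))) 0 = A \<bullet> lie_incl H G (ad H Z W)"
      using br_linearised[of "\<lambda>u. Z \<bullet> I u" "\<lambda>u. W \<bullet> I u" A]
      by (simp add: smooth_fun_S smap_inner_I left_diff_inner_I ad_lie_incl)
    then have "((\<lambda>t. ?b (lexp S (t *\<^sub>R A))) has_vector_derivative A \<bullet> lie_incl H G (ad H Z W)) (at 0)"
      using smap_real_has_real_derivative[OF smap_compose[OF smb S.smap_exp], of A 0]
      by (simp add: has_real_derivative_iff_has_vector_derivative)
    moreover have "((\<lambda>t. ad H Z W \<bullet> I (lexp S (t *\<^sub>R A))) has_vector_derivative
        ad H Z W \<bullet> adjoint (lie_incl H G) A) (at 0)"
      by (intro bounded_linear.has_vector_derivative[OF bounded_linear_inner_right I_exp_derivative])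
    ultimately have "((\<lambda>t. ?b (lexp S (t *\<^sub>R A)) + - (ad H Z W \<bullet> I (lexp S (t *\<^sub>R A)))) has_vector_derivative
        A \<bullet> lie_incl H G (ad H Z W) + - (ad H Z W \<bullet> adjoint (lie_incl H G) A)) (at 0)"
      by (intro has_vector_derivative_add has_vector_derivative_minus)
    then show "vector_derivative (\<lambda>t. ?b (lexp S (t *\<^sub>R A)) + - (ad H Z W \<bullet> I (lexp S (t *\<^sub>R A)))) (at 0) = 0"
      by (simp add: adjoint_lie_incl inner_commute vector_derivative_at)
  qed
  then show ?thesis by simp
qed

lemma smap_dp: "smap (prod_mfd (mfd G) (mfd S)) (mfd S) (\<lambda>(x, u). dp x u)"
  using dressing G.manifold S.manifold
  by (simp add: right_dressing_action_def right_lie_action_def smap_def smooth_manifold_prod)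

lemma smap_dp_of:
  assumes "smap M (mfd G) f" "smap M (mfd S) g" shows "smap M (mfd S) (\<lambda>x. dp (f x) (g x))"
  using smap_compose[OF smap_dp smap_Pair[OF assms]] by simp

lemma dp_closed: "x \<in> carrier G \<Longrightarrow> u \<in> carrier S \<Longrightarrow> dp x u \<in> carrier S"
  using smap_points[OF smap_dp, of "(x, u)"] by (simp add: G.points_carrier S.points_carrier)

lemma dp_one: "u \<in> carrier S \<Longrightarrow> dp \<one>\<^bsub>G\<^esub> u = u"
  and dp_mult: "x \<in> carrier G \<Longrightarrow> y \<in> carrier G \<Longrightarrow> u \<in> carrier S \<Longrightarrow> dp (x \<otimes>\<^bsub>G\<^esub> y) u = dp y (dp x u)"
  using dressing by (auto simp: right_dressing_action_def right_lie_action_def S.points_carrier)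

text \<open>
  The generator of the dressing action at \<open>u\<close>, tested on \<open>\<langle>Z, I\<rangle>\<close>, is \<open>- {\<langle>Z, I\<rangle>, \<langle>W, I\<rangle>}\<close>
  because \<open>\<iota> W\<close> is the left differential of \<open>\<langle>W, I\<rangle>\<close>. Skew symmetry of the bracket turns the
  result of \<open>br_inner_I\<close> into \<open>[W, Z]\<close>.
\<close>

lemma I_dp_derivative:
  assumes u: "u \<in> carrier S"
  shows "vector_derivative (\<lambda>t. I (dp (lexp H (t *\<^sub>R W)) u)) (at 0) \<bullet> Z = I u \<bullet> ad H W Z"
proof -
  have sm: "smap (mfd G) vec_mfd (\<lambda>x. Z \<bullet> I (dp x u))"
    by (intro smap_compose[OF smap_inner_I] smap_dp_of G.smap_group_ident S.smap_group_const G.manifold u)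
  have c: "smap (vec_mfd :: (real, real) manifold) vec_mfd (\<lambda>t. I (dp (lexp H (t *\<^sub>R W)) u))"
    by (intro smap_compose[OF smap_I] smap_dp_of smap_into_G H.smap_exp S.smap_group_const smooth_manifold_real u)
  have "vector_derivative (\<lambda>t. I (dp (lexp H (t *\<^sub>R W)) u)) (at 0) \<bullet> Z
      = vector_derivative (\<lambda>t. Z \<bullet> I (dp (lexp H (t *\<^sub>R W)) u)) (at 0)"
    using bounded_linear.has_vector_derivative[OF bounded_linear_inner_right smap_real_has_vector_derivative[OF c, of 0], of Z]
    by (simp add: vector_derivative_at inner_commute)
  also have "\<dots> = vector_derivative (\<lambda>t. Z \<bullet> I (dp (lexp G (t *\<^sub>R lie_incl H G W)) u)) (at 0)"
    by (rule same_velocity_vector_derivative[OF lie_incl_velocity smap_into_G[OF H.smap_exp] G.smap_exp sm])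
  also have "\<dots> = deriv (\<lambda>t. Z \<bullet> I (dp (lexp G (t *\<^sub>R lie_incl H G W)) u)) 0"
    by (rule deriv_eq_vector_derivative[OF smap_compose[OF sm G.smap_exp], symmetric])
  also have "\<dots> = - br (\<lambda>u. Z \<bullet> I u) (\<lambda>u. W \<bullet> I u) u"
  proof -
    have "br (\<lambda>u. Z \<bullet> I u) (\<lambda>u. W \<bullet> I u) u
        = - deriv (\<lambda>t. Z \<bullet> I (dp (lexp G (t *\<^sub>R left_diff S (\<lambda>u. W \<bullet> I u) u)) u)) 0"
      using dressing u smap_inner_I[of Z] smap_inner_I[of W]
      unfolding right_dressing_action_def smooth_fun_S by blast
    then show ?thesis by (simp add: left_diff_inner_I[OF u])
  qed
  also have "\<dots> = br (\<lambda>u. W \<bullet> I u) (\<lambda>u. Z \<bullet> I u) u"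
    using poisson_bracket_skew[OF br S.manifold smap_inner_I smap_inner_I smap_inner_I, of u W Z] u
    by (simp add: S.points_carrier)
  also have "\<dots> = I u \<bullet> ad H W Z" using br_inner_I[OF u] by (simp add: inner_commute)
  finally show ?thesis .
qed

text \<open>
  The function \<open>k \<mapsto> \<langle>I (dp k u), Ad (k\<^sup>-\<^sup>1) Z\<rangle>\<close> on \<open>H\<close> is constant: along \<open>k exp(t W)\<close> the two
  contributions of the product rule are \<open>\<plusminus> \<langle>I (dp k u), [W, Ad (k\<^sup>-\<^sup>1) Z]\<rangle>\<close>.
\<close>

theorem I_equivariant:
  assumes h: "h \<in> carrier H" and u: "u \<in> carrier S"
  shows "I (dp h u) = coAd H h (I u)"
proof (rule H.coAd_eqI[OF h, symmetric])
  fix Y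
  let ?Z = "Ad H h Y"
  let ?\<Phi> = "\<lambda>k. I (dp k u) \<bullet> Ad H (inv\<^bsub>H\<^esub> k) ?Z"
  have "?\<Phi> h = ?\<Phi> \<one>\<^bsub>H\<^esub>"
  proof (rule H.constant_if_left_derivative_zero[OF _ H_connected _ h])
    show "smap (mfd H) vec_mfd ?\<Phi>"
      by (intro smap_bilinear[OF bounded_bilinear_inner finite_dim_real] smap_compose[OF smap_I]
          smap_compose[OF H.smap_Ad] smap_dp_of smap_incl S.smap_group_const H.smap_inv
          H.smap_group_ident H.manifold u)
    fix k W assume k: "k \<in> carrier H"
    let ?u = "dp k u" and ?V = "Ad H (inv\<^bsub>H\<^esub> k) ?Z"
    have u': "?u \<in> carrier S" using dp_closed in_G k u by simp
    have eq: "?\<Phi> (k \<otimes>\<^bsub>H\<^esub> lexp H (t *\<^sub>R W)) =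
        I (dp (lexp H (t *\<^sub>R W)) ?u) \<bullet> Ad H (lexp H ((- t) *\<^sub>R W)) ?V" for t
    proof -
      have "dp (k \<otimes>\<^bsub>H\<^esub> lexp H (t *\<^sub>R W)) u = dp (lexp H (t *\<^sub>R W)) ?u"
        using k u by (simp add: mult_eq dp_mult in_G)
      moreover have "inv\<^bsub>H\<^esub> (k \<otimes>\<^bsub>H\<^esub> lexp H (t *\<^sub>R W)) = lexp H ((- t) *\<^sub>R W) \<otimes>\<^bsub>H\<^esub> inv\<^bsub>H\<^esub> k"
        using k by (simp add: H.inv_mult_group H.exp_minus del: scaleR_minus_left)
      ultimately show ?thesis using k by (simp add: H.Ad_mult del: scaleR_minus_left)
    qed
    have 1: "((\<lambda>t. I (dp (lexp H (t *\<^sub>R W)) ?u)) has_vector_derivative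
        vector_derivative (\<lambda>t. I (dp (lexp H (t *\<^sub>R W)) ?u)) (at 0)) (at 0)"
      by (intro smap_real_has_vector_derivative smap_compose[OF smap_I] smap_dp_of smap_into_G H.smap_exp
          S.smap_group_const smooth_manifold_real u')
    have exp_W: "((\<lambda>t. Ad H (lexp H (t *\<^sub>R W)) ?V) has_vector_derivative ad H W ?V) (at (- 0))"
      using smap_real_has_vector_derivative[OF smap_compose[OF H.smap_Ad H.smap_exp]] unfolding ad_def by simp
    have 2: "((\<lambda>t. Ad H (lexp H ((- t) *\<^sub>R W)) ?V) has_vector_derivative - ad H W ?V) (at 0)"
      using vector_diff_chain_at[OF has_vector_derivative_minus[OF has_vector_derivative_id] exp_W]
      by (simp add: o_def)
    have "((\<lambda>t. I (dp (lexp H (t *\<^sub>R W)) ?u) \<bullet> Ad H (lexp H ((- t) *\<^sub>R W)) ?V) has_vector_derivative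
        I (dp (lexp H (0 *\<^sub>R W)) ?u) \<bullet> - ad H W ?V +
        vector_derivative (\<lambda>t. I (dp (lexp H (t *\<^sub>R W)) ?u)) (at 0) \<bullet> Ad H (lexp H ((- 0) *\<^sub>R W)) ?V) (at 0)"
      by (rule bounded_bilinear.has_vector_derivative[OF bounded_bilinear_inner 1 2])
    moreover have "I (dp (lexp H (0 *\<^sub>R W)) ?u) \<bullet> - ad H W ?V +
        vector_derivative (\<lambda>t. I (dp (lexp H (t *\<^sub>R W)) ?u)) (at 0) \<bullet> Ad H (lexp H ((- 0) *\<^sub>R W)) ?V = 0"
      using u' by (simp add: H.Ad_one I_dp_derivative[OF u'] one_eq[symmetric] dp_one[folded one_eq])
    ultimately show "vector_derivative (\<lambda>t. ?\<Phi> (k \<otimes>\<^bsub>H\<^esub> lexp H (t *\<^sub>R W))) (at 0) = 0"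
      unfolding eq by (simp only: vector_derivative_at)
  qed
  then show "Y \<bullet> I (dp h u) = Ad H h Y \<bullet> I u"
    using H.Ad_mult[of "inv\<^bsub>H\<^esub> h" h Y] h dp_one[OF u, folded one_eq]
    by (simp add: H.Ad_one inner_commute)
qed

end

section \<open>The Drinfeld double\<close>

text \<open>
  The purely algebraic part of a pair of dressing actions: in the double, \<open>u x = (dm u x) (dp x u)\<close>.
\<close>

locale dressed_groups = G: group G + S: group S
  for G :: "('a, 'e, 'y) lie_group_scheme" and S :: "('d, 'f, 'z) lie_group_scheme" +
  fixes dp :: "'a \<Rightarrow> 'd \<Rightarrow> 'd" and dm :: "'d \<Rightarrow> 'a \<Rightarrow> 'a"
  assumes dp_closed [simp]: "x \<in> carrier G \<Longrightarrow> u \<in> carrier S \<Longrightarrow> dp x u \<in> carrier S"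
    and dm_closed [simp]: "x \<in> carrier G \<Longrightarrow> u \<in> carrier S \<Longrightarrow> dm u x \<in> carrier G"
    and dp_one_left [simp]: "u \<in> carrier S \<Longrightarrow> dp \<one>\<^bsub>G\<^esub> u = u"
    and dm_one_left [simp]: "x \<in> carrier G \<Longrightarrow> dm \<one>\<^bsub>S\<^esub> x = x"
    and dp_act: "x \<in> carrier G \<Longrightarrow> y \<in> carrier G \<Longrightarrow> u \<in> carrier S \<Longrightarrow> dp (x \<otimes>\<^bsub>G\<^esub> y) u = dp y (dp x u)"
    and dm_act: "u \<in> carrier S \<Longrightarrow> v \<in> carrier S \<Longrightarrow> x \<in> carrier G \<Longrightarrow> dm (u \<otimes>\<^bsub>S\<^esub> v) x = dm u (dm v x)"
    and dp_twist: "x \<in> carrier G \<Longrightarrow> u \<in> carrier S \<Longrightarrow> v \<in> carrier S \<Longrightarrow>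
      dp x (u \<otimes>\<^bsub>S\<^esub> v) = dp (dm v x) u \<otimes>\<^bsub>S\<^esub> dp x v"
    and dm_twist: "u \<in> carrier S \<Longrightarrow> x \<in> carrier G \<Longrightarrow> y \<in> carrier G \<Longrightarrow>
      dm u (x \<otimes>\<^bsub>G\<^esub> y) = dm u x \<otimes>\<^bsub>G\<^esub> dm (dp x u) y"
begin

abbreviation double where "double \<equiv> drinfeld_double G S dp dm"

lemma dp_one_right [simp]: "x \<in> carrier G \<Longrightarrow> dp x \<one>\<^bsub>S\<^esub> = \<one>\<^bsub>S\<^esub>"
  using dp_twist[of x "\<one>\<^bsub>S\<^esub>" "\<one>\<^bsub>S\<^esub>"] S.l_cancel_one'[of "dp x \<one>\<^bsub>S\<^esub>" "dp x \<one>\<^bsub>S\<^esub>"] by simp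

lemma dm_one_right [simp]: "u \<in> carrier S \<Longrightarrow> dm u \<one>\<^bsub>G\<^esub> = \<one>\<^bsub>G\<^esub>"
  using dm_twist[of u "\<one>\<^bsub>G\<^esub>" "\<one>\<^bsub>G\<^esub>"] G.l_cancel_one'[of "dm u \<one>\<^bsub>G\<^esub>" "dm u \<one>\<^bsub>G\<^esub>"] by simp

lemma dp_inv:
  assumes "x \<in> carrier G" "u \<in> carrier S"
  shows "dp (dm u x) (inv\<^bsub>S\<^esub> u) = inv\<^bsub>S\<^esub> (dp x u)"
proof -
  have "dp (dm u x) (inv\<^bsub>S\<^esub> u) \<otimes>\<^bsub>S\<^esub> dp x u = \<one>\<^bsub>S\<^esub>"
    using dp_twist[of x "inv\<^bsub>S\<^esub> u" u] assms by simp
  from S.inv_equality[OF this] show ?thesis using assms by simp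
qed

lemma dm_inv:
  assumes "x \<in> carrier G" "u \<in> carrier S"
  shows "dm (dp x u) (inv\<^bsub>G\<^esub> x) = inv\<^bsub>G\<^esub> (dm u x)"
proof -
  have "dm u x \<otimes>\<^bsub>G\<^esub> dm (dp x u) (inv\<^bsub>G\<^esub> x) = \<one>\<^bsub>G\<^esub>"
    using dm_twist[of u x "inv\<^bsub>G\<^esub> x"] assms by simp
  from G.inv_equality[OF G.inv_comm[OF this]] show ?thesis using assms by simp
qed

text \<open>
  The factors in the opposite order: \<open>g u = (swap_right g u) (swap_left g u)\<close> in the double. The pair
  \<open>(g, u)\<close> of the double stands for the product \<open>u g\<close>.
\<close>

definition swap_left :: "'a \<Rightarrow> 'd \<Rightarrow> 'a" where "swap_left g u = inv\<^bsub>G\<^esub> (dm (inv\<^bsub>S\<^esub> u) (inv\<^bsub>G\<^esub> g))"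
definition swap_right :: "'a \<Rightarrow> 'd \<Rightarrow> 'd" where "swap_right g u = inv\<^bsub>S\<^esub> (dp (inv\<^bsub>G\<^esub> g) (inv\<^bsub>S\<^esub> u))"

lemma swap_closed [simp]:
  "g \<in> carrier G \<Longrightarrow> u \<in> carrier S \<Longrightarrow> swap_left g u \<in> carrier G"
  "g \<in> carrier G \<Longrightarrow> u \<in> carrier S \<Longrightarrow> swap_right g u \<in> carrier S"
  by (simp_all add: swap_left_def swap_right_def)

lemma swap_one [simp]:
  "u \<in> carrier S \<Longrightarrow> swap_left \<one>\<^bsub>G\<^esub> u = \<one>\<^bsub>G\<^esub>" "u \<in> carrier S \<Longrightarrow> swap_right \<one>\<^bsub>G\<^esub> u = u"
  "g \<in> carrier G \<Longrightarrow> swap_left g \<one>\<^bsub>S\<^esub> = g" "g \<in> carrier G \<Longrightarrow> swap_right g \<one>\<^bsub>S\<^esub> = \<one>\<^bsub>S\<^esub>"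
  by (simp_all add: swap_left_def swap_right_def)

text \<open>
  The two ways of exchanging factors, \<open>w x = (dm w x) (dp x w)\<close> and \<open>g u = (swap_right g u) (swap_left g u)\<close>,
  are inverse to each other.
\<close>

lemma swap_dressing:
  assumes "x \<in> carrier G" "w \<in> carrier S"
  shows "swap_left (dm w x) (dp x w) = x" "swap_right (dm w x) (dp x w) = w"
proof -
  have "dm (inv\<^bsub>S\<^esub> (dp x w)) (inv\<^bsub>G\<^esub> (dm w x)) = inv\<^bsub>G\<^esub> x"
    using dm_act[of "inv\<^bsub>S\<^esub> (dp x w)" "dp x w" "inv\<^bsub>G\<^esub> x"] assms by (simp add: dm_inv)
  then show "swap_left (dm w x) (dp x w) = x" using assms by (simp add: swap_left_def)
  have "dp (inv\<^bsub>G\<^esub> (dm w x)) (inv\<^bsub>S\<^esub> (dp x w)) = inv\<^bsub>S\<^esub> w"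
    using dp_act[of "dm w x" "inv\<^bsub>G\<^esub> (dm w x)" "inv\<^bsub>S\<^esub> w"] assms by (simp add: dp_inv)
  then show "swap_right (dm w x) (dp x w) = w" using assms by (simp add: swap_right_def)
qed

lemma dressing_swap:
  assumes "g \<in> carrier G" "u \<in> carrier S"
  shows "dm (swap_right g u) (swap_left g u) = g" "dp (swap_left g u) (swap_right g u) = u"
proof -
  let ?a = "inv\<^bsub>G\<^esub> g" and ?v = "inv\<^bsub>S\<^esub> u"
  have l: "swap_left g u = dm (dp ?a ?v) g" using dm_inv[of ?a ?v] assms by (simp add: swap_left_def)
  have r: "swap_right g u = dp (dm ?v ?a) u" using dp_inv[of ?a ?v] assms by (simp add: swap_right_def)
  show "dm (swap_right g u) (swap_left g u) = g"
    unfolding l using dm_act[of "swap_right g u" "dp ?a ?v" g] assms by (simp add: swap_right_def)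
  show "dp (swap_left g u) (swap_right g u) = u"
    unfolding r using dp_act[of "dm ?v ?a" "swap_left g u" u] assms by (simp add: swap_left_def)
qed

lemma double_simps [simp]:
  "carrier double = carrier G \<times> carrier S" "\<one>\<^bsub>double\<^esub> = (\<one>\<^bsub>G\<^esub>, \<one>\<^bsub>S\<^esub>)"
  "mfd double = prod_mfd (mfd G) (mfd S)"
  by (simp_all add: drinfeld_double_def)

lemma double_mult: "(g1, u1) \<otimes>\<^bsub>double\<^esub> (g2, u2) = (swap_left g1 u2 \<otimes>\<^bsub>G\<^esub> g2, u1 \<otimes>\<^bsub>S\<^esub> swap_right g1 u2)"
  by (simp add: drinfeld_double_def swap_left_def swap_right_def)

text \<open>
  The inverse of \<open>u g\<close> is \<open>g\<^sup>-\<^sup>1 u\<^sup>-\<^sup>1\<close>, brought back into the order of the double by the dressing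
  actions.
\<close>

lemma double_inv_mult:
  assumes "g \<in> carrier G" "u \<in> carrier S"
  shows "(inv\<^bsub>G\<^esub> (dm u g), inv\<^bsub>S\<^esub> (dp g u)) \<otimes>\<^bsub>double\<^esub> (g, u) = (\<one>\<^bsub>G\<^esub>, \<one>\<^bsub>S\<^esub>)"
proof -
  have "swap_left (inv\<^bsub>G\<^esub> (dm u g)) u = inv\<^bsub>G\<^esub> g"
    using dm_act[of "inv\<^bsub>S\<^esub> u" u g] assms by (simp add: swap_left_def)
  moreover have "swap_right (inv\<^bsub>G\<^esub> (dm u g)) u = dp g u"
    using assms by (simp add: swap_right_def dp_inv)
  ultimately show ?thesis using assms by (simp add: double_mult)
qed

text \<open>
  Associativity amounts to the two twisted multiplicativity laws, which say that moving \<open>u\<close> past \<open>x y\<close>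
  can be done in two steps, and moving \<open>u v\<close> past \<open>x\<close> likewise.
\<close>

lemma group_double: "group double"
proof (rule groupI)
  fix x y assume "x \<in> carrier double" "y \<in> carrier double"
  then show "x \<otimes>\<^bsub>double\<^esub> y \<in> carrier double" by (cases x; cases y) (auto simp: double_mult)
next
  fix x assume "x \<in> carrier double"
  then show "\<one>\<^bsub>double\<^esub> \<otimes>\<^bsub>double\<^esub> x = x" by (cases x) (simp add: double_mult)
next
  fix x assume "x \<in> carrier double"
  then obtain g u where "x = (g, u)" "g \<in> carrier G" "u \<in> carrier S" by auto
  then show "\<exists>y\<in>carrier double. y \<otimes>\<^bsub>double\<^esub> x = \<one>\<^bsub>double\<^esub>"
    using double_inv_mult by (intro bexI[of _ "(inv\<^bsub>G\<^esub> (dm u g), inv\<^bsub>S\<^esub> (dp g u))"]) auto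
next
  fix x y z assume "x \<in> carrier double" "y \<in> carrier double" "z \<in> carrier double"
  then obtain g1 u1 g2 u2 g3 u3 where xyz: "x = (g1, u1)" "y = (g2, u2)" "z = (g3, u3)"
    and [simp]: "g1 \<in> carrier G" "u1 \<in> carrier S" "g2 \<in> carrier G" "u2 \<in> carrier S"
      "g3 \<in> carrier G" "u3 \<in> carrier S" by auto
  let ?a1 = "inv\<^bsub>G\<^esub> g1" and ?a2 = "inv\<^bsub>G\<^esub> g2" and ?v2 = "inv\<^bsub>S\<^esub> u2" and ?v3 = "inv\<^bsub>S\<^esub> u3"
  have "swap_left (swap_left g1 u2 \<otimes>\<^bsub>G\<^esub> g2) u3 = inv\<^bsub>G\<^esub> (dm ?v3 ?a2 \<otimes>\<^bsub>G\<^esub> dm (dp ?a2 ?v3) (dm ?v2 ?a1))"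
    by (simp add: swap_left_def G.inv_mult_group dm_twist)
  also have "\<dots> = swap_left g1 (u2 \<otimes>\<^bsub>S\<^esub> swap_right g2 u3) \<otimes>\<^bsub>G\<^esub> swap_left g2 u3"
    by (simp add: swap_left_def swap_right_def S.inv_mult_group G.inv_mult_group dm_act)
  finally have 1: "swap_left (swap_left g1 u2 \<otimes>\<^bsub>G\<^esub> g2) u3 =
      swap_left g1 (u2 \<otimes>\<^bsub>S\<^esub> swap_right g2 u3) \<otimes>\<^bsub>G\<^esub> swap_left g2 u3" .
  have "swap_right g1 (u2 \<otimes>\<^bsub>S\<^esub> swap_right g2 u3) = inv\<^bsub>S\<^esub> (dp (dm ?v2 ?a1) (dp ?a2 ?v3) \<otimes>\<^bsub>S\<^esub> dp ?a1 ?v2)"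
    by (simp add: swap_right_def S.inv_mult_group dp_twist)
  also have "\<dots> = swap_right g1 u2 \<otimes>\<^bsub>S\<^esub> swap_right (swap_left g1 u2 \<otimes>\<^bsub>G\<^esub> g2) u3"
    by (simp add: swap_left_def swap_right_def S.inv_mult_group G.inv_mult_group dp_act)
  finally have 2: "swap_right g1 (u2 \<otimes>\<^bsub>S\<^esub> swap_right g2 u3) =
      swap_right g1 u2 \<otimes>\<^bsub>S\<^esub> swap_right (swap_left g1 u2 \<otimes>\<^bsub>G\<^esub> g2) u3" .
  show "x \<otimes>\<^bsub>double\<^esub> y \<otimes>\<^bsub>double\<^esub> z = x \<otimes>\<^bsub>double\<^esub> (y \<otimes>\<^bsub>double\<^esub> z)"
    unfolding xyz double_mult 1 2 by (simp add: G.m_assoc S.m_assoc)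
qed simp

lemma double_inv: "g \<in> carrier G \<Longrightarrow> u \<in> carrier S \<Longrightarrow> inv\<^bsub>double\<^esub> (g, u) = (inv\<^bsub>G\<^esub> (dm u g), inv\<^bsub>S\<^esub> (dp g u))"
  using group.inv_equality[OF group_double, of "(inv\<^bsub>G\<^esub> (dm u g), inv\<^bsub>S\<^esub> (dp g u))" "(g, u)"]
  by (simp add: double_inv_mult)

end

section \<open>Products of Lie groups\<close>

lemma is_lie_groupI:
  fixes K :: "('a, 'e::real_inner, 'z) lie_group_scheme"
  assumes "group K" "smooth_manifold (mfd K)" "points (mfd K) = carrier K"
    and "smap (prod_mfd (mfd K) (mfd K)) (mfd K) (\<lambda>z. fst z \<otimes>\<^bsub>K\<^esub> snd z)"
    and "smap (mfd K) (mfd K) (\<lambda>x. inv\<^bsub>K\<^esub> x)"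
  shows "is_lie_group K"
  using assms by (simp add: is_lie_group_def smap_def case_prod_unfold)

lemma prod_lie_group_simps [simp]:
  "carrier (prod_lie_group G K) = carrier G \<times> carrier K"
  "\<one>\<^bsub>prod_lie_group G K\<^esub> = (\<one>\<^bsub>G\<^esub>, \<one>\<^bsub>K\<^esub>)"
  "mfd (prod_lie_group G K) = prod_mfd (mfd G) (mfd K)"
  "x \<otimes>\<^bsub>prod_lie_group G K\<^esub> y = (fst x \<otimes>\<^bsub>G\<^esub> fst y, snd x \<otimes>\<^bsub>K\<^esub> snd y)"
  by (simp_all add: prod_lie_group_def case_prod_unfold)

lemma is_lie_group_prod:
  fixes G :: "('a, 'e::real_inner, 'y) lie_group_scheme" and K :: "('b, 'f::real_inner, 'z) lie_group_scheme"
  assumes G: "is_lie_group G" and K: "is_lie_group K"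
  shows "is_lie_group (prod_lie_group G K)"
proof -
  let ?P = "prod_lie_group G K"
  interpret G: group G by (rule lie_group_group[OF G])
  interpret K: group K by (rule lie_group_group[OF K])
  note M = lie_group_manifold[OF G] lie_group_manifold[OF K]
  have grp: "group ?P"
  proof (rule groupI)
    fix x assume "x \<in> carrier ?P"
    then show "\<exists>y\<in>carrier ?P. y \<otimes>\<^bsub>?P\<^esub> x = \<one>\<^bsub>?P\<^esub>"
      by (intro bexI[of _ "(inv\<^bsub>G\<^esub> (fst x), inv\<^bsub>K\<^esub> (snd x))"]) auto
  qed (auto simp: G.m_assoc K.m_assoc)
  have inv: "inv\<^bsub>?P\<^esub> x = (inv\<^bsub>G\<^esub> (fst x), inv\<^bsub>K\<^esub> (snd x))" if "x \<in> carrier ?P" for x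
    using that by (intro group.inv_equality[OF grp]) auto
  show ?thesis
  proof (rule is_lie_groupI[OF grp])
    show "smooth_manifold (mfd ?P)" using M by (simp add: smooth_manifold_prod)
    show "points (mfd ?P) = carrier ?P" using lie_group_points[OF G] lie_group_points[OF K] by simp
    show "smap (prod_mfd (mfd ?P) (mfd ?P)) (mfd ?P) (\<lambda>z. fst z \<otimes>\<^bsub>?P\<^esub> snd z)"
      unfolding prod_lie_group_simps
      by (intro smap_Pair smap_lie_mult[OF G] smap_lie_mult[OF K]
          smap_fst_of[OF smap_fst] smap_fst_of[OF smap_snd] smap_snd_of[OF smap_fst] smap_snd_of[OF smap_snd]
          smooth_manifold_prod M)
    have "smap (mfd ?P) (mfd ?P) (\<lambda>x. (inv\<^bsub>G\<^esub> (fst x), inv\<^bsub>K\<^esub> (snd x)))"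
      unfolding prod_lie_group_simps
      by (intro smap_Pair smap_lie_inv[OF G] smap_lie_inv[OF K] smap_fst smap_snd M)
    then show "smap (mfd ?P) (mfd ?P) (\<lambda>x. inv\<^bsub>?P\<^esub> x)"
      by (rule smap_cong) (use inv lie_group_points[OF G] lie_group_points[OF K] in auto)
  qed
qed

section \<open>Lie groupoids\<close>

text \<open>
  All groupoids below have a multiplication given by a formula that is smooth on all pairs of
  arrows, composable or not; this avoids local extensions off the set of composable pairs.
\<close>

lemma lie_groupoidI:
  fixes \<Gamma> :: "('a, 'b, 'e::real_inner, 'f::real_inner) groupoid"
  assumes "submersion (arrows \<Gamma>) (gbase \<Gamma>) (gtarget \<Gamma>)" "submersion (arrows \<Gamma>) (gbase \<Gamma>) (gsource \<Gamma>)"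
    and "smap (gbase \<Gamma>) (arrows \<Gamma>) (gunit \<Gamma>)"
    and comp: "smap (prod_mfd (arrows \<Gamma>) (arrows \<Gamma>)) (arrows \<Gamma>) (\<lambda>z. gcomp \<Gamma> (fst z) (snd z))"
    and "\<And>b. b \<in> points (gbase \<Gamma>) \<Longrightarrow> gtarget \<Gamma> (gunit \<Gamma> b) = b \<and> gsource \<Gamma> (gunit \<Gamma> b) = b"
    and ts: "\<And>x y. (x, y) \<in> composable \<Gamma> \<Longrightarrow>
        gtarget \<Gamma> (gcomp \<Gamma> x y) = gtarget \<Gamma> x \<and> gsource \<Gamma> (gcomp \<Gamma> x y) = gsource \<Gamma> y"
    and "\<And>x y z. (x, y) \<in> composable \<Gamma> \<Longrightarrow> (y, z) \<in> composable \<Gamma> \<Longrightarrow>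
        gcomp \<Gamma> (gcomp \<Gamma> x y) z = gcomp \<Gamma> x (gcomp \<Gamma> y z)"
    and "\<And>x. x \<in> arrs \<Gamma> \<Longrightarrow> gcomp \<Gamma> (gunit \<Gamma> (gtarget \<Gamma> x)) x = x \<and> gcomp \<Gamma> x (gunit \<Gamma> (gsource \<Gamma> x)) = x"
    and "smap (arrows \<Gamma>) (arrows \<Gamma>) i"
    and "\<And>x. x \<in> arrs \<Gamma> \<Longrightarrow> gtarget \<Gamma> (i x) = gsource \<Gamma> x \<and> gsource \<Gamma> (i x) = gtarget \<Gamma> x \<and>
        gcomp \<Gamma> x (i x) = gunit \<Gamma> (gtarget \<Gamma> x) \<and> gcomp \<Gamma> (i x) x = gunit \<Gamma> (gsource \<Gamma> x)"
  shows "lie_groupoid \<Gamma>"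
proof -
  have "smooth_map_on (prod_mfd (arrows \<Gamma>) (arrows \<Gamma>)) (composable \<Gamma>) (arrows \<Gamma>) (\<lambda>(x, y). gcomp \<Gamma> x y)"
    unfolding case_prod_unfold by (rule smooth_map_on_if_smap[OF comp]) (auto simp: composable_def)
  moreover have "\<forall>(x, y)\<in>composable \<Gamma>. gcomp \<Gamma> x y \<in> arrs \<Gamma> \<and>
        gtarget \<Gamma> (gcomp \<Gamma> x y) = gtarget \<Gamma> x \<and> gsource \<Gamma> (gcomp \<Gamma> x y) = gsource \<Gamma> y"
    using ts smap_points[OF comp] by (force simp: composable_def)
  ultimately show ?thesis unfolding lie_groupoid_def using assms(1-3,5-)
    by (intro conjI exI[of _ i]) (auto simp: smap_def)
qed

lemma submersion_compose_diffeo: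
  fixes L :: "('l, 'k::real_inner) manifold"
    and M :: "('a, 'e::real_inner) manifold" and N :: "('b, 'f::real_inner) manifold"
  assumes f: "submersion M N f" and N: "smooth_manifold N" and F: "smap L M F" and E: "smap M L E"
    and EF: "\<And>x. x \<in> points L \<Longrightarrow> E (F x) = x" and FE: "\<And>y. y \<in> points M \<Longrightarrow> F (E y) = y"
  shows "submersion L N (\<lambda>x. f (F x))"
proof -
  have f': "smap M N f" using f N smap_target[OF F] by (simp add: submersion_def smap_def)
  have "surj (frechet_derivative (\<psi> \<circ> (\<lambda>x. f (F x)) \<circ> inv_into U \<phi>) (at (\<phi> x)))"
    if c: "(U, \<phi>) \<in> atlas L" "(V, \<psi>) \<in> atlas N" "x \<in> U" "f (F x) \<in> V" for U \<phi> V \<psi> x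
  proof -
    have x: "x \<in> points L" using chart_subset[OF smap_source[OF F] c(1)] c by auto
    obtain W \<theta> where d: "(W, \<theta>) \<in> atlas M" "F x \<in> W" using chart_at[OF smap_target[OF F] smap_points[OF F x]] .
    let ?A = "frechet_derivative (\<theta> \<circ> F \<circ> inv_into U \<phi>) (at (\<phi> x))"
    let ?B = "frechet_derivative (\<psi> \<circ> f \<circ> inv_into W \<theta>) (at (\<theta> (F x)))"
    have "((\<lambda>a. \<psi> (f (F (inv_into U \<phi> a)))) has_derivative ?B \<circ> ?A) (at (\<phi> x))"
      by (rule chart_derivative_compose[OF F f' c(1,3) d c(2,4)])
    then have "frechet_derivative (\<psi> \<circ> (\<lambda>x. f (F x)) \<circ> inv_into U \<phi>) (at (\<phi> x)) = ?B \<circ> ?A"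
      by (simp add: o_def frechet_derivative_at[symmetric])
    moreover have "surj ?A"
    proof (rule surjI)
      show "?A (frechet_derivative (\<phi> \<circ> E \<circ> inv_into W \<theta>) (at (\<theta> (F x))) v) = v" for v
        using chart_derivative_left_inverse[OF E F FE d c(1)] EF[OF x] c(3) by simp
    qed
    moreover have "surj ?B" using f c(2,4) d unfolding submersion_def by fast
    ultimately show ?thesis by (simp only: comp_surj)
  qed
  then show ?thesis unfolding submersion_def
    using smap_smooth_map[OF smap_compose[OF f' F]] by blast
qed

text \<open>
  The groupoid structure on \<open>N\<close> for which the bijection \<open>F\<close>, with inverse \<open>E\<close>, becomes an isomorphism
  over the identity of the base.
\<close>

definition transported_groupoid ::
  "('c, 'e) manifold \<Rightarrow> ('c \<Rightarrow> 'a) \<Rightarrow> ('a \<Rightarrow> 'c) \<Rightarrow> ('a, 'b, 'e, 'f) groupoid \<Rightarrow> ('c, 'b, 'e, 'f) groupoid" where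
  "transported_groupoid N F E \<Gamma> = \<lparr>arrows = N, gbase = gbase \<Gamma>,
     gtarget = (\<lambda>x. gtarget \<Gamma> (F x)), gsource = (\<lambda>x. gsource \<Gamma> (F x)), gunit = (\<lambda>b. E (gunit \<Gamma> b)),
     gcomp = (\<lambda>x y. E (gcomp \<Gamma> (F x) (F y)))\<rparr>"

lemma transported_groupoid_simps:
  "arrows (transported_groupoid N F E \<Gamma>) = N" "gbase (transported_groupoid N F E \<Gamma>) = gbase \<Gamma>"
  "gtarget (transported_groupoid N F E \<Gamma>) x = gtarget \<Gamma> (F x)"
  "gsource (transported_groupoid N F E \<Gamma>) x = gsource \<Gamma> (F x)"
  "gunit (transported_groupoid N F E \<Gamma>) b = E (gunit \<Gamma> b)"
  "gcomp (transported_groupoid N F E \<Gamma>) x y = E (gcomp \<Gamma> (F x) (F y))"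
  by (simp_all add: transported_groupoid_def)

lemma lie_groupoid_transported:
  fixes \<Gamma> :: "('a, 'b, 'e::real_inner, 'f::real_inner) groupoid"
  assumes \<Gamma>: "lie_groupoid \<Gamma>"
    and comp: "smap (prod_mfd (arrows \<Gamma>) (arrows \<Gamma>)) (arrows \<Gamma>) (\<lambda>z. gcomp \<Gamma> (fst z) (snd z))"
    and F: "smap N (arrows \<Gamma>) F" and E: "smap (arrows \<Gamma>) N E"
    and EF: "\<And>x. x \<in> points N \<Longrightarrow> E (F x) = x" and FE: "\<And>y. y \<in> arrs \<Gamma> \<Longrightarrow> F (E y) = y"
  shows "lie_groupoid (transported_groupoid N F E \<Gamma>)" (is "lie_groupoid ?T")
    and "groupoid_iso (transported_groupoid N F E \<Gamma>) \<Gamma>"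
proof -
  note sel [simp] = transported_groupoid_simps[of N F E \<Gamma>]
  have Fp: "F x \<in> arrs \<Gamma>" if "x \<in> points N" for x using smap_points[OF F that] .
  have unit: "smap (gbase \<Gamma>) (arrows \<Gamma>) (gunit \<Gamma>)" using \<Gamma> by (simp add: lie_groupoid_def smap_def)
  have cF: "(F x, F y) \<in> composable \<Gamma>" if "(x, y) \<in> composable ?T" for x y
    using that Fp by (simp add: composable_def)
  have cc: "gcomp \<Gamma> x y \<in> arrs \<Gamma>" "gtarget \<Gamma> (gcomp \<Gamma> x y) = gtarget \<Gamma> x" "gsource \<Gamma> (gcomp \<Gamma> x y) = gsource \<Gamma> y"
    if "(x, y) \<in> composable \<Gamma>" for x y
    using \<Gamma> that unfolding lie_groupoid_def by fast+
  have uu: "gunit \<Gamma> b \<in> arrs \<Gamma>" "gtarget \<Gamma> (gunit \<Gamma> b) = b" "gsource \<Gamma> (gunit \<Gamma> b) = b"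
    if "b \<in> points (gbase \<Gamma>)" for b
    using \<Gamma> that smap_points[OF unit] unfolding lie_groupoid_def by blast+
  have "smap (arrows \<Gamma>) (gbase \<Gamma>) (gtarget \<Gamma>)" "smap (arrows \<Gamma>) (gbase \<Gamma>) (gsource \<Gamma>)"
    using \<Gamma> by (simp_all add: lie_groupoid_def submersion_def smap_def)
  then have ts: "gtarget \<Gamma> x \<in> points (gbase \<Gamma>)" "gsource \<Gamma> x \<in> points (gbase \<Gamma>)" if "x \<in> arrs \<Gamma>" for x
    using that smap_points by fast+
  have ua: "gcomp \<Gamma> (gunit \<Gamma> (gtarget \<Gamma> x)) x = x" "gcomp \<Gamma> x (gunit \<Gamma> (gsource \<Gamma> x)) = x"
    if "x \<in> arrs \<Gamma>" for x using \<Gamma> that unfolding lie_groupoid_def by blast+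
  have as: "gcomp \<Gamma> (gcomp \<Gamma> x y) z = gcomp \<Gamma> x (gcomp \<Gamma> y z)"
    if "(x, y) \<in> composable \<Gamma>" "(y, z) \<in> composable \<Gamma>" for x y z
    using \<Gamma> that unfolding lie_groupoid_def by blast
  have "\<exists>i. smooth_map (arrows \<Gamma>) (arrows \<Gamma>) i \<and> (\<forall>x\<in>arrs \<Gamma>. gtarget \<Gamma> (i x) = gsource \<Gamma> x \<and> gsource \<Gamma> (i x) = gtarget \<Gamma> x \<and>
        gcomp \<Gamma> x (i x) = gunit \<Gamma> (gtarget \<Gamma> x) \<and> gcomp \<Gamma> (i x) x = gunit \<Gamma> (gsource \<Gamma> x))"
    using \<Gamma> unfolding lie_groupoid_def by blast
  then obtain i where i: "smap (arrows \<Gamma>) (arrows \<Gamma>) i"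
    and ii: "\<And>x. x \<in> arrs \<Gamma> \<Longrightarrow> gtarget \<Gamma> (i x) = gsource \<Gamma> x \<and> gsource \<Gamma> (i x) = gtarget \<Gamma> x \<and>
        gcomp \<Gamma> x (i x) = gunit \<Gamma> (gtarget \<Gamma> x) \<and> gcomp \<Gamma> (i x) x = gunit \<Gamma> (gsource \<Gamma> x)"
    using smap_source[OF comp] smap_target[OF comp] unfolding smap_def by blast
  have B: "smooth_manifold (gbase \<Gamma>)" using \<Gamma> by (simp add: lie_groupoid_def)
  show T: "lie_groupoid ?T"
  proof (rule lie_groupoidI[where i = "\<lambda>x. E (i (F x))"])
    show "submersion (arrows ?T) (gbase ?T) (gtarget ?T)" "submersion (arrows ?T) (gbase ?T) (gsource ?T)"
      using \<Gamma> submersion_compose_diffeo[OF _ B F E EF FE]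
      by (auto simp: transported_groupoid_def lie_groupoid_def)
    show "smap (gbase ?T) (arrows ?T) (gunit ?T)"
      using smap_compose[OF E unit] by (simp add: transported_groupoid_def)
    have N: "smooth_manifold N" using smap_source[OF F] .
    have "smap (prod_mfd N N) (prod_mfd (arrows \<Gamma>) (arrows \<Gamma>)) (\<lambda>z. (F (fst z), F (snd z)))"
      by (intro smap_Pair smap_compose[OF F] smap_fst smap_snd N)
    from smap_compose[OF E smap_compose[OF comp this]]
    show "smap (prod_mfd (arrows ?T) (arrows ?T)) (arrows ?T) (\<lambda>z. gcomp ?T (fst z) (snd z))" by simp
    show "smap (arrows ?T) (arrows ?T) (\<lambda>x. E (i (F x)))"
      unfolding sel by (intro smap_compose[OF E] smap_compose[OF i] F)
    show "gtarget ?T (gunit ?T b) = b \<and> gsource ?T (gunit ?T b) = b"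
      if "b \<in> points (gbase ?T)" for b using that by (simp add: FE uu)
    show "gtarget ?T (gcomp ?T x y) = gtarget ?T x \<and> gsource ?T (gcomp ?T x y) = gsource ?T y"
      if "(x, y) \<in> composable ?T" for x y using cc[OF cF[OF that]] by (simp add: FE)
    show "gcomp ?T (gcomp ?T x y) z = gcomp ?T x (gcomp ?T y z)"
      if "(x, y) \<in> composable ?T" "(y, z) \<in> composable ?T" for x y z
      using cc[OF cF[OF that(1)]] cc[OF cF[OF that(2)]] as[OF cF[OF that(1)] cF[OF that(2)]] by (simp add: FE)
    show "gcomp ?T (gunit ?T (gtarget ?T x)) x = x \<and> gcomp ?T x (gunit ?T (gsource ?T x)) = x"
      if "x \<in> arrs ?T" for x
    proof -
      have x: "x \<in> points N" using that by simp
      show ?thesis using ua[OF Fp[OF x]] uu ts[OF Fp[OF x]] x by (simp add: FE EF)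
    qed
    show "gtarget ?T (E (i (F x))) = gsource ?T x \<and> gsource ?T (E (i (F x))) = gtarget ?T x \<and>
        gcomp ?T x (E (i (F x))) = gunit ?T (gtarget ?T x) \<and> gcomp ?T (E (i (F x))) x = gunit ?T (gsource ?T x)"
      if "x \<in> arrs ?T" for x
    proof -
      have x: "x \<in> points N" using that by simp
      show ?thesis using ii[OF Fp[OF x]] smap_points[OF i Fp[OF x]] by (simp add: FE)
    qed
  qed
  have "groupoid_morphism ?T \<Gamma> F"
    unfolding groupoid_morphism_def
    using T \<Gamma> smap_smooth_map[OF F] uu cc cF by (auto simp: FE)
  then show "groupoid_iso ?T \<Gamma>"
    unfolding groupoid_iso_def using diffeomorphismI[OF F E EF FE] by auto
qed

text \<open>
  To check that a map into a transported groupoid is a morphism, compose it with \<open>F\<close> and compute in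
  \<open>\<Gamma>\<close>.
\<close>

lemma groupoid_morphism_transported:
  fixes \<Gamma> :: "('a, 'b, 'e::real_inner, 'f::real_inner) groupoid"
    and \<Delta> :: "('c, 'b, 'g::real_inner, 'f) groupoid"
  assumes \<Delta>: "lie_groupoid \<Delta>" and T: "lie_groupoid (transported_groupoid N F E \<Gamma>)"
    and base: "gbase \<Delta> = gbase \<Gamma>" and f: "smap (arrows \<Delta>) N f"
    and EF: "\<And>x. x \<in> points N \<Longrightarrow> E (F x) = x"
    and ts: "\<And>x. x \<in> arrs \<Delta> \<Longrightarrow> gtarget \<Gamma> (F (f x)) = gtarget \<Delta> x \<and> gsource \<Gamma> (F (f x)) = gsource \<Delta> x"
    and unit: "\<And>b. F (f (gunit \<Delta> b)) = gunit \<Gamma> b"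
    and comp: "\<And>x y. (x, y) \<in> composable \<Delta> \<Longrightarrow> F (f (gcomp \<Delta> x y)) = gcomp \<Gamma> (F (f x)) (F (f y))"
  shows "groupoid_morphism \<Delta> (transported_groupoid N F E \<Gamma>) f"
proof -
  have gu: "smap (gbase \<Delta>) (arrows \<Delta>) (gunit \<Delta>)" using \<Delta> by (simp add: lie_groupoid_def smap_def)
  have u: "f (gunit \<Delta> b) \<in> points N" if "b \<in> points (gbase \<Delta>)" for b
    by (rule smap_points[OF f smap_points[OF gu that]])
  have c: "f (gcomp \<Delta> x y) \<in> points N" if "(x, y) \<in> composable \<Delta>" for x y
  proof -
    have "gcomp \<Delta> x y \<in> arrs \<Delta>" using \<Delta> that unfolding lie_groupoid_def by fast
    then show ?thesis by (rule smap_points[OF f])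
  qed
  have "f (gunit \<Delta> b) = E (gunit \<Gamma> b)" if "b \<in> points (gbase \<Delta>)" for b
    using EF[OF u[OF that]] unit by simp
  moreover have "f (gcomp \<Delta> x y) = E (gcomp \<Gamma> (F (f x)) (F (f y)))" if "(x, y) \<in> composable \<Delta>" for x y
    using EF[OF c[OF that]] comp[OF that] by simp
  ultimately show ?thesis unfolding groupoid_morphism_def
    using \<Delta> T base smap_smooth_map[OF f] ts by (auto simp: transported_groupoid_simps)
qed

section \<open>Trivial groupoids\<close>

lemma trivial_groupoid_simps [simp]:
  "arrows (trivial_groupoid K) = prod_mfd vec_mfd (prod_mfd (mfd K) vec_mfd)"
  "gbase (trivial_groupoid K) = vec_mfd"
  "gtarget (trivial_groupoid K) x = fst x" "gsource (trivial_groupoid K) x = snd (snd x)"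
  "gunit (trivial_groupoid K) q = (q, \<one>\<^bsub>K\<^esub>, q)"
  "gcomp (trivial_groupoid K) x y = (fst x, fst (snd x) \<otimes>\<^bsub>K\<^esub> fst (snd y), snd (snd y))"
  by (simp_all add: trivial_groupoid_def case_prod_unfold)

lemma trivial_groupoid_maps:
  "gtarget (trivial_groupoid K) = fst" "gsource (trivial_groupoid K) = (\<lambda>x. snd (snd x))"
  "gunit (trivial_groupoid K) = (\<lambda>q. (q, \<one>\<^bsub>K\<^esub>, q))"
  by (auto simp: fun_eq_iff)

lemma lie_groupoid_trivial:
  fixes K :: "('a, 'e::real_inner, 'z) lie_group_scheme"
  assumes K: "is_lie_group K" and fin: "finite_dim TYPE('f::real_inner)"
  defines "\<Gamma> \<equiv> trivial_groupoid K :: ('f \<times> 'a \<times> 'f, 'f, 'f \<times> 'e \<times> 'f, 'f) groupoid"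
  shows "smap (prod_mfd (arrows \<Gamma>) (arrows \<Gamma>)) (arrows \<Gamma>) (\<lambda>z. gcomp \<Gamma> (fst z) (snd z))"
    and "lie_groupoid \<Gamma>"
proof -
  interpret group K by (rule lie_group_group[OF K])
  note M = smooth_manifold_vec[OF fin] lie_group_manifold[OF K]
  note M' = M smooth_manifold_prod
  note pt = lie_group_points[OF K]
  have A: "smooth_manifold (arrows \<Gamma>)" unfolding \<Gamma>_def by (simp add: M smooth_manifold_prod)
  have proj: "smap (arrows \<Gamma>) vec_mfd fst" "smap (arrows \<Gamma>) (mfd K) (\<lambda>x. fst (snd x))"
    "smap (arrows \<Gamma>) vec_mfd (\<lambda>x. snd (snd x))"
    unfolding \<Gamma>_def trivial_groupoid_simps
    by (intro smap_fst smap_fst_of[OF smap_snd] smap_snd_of[OF smap_snd] M')+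
  note of_fst = smap_compose[OF _ smap_fst[OF A A]] and of_snd = smap_compose[OF _ smap_snd[OF A A]]
  show comp: "smap (prod_mfd (arrows \<Gamma>) (arrows \<Gamma>)) (arrows \<Gamma>) (\<lambda>z. gcomp \<Gamma> (fst z) (snd z))"
    unfolding \<Gamma>_def trivial_groupoid_simps(1,6)
    by (intro smap_Pair smap_lie_mult[OF K] of_fst[unfolded \<Gamma>_def trivial_groupoid_simps(1)]
       of_snd[unfolded \<Gamma>_def trivial_groupoid_simps(1)] proj[unfolded \<Gamma>_def trivial_groupoid_simps(1)])
  show "lie_groupoid \<Gamma>"
  proof (rule lie_groupoidI[OF _ _ _ comp, where i = "\<lambda>x. (snd (snd x), inv\<^bsub>K\<^esub> (fst (snd x)), fst x)"])
    show "submersion (arrows \<Gamma>) (gbase \<Gamma>) (gtarget \<Gamma>)"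
    proof (rule submersionI_sections)
      show "smap (arrows \<Gamma>) (gbase \<Gamma>) (gtarget \<Gamma>)"
        using proj(1) by (simp add: \<Gamma>_def trivial_groupoid_maps)
      fix x assume "x \<in> arrs \<Gamma>"
      then have x: "fst (snd x) \<in> carrier K" by (auto simp: \<Gamma>_def pt)
      have "smap vec_mfd (arrows \<Gamma>) (\<lambda>p. (p, fst (snd x), snd (snd x)))"
        unfolding \<Gamma>_def trivial_groupoid_simps
        by (intro smap_Pair smap_ident smap_lie_const[OF K] smap_const M x) simp
      then show "\<exists>s. smap (gbase \<Gamma>) (arrows \<Gamma>) s \<and> s (gtarget \<Gamma> x) = x \<and> (\<forall>y\<in>points (gbase \<Gamma>). gtarget \<Gamma> (s y) = y)"
        by (intro exI[of _ "\<lambda>p. (p, fst (snd x), snd (snd x))"]) (simp add: \<Gamma>_def)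
    qed
    show "submersion (arrows \<Gamma>) (gbase \<Gamma>) (gsource \<Gamma>)"
    proof (rule submersionI_sections)
      show "smap (arrows \<Gamma>) (gbase \<Gamma>) (gsource \<Gamma>)"
        using proj(3) by (simp add: \<Gamma>_def trivial_groupoid_maps)
      fix x assume "x \<in> arrs \<Gamma>"
      then have x: "fst (snd x) \<in> carrier K" by (auto simp: \<Gamma>_def pt)
      have "smap vec_mfd (arrows \<Gamma>) (\<lambda>q. (fst x, fst (snd x), q))"
        unfolding \<Gamma>_def trivial_groupoid_simps
        by (intro smap_Pair smap_ident smap_lie_const[OF K] smap_const M x) simp
      then show "\<exists>s. smap (gbase \<Gamma>) (arrows \<Gamma>) s \<and> s (gsource \<Gamma> x) = x \<and> (\<forall>y\<in>points (gbase \<Gamma>). gsource \<Gamma> (s y) = y)"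
        by (intro exI[of _ "\<lambda>q. (fst x, fst (snd x), q)"]) (simp add: \<Gamma>_def)
    qed
    show "smap (gbase \<Gamma>) (arrows \<Gamma>) (gunit \<Gamma>)"
      unfolding \<Gamma>_def trivial_groupoid_maps trivial_groupoid_simps
      by (intro smap_Pair smap_ident smap_lie_const[OF K] M) simp
    show "smap (arrows \<Gamma>) (arrows \<Gamma>) (\<lambda>x. (snd (snd x), inv\<^bsub>K\<^esub> (fst (snd x)), fst x))"
      using proj unfolding \<Gamma>_def trivial_groupoid_simps
      by (intro smap_Pair smap_lie_inv[OF K])
  qed (auto simp: \<Gamma>_def composable_def pt m_assoc)
qed

section \<open>The dual groupoid\<close>

lemma dual_groupoid_simps [simp]:
  "arrows (dual_groupoid G H S dp I) = prod_mfd (mfd H) (prod_mfd vec_mfd (mfd S))"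
  "gbase (dual_groupoid G H S dp I) = vec_mfd"
  "gtarget (dual_groupoid G H S dp I) x = coAd H (inv\<^bsub>H\<^esub> fst x) (fst (snd x)) + I (snd (snd x))"
  "gsource (dual_groupoid G H S dp I) x = fst (snd x)"
  "gunit (dual_groupoid G H S dp I) q = (\<one>\<^bsub>H\<^esub>, q, \<one>\<^bsub>S\<^esub>)"
  "gcomp (dual_groupoid G H S dp I) x y =
    (fst x \<otimes>\<^bsub>H\<^esub> fst y, fst (snd y), snd (snd x) \<otimes>\<^bsub>S\<^esub> dp (inv\<^bsub>G\<^esub> fst x) (snd (snd y)))"
  by (simp_all add: dual_groupoid_def case_prod_unfold)

lemma dual_groupoid_maps:
  "gtarget (dual_groupoid G H S dp I) = (\<lambda>x. coAd H (inv\<^bsub>H\<^esub> fst x) (fst (snd x)) + I (snd (snd x)))"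
  "gsource (dual_groupoid G H S dp I) = (\<lambda>x. fst (snd x))"
  "gunit (dual_groupoid G H S dp I) = (\<lambda>q. (\<one>\<^bsub>H\<^esub>, q, \<one>\<^bsub>S\<^esub>))"
  by (auto simp: fun_eq_iff)

locale dressed_pair = momentum_morphism G H S br dp I
  for G :: "('a, 'g::real_inner) exp_lie_group" and H :: "('a, 'h::real_inner) exp_lie_group"
    and S :: "('d, 'g) exp_lie_group" and br dp and I :: "'d \<Rightarrow> 'h" +
  fixes dm :: "'d \<Rightarrow> 'a \<Rightarrow> 'a"
  assumes left_action: "left_lie_action S (mfd G) dm"
    and dp_twist: "\<And>x u v. x \<in> carrier G \<Longrightarrow> u \<in> carrier S \<Longrightarrow> v \<in> carrier S \<Longrightarrow>
        dp x (u \<otimes>\<^bsub>S\<^esub> v) = dp (dm v x) u \<otimes>\<^bsub>S\<^esub> dp x v"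
    and dm_twist: "\<And>u x y. u \<in> carrier S \<Longrightarrow> x \<in> carrier G \<Longrightarrow> y \<in> carrier G \<Longrightarrow>
        dm u (x \<otimes>\<^bsub>G\<^esub> y) = dm u x \<otimes>\<^bsub>G\<^esub> dm (dp x u) y"
    and dm_fix: "\<And>u h. u \<in> carrier S \<Longrightarrow> h \<in> carrier H \<Longrightarrow> dm u h = h"
begin

lemma smap_dm: "smap (prod_mfd (mfd S) (mfd G)) (mfd G) (\<lambda>(u, x). dm u x)"
  using left_action G.manifold S.manifold
  by (simp add: left_lie_action_def smap_def smooth_manifold_prod)

lemma smap_dm_of:
  assumes "smap M (mfd S) f" "smap M (mfd G) g" shows "smap M (mfd G) (\<lambda>x. dm (f x) (g x))"
  using smap_compose[OF smap_dm smap_Pair[OF assms]] by simp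

lemma dm_closed: "x \<in> carrier G \<Longrightarrow> u \<in> carrier S \<Longrightarrow> dm u x \<in> carrier G"
  using smap_points[OF smap_dm, of "(u, x)"] by (simp add: G.points_carrier S.points_carrier)

sublocale D: dressed_groups G S dp dm
proof unfold_locales
  show "dm \<one>\<^bsub>S\<^esub> x = x" if "x \<in> carrier G" for x
    using left_action that by (simp add: left_lie_action_def G.points_carrier)
  show "dm (u \<otimes>\<^bsub>S\<^esub> v) x = dm u (dm v x)" if "u \<in> carrier S" "v \<in> carrier S" "x \<in> carrier G" for u v x
    using left_action that by (simp add: left_lie_action_def G.points_carrier)
qed (simp_all add: dp_closed dm_closed dp_one dp_mult dp_twist dm_twist)

lemma smap_swap:
  assumes "smap M (mfd G) g" "smap M (mfd S) u"
  shows "smap M (mfd G) (\<lambda>x. D.swap_left (g x) (u x))" "smap M (mfd S) (\<lambda>x. D.swap_right (g x) (u x))"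
  unfolding D.swap_left_def D.swap_right_def
  by (intro G.smap_inv S.smap_inv smap_dm_of smap_dp_of assms)+

lemma is_lie_group_double: "is_lie_group D.double"
proof (rule is_lie_groupI[OF D.group_double])
  note M = G.manifold S.manifold smooth_manifold_prod
  show "smooth_manifold (mfd D.double)" by (simp add: M)
  show "points (mfd D.double) = carrier D.double" by (simp add: G.points_carrier S.points_carrier)
  have mult: "x \<otimes>\<^bsub>D.double\<^esub> y = (D.swap_left (fst x) (snd y) \<otimes>\<^bsub>G\<^esub> fst y, snd x \<otimes>\<^bsub>S\<^esub> D.swap_right (fst x) (snd y))" for x y
    using D.double_mult[of "fst x" "snd x" "fst y" "snd y"] by simp
  show "smap (prod_mfd (mfd D.double) (mfd D.double)) (mfd D.double) (\<lambda>z. fst z \<otimes>\<^bsub>D.double\<^esub> snd z)"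
    unfolding mult D.double_simps
    by (intro smap_Pair G.smap_mult S.smap_mult smap_swap
          smap_fst_of[OF smap_fst] smap_fst_of[OF smap_snd] smap_snd_of[OF smap_fst] smap_snd_of[OF smap_snd] M)
  have "smap (mfd D.double) (mfd D.double) (\<lambda>x. (inv\<^bsub>G\<^esub> (dm (snd x) (fst x)), inv\<^bsub>S\<^esub> (dp (fst x) (snd x))))"
    unfolding D.double_simps
    by (intro smap_Pair G.smap_inv S.smap_inv smap_dm_of smap_dp_of smap_fst smap_snd M)
  then show "smap (mfd D.double) (mfd D.double) (\<lambda>x. inv\<^bsub>D.double\<^esub> x)"
    by (rule smap_cong) (auto simp: G.points_carrier S.points_carrier D.double_inv)
qed

lemma dp_hom:
  assumes "h \<in> carrier H" "u \<in> carrier S" "v \<in> carrier S"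
  shows "dp h (u \<otimes>\<^bsub>S\<^esub> v) = dp h u \<otimes>\<^bsub>S\<^esub> dp h v"
  using dp_twist[OF in_G] dm_fix assms by simp

lemma dp_inv_hom:
  assumes "h \<in> carrier H" "u \<in> carrier S"
  shows "dp h (inv\<^bsub>S\<^esub> u) = inv\<^bsub>S\<^esub> (dp h u)"
  using D.dp_inv[OF in_G] dm_fix assms by simp

lemma inv_in_H: "h \<in> carrier H \<Longrightarrow> inv\<^bsub>G\<^esub> h \<in> carrier H"
  by (metis H.inv_closed inv_eq)

text \<open>
  Moving an element of \<open>H\<close> past \<open>u\<close> leaves it unchanged, so that \<open>h u = (dp (h\<^sup>-\<^sup>1) u) h\<close> in the double:
  this is the product rule of the dual groupoid.
\<close>

lemma swap_subgroup:
  assumes "h \<in> carrier H" "u \<in> carrier S"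
  shows "D.swap_left h u = h" "D.swap_right h u = dp (inv\<^bsub>G\<^esub> h) u"
  using assms inv_in_H by (simp_all add: D.swap_left_def D.swap_right_def dm_fix dp_inv_hom in_G)

abbreviation dual where "dual \<equiv> dual_groupoid G H S dp I"

lemma arrs_dual: "arrs dual = carrier H \<times> UNIV \<times> carrier S"
  by (simp add: H.points_carrier S.points_carrier)

lemma I_inv: "u \<in> carrier S \<Longrightarrow> I (inv\<^bsub>S\<^esub> u) = - I u"
  using I_mult[of "inv\<^bsub>S\<^esub> u" u] I_one by (simp add: eq_neg_iff_add_eq_0)

text \<open>
  The target of a product in the dual groupoid is the target of its first factor: equivariance of \<open>I\<close>.
\<close>

lemma dual_target_comp:
  assumes "h \<in> carrier H" "k \<in> carrier H" "u \<in> carrier S" "v \<in> carrier S"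
  shows "coAd H (inv\<^bsub>H\<^esub> (h \<otimes>\<^bsub>H\<^esub> k)) q + I (u \<otimes>\<^bsub>S\<^esub> dp (inv\<^bsub>G\<^esub> h) v)
    = coAd H (inv\<^bsub>H\<^esub> h) (coAd H (inv\<^bsub>H\<^esub> k) q + I v) + I u"
proof -
  have "I (dp (inv\<^bsub>G\<^esub> h) v) = coAd H (inv\<^bsub>H\<^esub> h) (I v)"
    using I_equivariant[of "inv\<^bsub>G\<^esub> h" v] assms inv_in_H by (simp add: inv_eq)
  then show ?thesis
    using assms by (simp add: H.inv_mult_group H.coAd_mult H.coAd_add I_mult dp_closed in_G)
qed

lemma smap_dual_projections:
  "smap (arrows dual) (mfd H) fst" "smap (arrows dual) vec_mfd (\<lambda>x. fst (snd x))"
  "smap (arrows dual) (mfd S) (\<lambda>x. snd (snd x))"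
  unfolding dual_groupoid_simps
  by (intro smap_fst smap_fst_of[OF smap_snd] smap_snd_of[OF smap_snd] H.manifold S.manifold
      smooth_manifold_vec H.finite_dim smooth_manifold_prod)+

lemma smap_dual_target: "smap (arrows dual) vec_mfd (gtarget dual)"
  unfolding dual_groupoid_maps
  by (intro smap_add H.smap_coAd H.smap_inv smap_compose[OF smap_I] smap_dual_projections)

text \<open>
  The inverse of \<open>(h, p, u)\<close> is \<open>(h\<^sup>-\<^sup>1, \<alpha>(h, p, u), dp h (u\<^sup>-\<^sup>1))\<close>. The target is a submersion because for
  given \<open>h\<close> and \<open>u\<close> it is an affine bijection in \<open>p\<close>.
\<close>

lemma lie_groupoid_dual: "lie_groupoid dual"
proof -
  note M = H.manifold S.manifold smooth_manifold_vec[OF H.finite_dim]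
  note pr = smap_dual_projections
  have A: "smooth_manifold (arrows dual)" by (simp add: M smooth_manifold_prod)
  have pt: "x \<in> arrs dual \<longleftrightarrow> fst x \<in> carrier H \<and> snd (snd x) \<in> carrier S" for x
    by (cases x) (simp add: H.points_carrier S.points_carrier)
  note sub = in_G inv_in_H inv_eq dp_closed
  show ?thesis
  proof (rule lie_groupoidI[where i = "\<lambda>x. (inv\<^bsub>H\<^esub> fst x, gtarget dual x, dp (fst x) (inv\<^bsub>S\<^esub> snd (snd x)))"])
    show "submersion (arrows dual) (gbase dual) (gtarget dual)"
    proof (rule submersionI_sections)
      show "smap (arrows dual) (gbase dual) (gtarget dual)" using smap_dual_target by simp
      fix x assume "x \<in> arrs dual"
      then have x: "fst x \<in> carrier H" "snd (snd x) \<in> carrier S" unfolding pt by blast+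
      let ?s = "\<lambda>q. (fst x, coAd H (fst x) (q + - I (snd (snd x))), snd (snd x))"
      have "smap (gbase dual) (arrows dual) ?s"
        unfolding dual_groupoid_simps
        by (intro smap_Pair H.smap_group_const S.smap_group_const H.smap_coAd smap_add smap_ident smap_const M x) simp
      then show "\<exists>s. smap (gbase dual) (arrows dual) s \<and> s (gtarget dual x) = x \<and>
          (\<forall>y\<in>points (gbase dual). gtarget dual (s y) = y)"
        using x by (intro exI[of _ ?s]) (simp add: H.coAd_inv)
    qed
    show "submersion (arrows dual) (gbase dual) (gsource dual)"
    proof (rule submersionI_sections)
      show "smap (arrows dual) (gbase dual) (gsource dual)"
        using pr(2) by (simp add: dual_groupoid_maps)
      fix x assume "x \<in> arrs dual"
      then have x: "fst x \<in> carrier H" "snd (snd x) \<in> carrier S" unfolding pt by blast+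
      let ?s = "\<lambda>q. (fst x, q, snd (snd x))"
      have "smap (gbase dual) (arrows dual) ?s"
        unfolding dual_groupoid_simps
        by (intro smap_Pair H.smap_group_const S.smap_group_const smap_ident M x)
      then show "\<exists>s. smap (gbase dual) (arrows dual) s \<and> s (gsource dual x) = x \<and>
          (\<forall>y\<in>points (gbase dual). gsource dual (s y) = y)"
        by (intro exI[of _ ?s]) simp
    qed
    show "smap (gbase dual) (arrows dual) (gunit dual)"
      unfolding dual_groupoid_maps dual_groupoid_simps
      by (intro smap_Pair H.smap_group_const S.smap_group_const smap_ident M) auto
    note pr_fst = smap_compose[OF pr(1) smap_fst[OF A A]] smap_compose[OF pr(2) smap_fst[OF A A]]
        smap_compose[OF pr(3) smap_fst[OF A A]]
      and pr_snd = smap_compose[OF pr(1) smap_snd[OF A A]] smap_compose[OF pr(2) smap_snd[OF A A]]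
        smap_compose[OF pr(3) smap_snd[OF A A]]
    have "smap (prod_mfd (arrows dual) (arrows dual)) (prod_mfd (mfd H) (prod_mfd vec_mfd (mfd S)))
        (\<lambda>z. gcomp dual (fst z) (snd z))"
      unfolding dual_groupoid_simps(6)
      by (intro smap_Pair H.smap_mult S.smap_mult smap_dp_of G.smap_inv smap_into_G pr_fst pr_snd)
    then show "smap (prod_mfd (arrows dual) (arrows dual)) (arrows dual) (\<lambda>z. gcomp dual (fst z) (snd z))"
      by simp
    have "smap (arrows dual) (prod_mfd (mfd H) (prod_mfd vec_mfd (mfd S)))
        (\<lambda>x. (inv\<^bsub>H\<^esub> fst x, gtarget dual x, dp (fst x) (inv\<^bsub>S\<^esub> snd (snd x))))"
      by (intro smap_Pair H.smap_inv S.smap_inv smap_dual_target smap_dp_of smap_into_G pr)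
    then show "smap (arrows dual) (arrows dual) (\<lambda>x. (inv\<^bsub>H\<^esub> fst x, gtarget dual x, dp (fst x) (inv\<^bsub>S\<^esub> snd (snd x))))"
      by simp
    show "gtarget dual (gunit dual b) = b \<and> gsource dual (gunit dual b) = b" for b
      by (simp add: H.coAd_one I_one)
    show "gtarget dual (gcomp dual x y) = gtarget dual x \<and> gsource dual (gcomp dual x y) = gsource dual y"
      if "(x, y) \<in> composable dual" for x y
    proof -
      have "fst x \<in> carrier H" "snd (snd x) \<in> carrier S" "fst y \<in> carrier H" "snd (snd y) \<in> carrier S"
        and "fst (snd x) = coAd H (inv\<^bsub>H\<^esub> fst y) (fst (snd y)) + I (snd (snd y))"
        using that unfolding composable_def by (auto simp: pt simp del: dual_groupoid_simps(1)) 
      then show ?thesis by (simp add: dual_target_comp)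
    qed
    show "gcomp dual (gcomp dual x y) z = gcomp dual x (gcomp dual y z)"
      if "(x, y) \<in> composable dual" "(y, z) \<in> composable dual" for x y z
    proof -
      have c: "fst x \<in> carrier H" "snd (snd x) \<in> carrier S" "fst y \<in> carrier H" "snd (snd y) \<in> carrier S"
          "fst z \<in> carrier H" "snd (snd z) \<in> carrier S"
        using that unfolding composable_def by (auto simp: pt simp del: dual_groupoid_simps(1))
      have "dp (inv\<^bsub>G\<^esub> (fst x \<otimes>\<^bsub>H\<^esub> fst y)) (snd (snd z)) = dp (inv\<^bsub>G\<^esub> fst x) (dp (inv\<^bsub>G\<^esub> fst y) (snd (snd z)))"
        using c by (simp add: mult_eq G.inv_mult_group in_G dp_mult)
      then show ?thesis
        using c sub by (simp add: H.m_assoc S.m_assoc dp_hom)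
    qed
    show "gcomp dual (gunit dual (gtarget dual x)) x = x \<and> gcomp dual x (gunit dual (gsource dual x)) = x"
      if "x \<in> arrs dual" for x
    proof -
      have c: "fst x \<in> carrier H" "snd (snd x) \<in> carrier S" using that unfolding pt by blast+
      then have "dp (inv\<^bsub>G\<^esub> \<one>\<^bsub>H\<^esub>) (snd (snd x)) = snd (snd x)" by (simp add: one_eq)
      moreover have "dp (inv\<^bsub>G\<^esub> (fst x)) \<one>\<^bsub>S\<^esub> = \<one>\<^bsub>S\<^esub>" using c by (simp add: in_G)
      ultimately show ?thesis using c by simp
    qed
    fix x assume "x \<in> arrs dual"
    then have c: "fst x \<in> carrier H" "snd (snd x) \<in> carrier S" using pt by auto
    let ?h = "fst x" and ?u = "snd (snd x)"
    have "dp (inv\<^bsub>G\<^esub> ?h) (dp ?h (inv\<^bsub>S\<^esub> ?u)) = inv\<^bsub>S\<^esub> ?u"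
      using c dp_mult[of ?h "inv\<^bsub>G\<^esub> ?h" "inv\<^bsub>S\<^esub> ?u"] by (simp add: in_G)
    moreover have "dp ?h (inv\<^bsub>S\<^esub> ?u) \<otimes>\<^bsub>S\<^esub> dp (inv\<^bsub>G\<^esub> (inv\<^bsub>H\<^esub> ?h)) ?u = \<one>\<^bsub>S\<^esub>"
      using c dp_hom[of ?h "inv\<^bsub>S\<^esub> ?u" ?u] by (simp add: in_G inv_eq)
    moreover have "coAd H ?h (coAd H (inv\<^bsub>H\<^esub> ?h) (fst (snd x)) + I ?u) + I (dp ?h (inv\<^bsub>S\<^esub> ?u)) = fst (snd x)"
      using c by (simp add: H.coAd_add H.coAd_inv H.coAd_minus I_equivariant I_inv)
    ultimately show "gtarget dual (inv\<^bsub>H\<^esub> fst x, gtarget dual x, dp (fst x) (inv\<^bsub>S\<^esub> snd (snd x))) = gsource dual x \<and>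
        gsource dual (inv\<^bsub>H\<^esub> fst x, gtarget dual x, dp (fst x) (inv\<^bsub>S\<^esub> snd (snd x))) = gtarget dual x \<and>
        gcomp dual x (inv\<^bsub>H\<^esub> fst x, gtarget dual x, dp (fst x) (inv\<^bsub>S\<^esub> snd (snd x))) = gunit dual (gtarget dual x) \<and>
        gcomp dual (inv\<^bsub>H\<^esub> fst x, gtarget dual x, dp (fst x) (inv\<^bsub>S\<^esub> snd (snd x))) x = gunit dual (gsource dual x)"
      using c by simp
  qed
qed

section \<open>The matched product\<close>

abbreviation model :: "('h \<times> ('a \<times> 'a \<times> 'd) \<times> 'h, 'h, 'h \<times> ('h \<times> 'g \<times> 'g) \<times> 'h, 'h) groupoid" where
  "model \<equiv> trivial_groupoid (prod_lie_group H D.double)"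

abbreviation trivial_G :: "('h \<times> 'a \<times> 'h, 'h, 'h \<times> 'g \<times> 'h, 'h) groupoid" where
  "trivial_G \<equiv> trivial_groupoid G"

text \<open>
  The product of the images of two arrows in the trivial groupoid \<open>model\<close>: its middle component is
  \<open>(1, (g, 1)) (h, (h, u))\<close>.
\<close>

definition factors_product :: "('h \<times> 'a \<times> 'h) \<times> ('a \<times> 'h \<times> 'd) \<Rightarrow> 'h \<times> ('a \<times> 'a \<times> 'd) \<times> 'h" where
  "factors_product = (\<lambda>((p, g, q), (h, r, u)). (p, (h, (D.swap_left g u \<otimes>\<^bsub>G\<^esub> h, D.swap_right g u)), r))"

text \<open>
  From \<open>w x = g u h\<close> in the double one gets \<open>g u = w y\<close> with \<open>y = x h\<^sup>-\<^sup>1\<close>, so \<open>g = dm w y\<close> and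
  \<open>u = dp y w\<close>.
\<close>

definition factorisation :: "'h \<times> ('a \<times> 'a \<times> 'd) \<times> 'h \<Rightarrow> ('h \<times> 'a \<times> 'h) \<times> ('a \<times> 'h \<times> 'd)" where
  "factorisation = (\<lambda>(p, (h, (x, w)), r). let y = x \<otimes>\<^bsub>G\<^esub> inv\<^bsub>G\<^esub> h; u = dp y w in
     ((p, dm w y, coAd H (inv\<^bsub>H\<^esub> h) r + I u), (h, r, u)))"

definition pairs :: "(('h \<times> 'a \<times> 'h) \<times> ('a \<times> 'h \<times> 'd)) set" where
  "pairs = {(v, k). v \<in> arrs trivial_G \<and> k \<in> arrs dual \<and> gsource trivial_G v = gtarget dual k}"

lemma pairs_iff: "((p, g, q), (h, r, u)) \<in> pairs \<longleftrightarrow>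
    g \<in> carrier G \<and> h \<in> carrier H \<and> u \<in> carrier S \<and> q = coAd H (inv\<^bsub>H\<^esub> h) r + I u"
  by (auto simp: pairs_def G.points_carrier H.points_carrier S.points_carrier)

lemma arrs_model_iff: "(p, (h, (x, w)), r) \<in> arrs model \<longleftrightarrow> h \<in> carrier H \<and> x \<in> carrier G \<and> w \<in> carrier S"
  by (simp add: G.points_carrier H.points_carrier S.points_carrier)

lemma factorisation_factors_product: "z \<in> pairs \<Longrightarrow> factorisation (factors_product z) = z"
  by (cases z) (auto simp: pairs_iff factors_product_def factorisation_def G.m_assoc in_G D.dressing_swap)

lemma factors_product_factorisation: "t \<in> arrs model \<Longrightarrow> factors_product (factorisation t) = t"
  by (cases t) (auto simp: arrs_model_iff factors_product_def factorisation_def Let_def G.m_assoc in_G D.swap_dressing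
      simp del: trivial_groupoid_simps)

lemma factorisation_pairs: "t \<in> arrs model \<Longrightarrow> factorisation t \<in> pairs"
  by (cases t) (auto simp: arrs_model_iff factorisation_def Let_def pairs_iff in_G dp_closed dm_closed
      simp del: trivial_groupoid_simps)

lemma smap_factors_product: "smap (prod_mfd (arrows trivial_G) (arrows dual)) (arrows model) factors_product"
proof -
  note M = G.manifold H.manifold S.manifold smooth_manifold_vec[OF H.finite_dim]
  note M' = M smooth_manifold_prod
  let ?A = "prod_mfd (vec_mfd :: ('h, 'h) manifold) (prod_mfd (mfd G) (vec_mfd :: ('h, 'h) manifold))"
  let ?B = "prod_mfd (mfd H) (prod_mfd (vec_mfd :: ('h, 'h) manifold) (mfd S))"
  have 1: "smap (prod_mfd ?A ?B) ?A fst" and 2: "smap (prod_mfd ?A ?B) ?B snd"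
    by (intro smap_fst smap_snd M')+
  note pr = smap_fst_of[OF 1] smap_fst_of[OF smap_snd_of[OF 1]] smap_fst_of[OF 2]
    smap_fst_of[OF smap_snd_of[OF 2]] smap_snd_of[OF smap_snd_of[OF 2]]
  show ?thesis
    unfolding factors_product_def case_prod_unfold trivial_groupoid_simps prod_lie_group_simps
      D.double_simps dual_groupoid_simps
    by (intro smap_Pair G.smap_mult smap_swap smap_into_G pr M')
qed

lemma smap_factorisation: "smap (arrows model) (prod_mfd (arrows trivial_G) (arrows dual)) factorisation"
proof -
  note M = G.manifold H.manifold S.manifold smooth_manifold_vec[OF H.finite_dim]
  note M' = M smooth_manifold_prod
  let ?T = "prod_mfd (vec_mfd :: ('h, 'h) manifold) (prod_mfd (prod_mfd (mfd H) (prod_mfd (mfd G) (mfd S)))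
      (vec_mfd :: ('h, 'h) manifold))"
  have 1: "smap ?T ?T (\<lambda>x. x)" by (intro smap_ident M')
  note snd_1 = smap_snd_of[OF 1]
  note pr = smap_fst_of[OF 1] smap_fst_of[OF smap_fst_of[OF snd_1]]
    smap_fst_of[OF smap_snd_of[OF smap_fst_of[OF snd_1]]]
    smap_snd_of[OF smap_snd_of[OF smap_fst_of[OF snd_1]]] smap_snd_of[OF snd_1]
  show ?thesis
    unfolding factorisation_def Let_def case_prod_unfold trivial_groupoid_simps prod_lie_group_simps
      D.double_simps dual_groupoid_simps
    by (intro smap_Pair G.smap_mult G.smap_inv smap_dm_of smap_dp_of smap_add H.smap_coAd H.smap_inv
        smap_compose[OF smap_I] smap_into_G pr M')
qed

definition pairs_top :: "(('h \<times> 'a \<times> 'h) \<times> ('a \<times> 'h \<times> 'd)) topology" where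
  "pairs_top = subtopology (mtop (prod_mfd (arrows trivial_G) (arrows dual))) pairs"

lemma topspace_pairs_top: "topspace pairs_top = pairs"
  by (auto simp: pairs_top_def pairs_def)

lemma homeomorphic_maps_factors_product: "homeomorphic_maps pairs_top (mtop (arrows model)) factors_product factorisation"
  unfolding homeomorphic_maps_def
proof (intro conjI ballI)
  show "continuous_map pairs_top (mtop (arrows model)) factors_product"
    unfolding pairs_top_def
    by (rule continuous_map_from_subtopology[OF smap_continuous_map[OF smap_factors_product]])
  show "continuous_map (mtop (arrows model)) pairs_top factorisation"
    unfolding pairs_top_def
    by (rule continuous_map_into_subtopology[OF smap_continuous_map[OF smap_factorisation]])
      (use factorisation_pairs in blast)
  show "factorisation (factors_product x) = x" if "x \<in> topspace pairs_top" for x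
    using that factorisation_factors_product by (simp add: topspace_pairs_top)
  show "factors_product (factorisation y) = y" if "y \<in> topspace (mtop (arrows model))" for y
    using that by (rule factors_product_factorisation)
qed

lemma is_lie_group_vertex: "is_lie_group (prod_lie_group H D.double)"
  by (rule is_lie_group_prod[OF H.is_lie is_lie_group_double])

lemmas smap_model_comp = lie_groupoid_trivial(1)[OF is_lie_group_vertex H.finite_dim]
  and lie_groupoid_model = lie_groupoid_trivial(2)[OF is_lie_group_vertex H.finite_dim]
  and lie_groupoid_trivial_G = lie_groupoid_trivial(2)[OF G.is_lie H.finite_dim]

lemmas smooth_manifold_model = smap_source[OF smap_factorisation]

abbreviation pairs_mfd where "pairs_mfd \<equiv> pullback_mfd pairs_top factors_product (arrows model)"

lemma mtop_pairs_mfd: "mtop pairs_mfd = pairs_top"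
  by (rule mtop_pullback_mfd[OF smooth_manifold_model homeomorphic_maps_factors_product])

lemma points_pairs_mfd: "points pairs_mfd = pairs"
  by (simp only: mtop_pairs_mfd topspace_pairs_top)

lemmas smap_pairs = smap_pullback[OF smooth_manifold_model homeomorphic_maps_factors_product]
  and smap_pairs_inverse = smap_pullback_inverse[OF smooth_manifold_model homeomorphic_maps_factors_product]

abbreviation product_groupoid where
  "product_groupoid \<equiv> transported_groupoid pairs_mfd factors_product factorisation model"

lemma lie_groupoid_product: "lie_groupoid product_groupoid"
  and iso_product: "groupoid_iso product_groupoid model"
  using lie_groupoid_transported[OF lie_groupoid_model smap_model_comp smap_pairs smap_pairs_inverse]
    factorisation_factors_product factors_product_factorisation by (simp_all only: points_pairs_mfd)

lemma smap_into_pairs: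
  assumes f: "smap M (prod_mfd (arrows trivial_G) (arrows dual)) f" and mem: "\<And>x. x \<in> points M \<Longrightarrow> f x \<in> pairs"
  shows "smap M pairs_mfd f"
  by (rule smap_cong[OF smap_compose[OF smap_pairs_inverse smap_compose[OF smap_factors_product f]]])
    (simp add: factorisation_factors_product mem)

text \<open>
  The inclusion is an immersion because \<open>factorisation \<circ> factors_product\<close>, defined on all of
  the product of the two arrow manifolds, is a smooth left inverse of it.
\<close>

lemma embedded_pairs: "embedded_submanifold pairs_mfd (prod_mfd (arrows trivial_G) (arrows dual))"
  unfolding embedded_submanifold_def points_pairs_mfd
proof (intro conjI)
  show "smooth_manifold pairs_mfd" by (rule smap_source[OF smap_pairs])
  show "pairs \<subseteq> points (prod_mfd (arrows trivial_G) (arrows dual))" by (auto simp: pairs_def)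
  show "mtop pairs_mfd = subtopology (mtop (prod_mfd (arrows trivial_G) (arrows dual))) pairs"
    unfolding mtop_pairs_mfd by (rule pairs_top_def)
  have incl: "smap pairs_mfd (prod_mfd (arrows trivial_G) (arrows dual)) (\<lambda>x. x)"
    by (rule smap_cong[OF smap_compose[OF smap_factorisation smap_pairs]])
      (simp only: points_pairs_mfd factorisation_factors_product)
  show "immersion pairs_mfd (prod_mfd (arrows trivial_G) (arrows dual)) (\<lambda>x. x)"
    by (rule immersionI_left_inverse[OF incl smap_compose[OF smap_pairs_inverse smap_factors_product]])
      (simp only: points_pairs_mfd factorisation_factors_product)
qed

lemma morphism_dual: "groupoid_morphism dual product_groupoid (\<lambda>k. (gunit trivial_G (gtarget dual k), k))"
proof (rule groupoid_morphism_transported[OF lie_groupoid_dual lie_groupoid_product])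
  let ?f = "\<lambda>k. (gunit trivial_G (gtarget dual k), k)"
  have A: "smooth_manifold (arrows dual)" using lie_groupoid_dual by (simp add: lie_groupoid_def)
  have unit: "smap vec_mfd (arrows trivial_G) (gunit trivial_G)"
    using lie_groupoid_trivial_G smooth_manifold_vec[OF H.finite_dim] by (simp add: lie_groupoid_def smap_def)
  have f: "?f k \<in> pairs" if "k \<in> arrs dual" for k
    using that by (auto simp: pairs_def G.points_carrier)
  show "smap (arrows dual) pairs_mfd ?f"
    by (intro smap_into_pairs smap_Pair smap_compose[OF unit smap_dual_target] smap_ident A f)
  have F: "factors_product (?f (h, p, u)) = (coAd H (inv\<^bsub>H\<^esub> h) p + I u, (h, (h, u)), p)"
    if "h \<in> carrier H" "u \<in> carrier S" for h p u
    using that by (simp add: factors_product_def in_G)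
  show "factorisation (factors_product x) = x" if "x \<in> points pairs_mfd" for x
    using that by (simp only: points_pairs_mfd factorisation_factors_product)
  show "gtarget model (factors_product (?f k)) = gtarget dual k \<and> gsource model (factors_product (?f k)) = gsource dual k"
    if "k \<in> arrs dual" for k
    using that F unfolding arrs_dual by (cases k) auto
  show "factors_product (?f (gunit dual b)) = gunit model b" for b
  proof -
    have "factors_product (?f (gunit dual b)) = (b, (\<one>\<^bsub>H\<^esub>, (\<one>\<^bsub>H\<^esub>, \<one>\<^bsub>S\<^esub>)), b)"
      using F[of "\<one>\<^bsub>H\<^esub>" "\<one>\<^bsub>S\<^esub>" b] by (simp add: H.coAd_one I_one)
    then show ?thesis
      by (simp only: trivial_groupoid_simps prod_lie_group_simps D.double_simps one_eq)
  qed
  fix x y assume xy: "(x, y) \<in> composable dual"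
  obtain h p u k q v where x: "x = (h, p, u)" and y: "y = (k, q, v)" by (metis prod.exhaust)
  from xy have c: "h \<in> carrier H" "k \<in> carrier H" "u \<in> carrier S" "v \<in> carrier S"
    "p = coAd H (inv\<^bsub>H\<^esub> k) q + I v"
    unfolding composable_def arrs_dual x y by auto
  then show "factors_product (?f (gcomp dual x y)) = gcomp model (factors_product (?f x)) (factors_product (?f y))"
    unfolding x y dual_groupoid_simps(6) fst_conv snd_conv
    by (subst (1 2 3) F)
      (simp_all add: D.double_mult swap_subgroup mult_eq[symmetric] dual_target_comp dp_closed in_G inv_in_H)
qed simp

lemma morphism_trivial_G: "groupoid_morphism trivial_G product_groupoid (\<lambda>v. (v, gunit dual (gsource trivial_G v)))"
proof (rule groupoid_morphism_transported[OF lie_groupoid_trivial_G lie_groupoid_product])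
  let ?f = "\<lambda>v. (v, gunit dual (gsource trivial_G v))"
  have A: "smooth_manifold (arrows trivial_G)" using lie_groupoid_trivial_G by (simp only: lie_groupoid_def)
  have unit: "smap vec_mfd (arrows dual) (gunit dual)"
    using lie_groupoid_dual smooth_manifold_vec[OF H.finite_dim] by (simp add: lie_groupoid_def smap_def)
  have src: "smap (arrows trivial_G) vec_mfd (gsource trivial_G)"
    using lie_groupoid_trivial_G unfolding lie_groupoid_def submersion_def smap_def by (simp only: trivial_groupoid_simps)
  have f: "?f k \<in> pairs" if "k \<in> arrs trivial_G" for k
    using that by (auto simp: pairs_def H.points_carrier S.points_carrier H.coAd_one I_one)
  show "smap (arrows trivial_G) pairs_mfd ?f"
    by (intro smap_into_pairs smap_Pair smap_compose[OF unit src] smap_ident A f)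
  have F: "factors_product (?f (p, g, q)) = (p, (\<one>\<^bsub>H\<^esub>, (g, \<one>\<^bsub>S\<^esub>)), q)" if "g \<in> carrier G" for p g q
    using that by (simp add: factors_product_def one_eq)
  show "factorisation (factors_product x) = x" if "x \<in> points pairs_mfd" for x
    using that by (simp only: points_pairs_mfd factorisation_factors_product)
  show "gtarget model (factors_product (?f k)) = gtarget trivial_G k \<and> gsource model (factors_product (?f k)) = gsource trivial_G k"
    if "k \<in> arrs trivial_G" for k
    using that F by (cases k) (auto simp: G.points_carrier)
  show "factors_product (?f (gunit trivial_G b)) = gunit model b" for b
    using F[of "\<one>\<^bsub>G\<^esub>" b b] by simp
  fix x y assume xy: "(x, y) \<in> composable trivial_G"
  obtain p g q p' g' q' where x: "x = (p, g, q)" and y: "y = (p', g', q')" by (metis prod.exhaust)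
  from xy have c: "g \<in> carrier G" "g' \<in> carrier G"
    unfolding composable_def x y by (auto simp: G.points_carrier)
  then show "factors_product (?f (gcomp trivial_G x y)) = gcomp model (factors_product (?f x)) (factors_product (?f y))"
    unfolding x y trivial_groupoid_simps(6)[of G] fst_conv snd_conv
    by (subst (1 2 3) F) (simp_all add: D.double_mult)
qed simp

text \<open>
  By its definition \<open>factors_product\<close> multiplies the images of the two factors in \<open>model\<close>;
  transporting this product back gives the pair itself.
\<close>

lemma product_of_factors:
  assumes "(v, k) \<in> pairs"
  shows "gcomp product_groupoid (v, gunit dual (gsource trivial_G v)) (gunit trivial_G (gtarget dual k), k) = (v, k)"
proof -
  obtain p g q h r u where v: "v = (p, g, q)" and k: "k = (h, r, u)" by (metis prod.exhaust)
  have c: "g \<in> carrier G" "h \<in> carrier H" "u \<in> carrier S" using assms unfolding v k pairs_iff by auto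
  have "gcomp model (factors_product (v, gunit dual (gsource trivial_G v))) (factors_product (gunit trivial_G (gtarget dual k), k))
      = factors_product (v, k)"
  proof -
    have r_one: "g \<otimes>\<^bsub>G\<^esub> \<one>\<^bsub>H\<^esub> = g" using c by (simp add: one_eq)
    show ?thesis using c by (simp add: v k factors_product_def D.double_mult in_G r_one)
  qed
  then show ?thesis using factorisation_factors_product[OF assms] by (simp only: transported_groupoid_simps)
qed

theorem matched_product_dual: "matched_product trivial_G dual product_groupoid"
  unfolding matched_product_def
proof (intro conjI lie_groupoid_trivial_G lie_groupoid_dual lie_groupoid_product morphism_dual morphism_trivial_G)
  show "gbase trivial_G = gbase dual" by simp
  show "gbase product_groupoid = gbase trivial_G" by (simp add: transported_groupoid_simps)
  have arr: "arrows product_groupoid = pairs_mfd" by (rule transported_groupoid_simps)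
  show "arrs product_groupoid = {(v, h). v \<in> arrs trivial_G \<and> h \<in> arrs dual \<and> gsource trivial_G v = gtarget dual h}"
    unfolding arr points_pairs_mfd pairs_def ..
  show "embedded_submanifold (arrows product_groupoid) (prod_mfd (arrows trivial_G) (arrows dual))"
    unfolding arr by (rule embedded_pairs)
  have N: "smooth_manifold pairs_mfd" by (rule smap_source[OF smap_pairs])
  let ?m = "\<lambda>(v, h). gcomp product_groupoid (v, gunit dual (gsource trivial_G v)) (gunit trivial_G (gtarget dual h), h)"
  have m: "z = ?m z" if "z \<in> points pairs_mfd" for z
  proof -
    obtain v k where z: "z = (v, k)" by (cases z)
    have vk: "(v, k) \<in> pairs" using that unfolding z points_pairs_mfd .
    show ?thesis unfolding z prod.case by (rule product_of_factors[OF vk, symmetric])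
  qed
  have sm: "smap pairs_mfd pairs_mfd ?m" by (rule smap_cong[OF smap_ident[OF N] m])
  show "diffeomorphism (arrows product_groupoid) (arrows product_groupoid) ?m"
    unfolding arr by (rule diffeomorphismI[OF sm smap_ident[OF N] m[symmetric] m[symmetric]])
qed

end

theorem proposition5p2p3:
  fixes G :: "('a, 'g::real_inner) exp_lie_group"
    and H :: "('a, 'h::real_inner) exp_lie_group"
    and Gs :: "('d, 'g) exp_lie_group"
    and R :: "'g \<Rightarrow> 'g"
    and brs :: "('d \<Rightarrow> real) \<Rightarrow> ('d \<Rightarrow> real) \<Rightarrow> 'd \<Rightarrow> real"
    and dp :: "'a \<Rightarrow> 'd \<Rightarrow> 'd" and dm :: "'d \<Rightarrow> 'a \<Rightarrow> 'a"
    and Is :: "'d \<Rightarrow> 'h"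
  assumes G: "is_exp_lie_group G" "connected_space (mtop (mfd G))"
      "simply_connected_space (mtop (mfd G))"
    and H: "lie_subgroup H G" "connected_space (mtop (mfd H))"
      "simply_connected_space (mtop (mfd H))"
    and R_linear: "linear R"
    and R_skew: "\<And>A B. R A \<bullet> B = - (A \<bullet> R B)"
    and kappa_inv: "\<And>Y A B. ad G Y (kappa G R A B) + kappa G R (coad G Y A) B
        + kappa G R A (coad G Y B) = 0"
    and R_equiv: "\<And>Z A. R (coad G (lie_incl H G Z) A) + ad G (lie_incl H G Z) (R A) = 0"
    and Gs: "dual_poisson_lie_group G R Gs brs"
    and dp: "right_dressing_action G Gs brs dp"
    and dm: "left_dressing_action G Gs (r_bracket G R) dm"
    and dp_mult: "\<And>x u v. x \<in> carrier G \<Longrightarrow> u \<in> carrier Gs \<Longrightarrow> v \<in> carrier Gs \<Longrightarrow>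
        dp x (u \<otimes>\<^bsub>Gs\<^esub> v) = dp (dm v x) u \<otimes>\<^bsub>Gs\<^esub> dp x v"
    and dm_mult: "\<And>u x y. u \<in> carrier Gs \<Longrightarrow> x \<in> carrier G \<Longrightarrow> y \<in> carrier G \<Longrightarrow>
        dm u (x \<otimes>\<^bsub>G\<^esub> y) = dm u x \<otimes>\<^bsub>G\<^esub> dm (dp x u) y"
    and dm_fix: "\<And>u h. u \<in> carrier Gs \<Longrightarrow> h \<in> carrier H \<Longrightarrow> dm u h = h"
    and Is: "lie_hom Gs (vec_lie_group :: ('h, 'h) exp_lie_group) Is"
      "lie_diff Gs (vec_lie_group :: ('h, 'h) exp_lie_group) Is = adjoint (lie_incl H G)"
  shows "\<exists>P :: (('h \<times> 'a \<times> 'h) \<times> ('a \<times> 'h \<times> 'd), 'h,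
                 'h \<times> ('h \<times> 'g \<times> 'g) \<times> 'h, 'h) groupoid.
     matched_product (trivial_groupoid G) (dual_groupoid G H Gs dp Is) P \<and>
     groupoid_iso P (trivial_groupoid (prod_lie_group H (drinfeld_double G Gs dp dm)))"
proof -
  interpret lie_subgroup_pair G H
    using G H by unfold_locales (auto simp: lie_subgroup_def)
  interpret dressed_pair G H Gs brs dp Is dm
  proof unfold_locales
    show "is_exp_lie_group Gs" using Gs by (simp add: dual_poisson_lie_group_def)
  qed (use Gs dp dm H Is dp_mult dm_mult dm_fix in
      \<open>auto simp: dual_poisson_lie_group_def left_dressing_action_def\<close>)
  show ?thesis using matched_product_dual iso_product by blast
qed

end
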